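(* The family of Wishart distributions $\{\mathcal{W}_p(n,\Sigma)\}$ forms a symmetric monoidal category. The category $\mathcal{W}$ and its structure are the following. Objects: $\mathrm{Ob}(\mathcal{W})=\{\mathcal{W}_p(n,\Sigma)\mid p\in\mathbb{N},\ n\ge p,\ \Sigma\in\mathcal{S}_+^p\}$, where $p$ (the dimension) and $n$ (the degrees of freedom) are positive integers and $\mathcal{S}_+^p$ is the cone of symmetric positive definite $p\times p$ matrices. Morphisms: linear transformations between Wishart distributions. For a linear map $A\in\mathbb{R}^{q\times p}$ one has $A\mathbf{W}A^T\sim\mathcal{W}_q(n,A\Sigma A^T)$ when $\mathbf{W}\sim\mathcal{W}_p(n,\Sigma)$, and this induces the morphism $A:\mathcal{W}_p(n,\Sigma)\to\mathcal{W}_q(n,A\Sigma A^T)$. The identity morphism of $\mathcal{W}_p(n,\Sigma)$ is given by $A=I_p$. For $A\in\mathbb{R}^{q\times p}$ and $B\in\mathbb{R}^{r\times q}$, the composition is $B\circ A:\mathcal{W}_p(n,\Sigma)\to\mathcal{W}_r(n,BA\Sigma A^TB^T)$, corresponding to $\mathbf{W}\mapsto BA\mathbf{W}A^TB^T$. Tensor product: on objects, $$\mathcal{W}_{p_1}(n_1,\Sigma_1)\otimes\mathcal{W}_{p_2}(n_2,\Sigma_2)=\mathcal{W}_{p_1+p_2}(n_1+n_2,\Sigma_1\oplus\Sigma_2);$$ for morphisms $A_i:\mathcal{W}_{p_i}(n_i,\Sigma_i)\to\mathcal{W}_{q_i}(n_i,A_i\Sigma_iA_i^T)$, $i=1,2$,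 $$A_1\otimes A_2=A_1\oplus A_2:\ \mathcal{W}_{p_1+p_2}(n_1+n_2,\Sigma_1\oplus\Sigma_2)\to\mathcal{W}_{q_1+q_2}\bigl(n_1+n_2,(A_1\oplus A_2)(\Sigma_1\oplus\Sigma_2)(A_1\oplus A_2)^T\bigr).$$ Monoidal unit: $\mathcal{W}_0(0,0)$, representing the trivial Wishart distribution in dimension $0$, with $\mathcal{W}_p(n,\Sigma)\otimes\mathcal{W}_0(0,0)\cong\mathcal{W}_p(n,\Sigma)$. Symmetry: the braiding is the natural isomorphism $$\beta:\mathcal{W}_{p_1+p_2}(n_1+n_2,\Sigma_1\oplus\Sigma_2)\to\mathcal{W}_{p_2+p_1}(n_2+n_1,\Sigma_2\oplus\Sigma_1)$$ corresponding to swapping the block structure of $\Sigma_1\oplus\Sigma_2$.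
   Context: For a fixed symmetric positive definite $p\times p$ matrix $\Sigma$, a random symmetric positive semi-definite $p\times p$ matrix $\mathbf{W}$ has the Wishart distribution with $n$ degrees of freedom and scale matrix $\Sigma$, written $\mathbf{W}\sim\mathcal{W}_p(n,\Sigma)$, if it has the density $$f_{\mathbf{W}}=\frac{1}{2^{np/2}|\Sigma|^{n/2}\Gamma_p(n/2)}\,|\mathbf{W}|^{(n-p-1)/2}e^{-\frac12\operatorname{tr}(\Sigma^{-1}\mathbf{W})},\qquad \Gamma_p\!\left(\tfrac n2\right)=\pi^{p(p-1)/4}\prod_{j=1}^p\Gamma\!\left(\tfrac n2-\tfrac{j-1}2\right),$$ where $|\cdot|$ is the determinant. The symbol $\oplus$ denotes the block-diagonal matrix, e.g. $\Sigma_1\oplus\Sigma_2=\begin{pmatrix}\Sigma_1&0\\0&\Sigma_2\end{pmatrix}$. A symmetric monoidal category is a tuple $(\mathcal{C},\otimes,I,\alpha,\lambda,\rho,\gamma)$ consisting of a category, a bifunctor $\otimes:\mathcal{C}\times\mathcal{C}\to\mathcal{C}$, a unit object $I$, and natural isomorphisms (associator $\alpha$, left unitor $\lambda$, right unitor $\rho$, braiding $\gamma$) satisfying the usual pentagon and triangle conditions, with $\gamma_{B,A}\circ\gamma_{A,B}=\mathrm{id}_{A\otimes B}$ and $\gamma_{A,I}=\lambda_A^{-1}\circ\rho_A$.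
   Formalization: The claims for linear maps A in R^{q×p} (and B) are made only when the resulting scale matrix AΣA^T is positive definite (A of full row rank), as W_q(n,AΣA^T) is otherwise undefined; the unit W_0(0,0) is added to the listed objects. *)

theory Defs
  imports
    "HOL-Probability.Probability"
    "Jordan_Normal_Form.Gauss_Jordan_Elimination"
    "Jordan_Normal_Form.Determinant"
begin

section \<open>Symmetric monoidal categories\<close>

record ('o, 'a) category =
  Obj :: "'o set"
  Arr :: "'a set"
  Dom :: "'a \<Rightarrow> 'o"
  Cod :: "'a \<Rightarrow> 'o"
  Ide :: "'o \<Rightarrow> 'a"
  Cmp :: "'a \<Rightarrow> 'a \<Rightarrow> 'a"  (infixl \<open>\<cdot>\<index>\<close> 55)

definition Hom :: "('o, 'a) category \<Rightarrow> 'o \<Rightarrow> 'o \<Rightarrow> 'a set" where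
  "Hom C X Y = {f \<in> Arr C. Dom C f = X \<and> Cod C f = Y}"

locale category =
  fixes C :: "('o, 'a) category" (structure)
  assumes Dom_Obj: "f \<in> Arr C \<Longrightarrow> Dom C f \<in> Obj C"
    and Cod_Obj: "f \<in> Arr C \<Longrightarrow> Cod C f \<in> Obj C"
    and Ide_Hom: "X \<in> Obj C \<Longrightarrow> Ide C X \<in> Hom C X X"
    and Cmp_Hom: "\<lbrakk>f \<in> Hom C X Y; g \<in> Hom C Y Z\<rbrakk> \<Longrightarrow> g \<cdot> f \<in> Hom C X Z"
    and Cmp_Ide_left: "f \<in> Hom C X Y \<Longrightarrow> Ide C Y \<cdot> f = f"
    and Cmp_Ide_right: "f \<in> Hom C X Y \<Longrightarrow> f \<cdot> Ide C X = f"
    and Cmp_assoc: "\<lbrakk>f \<in> Hom C X Y; g \<in> Hom C Y Z; h \<in> Hom C Z U\<rbrakk>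
      \<Longrightarrow> (h \<cdot> g) \<cdot> f = h \<cdot> (g \<cdot> f)"

definition inverse_arrows :: "('o, 'a) category \<Rightarrow> 'a \<Rightarrow> 'a \<Rightarrow> bool" where
  "inverse_arrows C f g \<longleftrightarrow>
     f \<in> Arr C \<and> g \<in> Hom C (Cod C f) (Dom C f) \<and>
     g \<cdot>\<^bsub>C\<^esub> f = Ide C (Dom C f) \<and> f \<cdot>\<^bsub>C\<^esub> g = Ide C (Cod C f)"

definition iso_arrow :: "('o, 'a) category \<Rightarrow> 'a \<Rightarrow> bool" where
  "iso_arrow C f \<longleftrightarrow> (\<exists>g. inverse_arrows C f g)"

definition inv_arrow :: "('o, 'a) category \<Rightarrow> 'a \<Rightarrow> 'a" where
  "inv_arrow C f = (THE g. inverse_arrows C f g)"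

definition isomorphic :: "('o, 'a) category \<Rightarrow> 'o \<Rightarrow> 'o \<Rightarrow> bool" where
  "isomorphic C X Y \<longleftrightarrow> (\<exists>f \<in> Hom C X Y. iso_arrow C f)"

definition prod_cat ::
  "('o, 'a) category \<Rightarrow> ('p, 'b) category \<Rightarrow> ('o \<times> 'p, 'a \<times> 'b) category" where
  "prod_cat C D =
     \<lparr>Obj = Obj C \<times> Obj D,
      Arr = Arr C \<times> Arr D,
      Dom = map_prod (Dom C) (Dom D),
      Cod = map_prod (Cod C) (Cod D),
      Ide = map_prod (Ide C) (Ide D),
      Cmp = (\<lambda>(g, g') (f, f'). (g \<cdot>\<^bsub>C\<^esub> f, g' \<cdot>\<^bsub>D\<^esub> f'))\<rparr>"

locale is_functor = C: category C + D: category D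
  for C :: "('o, 'a) category" and D :: "('p, 'b) category" +
  fixes Fo :: "'o \<Rightarrow> 'p" and Fa :: "'a \<Rightarrow> 'b"
  assumes map_Obj: "X \<in> Obj C \<Longrightarrow> Fo X \<in> Obj D"
    and map_Hom: "f \<in> Hom C X Y \<Longrightarrow> Fa f \<in> Hom D (Fo X) (Fo Y)"
    and map_Ide: "X \<in> Obj C \<Longrightarrow> Fa (Ide C X) = Ide D (Fo X)"
    and map_Cmp: "\<lbrakk>f \<in> Hom C X Y; g \<in> Hom C Y Z\<rbrakk>
      \<Longrightarrow> Fa (g \<cdot>\<^bsub>C\<^esub> f) = Fa g \<cdot>\<^bsub>D\<^esub> Fa f"

locale natural_iso = F: is_functor C D Fo Fa + G: is_functor C D Go Ga
  for C :: "('o, 'a) category" and D :: "('p, 'b) category"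
    and Fo :: "'o \<Rightarrow> 'p" and Fa :: "'a \<Rightarrow> 'b"
    and Go :: "'o \<Rightarrow> 'p" and Ga :: "'a \<Rightarrow> 'b" +
  fixes \<eta> :: "'o \<Rightarrow> 'b"
  assumes component_Hom: "X \<in> Obj C \<Longrightarrow> \<eta> X \<in> Hom D (Fo X) (Go X)"
    and component_iso: "X \<in> Obj C \<Longrightarrow> iso_arrow D (\<eta> X)"
    and naturality: "f \<in> Hom C X Y
      \<Longrightarrow> Ga f \<cdot>\<^bsub>D\<^esub> \<eta> X = \<eta> Y \<cdot>\<^bsub>D\<^esub> Fa f"

text \<open>The tensor product is a functor on \<open>prod_cat C C\<close>, so its object and arrow parts take pairs.
  The hexagon identity is part of the usual notion and is required here as well.\<close>

locale symmetric_monoidal_category =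
  category C + tensor: is_functor "prod_cat C C" C To Ta
  for C :: "('o, 'a) category" (structure)
    and To :: "'o \<times> 'o \<Rightarrow> 'o" and Ta :: "'a \<times> 'a \<Rightarrow> 'a" +
  fixes I :: 'o
    and \<alpha> :: "'o \<Rightarrow> 'o \<Rightarrow> 'o \<Rightarrow> 'a"
    and lun :: "'o \<Rightarrow> 'a"
    and run :: "'o \<Rightarrow> 'a"
    and \<gamma> :: "'o \<Rightarrow> 'o \<Rightarrow> 'a"
  assumes unit_Obj: "I \<in> Obj C"
    and associator: "natural_iso (prod_cat (prod_cat C C) C) C
      (\<lambda>((X, Y), Z). To (To (X, Y), Z)) (\<lambda>((f, g), h). Ta (Ta (f, g), h))
      (\<lambda>((X, Y), Z). To (X, To (Y, Z))) (\<lambda>((f, g), h). Ta (f, Ta (g, h)))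
      (\<lambda>((X, Y), Z). \<alpha> X Y Z)"
    and left_unitor: "natural_iso C C
      (\<lambda>X. To (I, X)) (\<lambda>f. Ta (Ide C I, f)) (\<lambda>X. X) (\<lambda>f. f) lun"
    and right_unitor: "natural_iso C C
      (\<lambda>X. To (X, I)) (\<lambda>f. Ta (f, Ide C I)) (\<lambda>X. X) (\<lambda>f. f) run"
    and braiding: "natural_iso (prod_cat C C) C
      To Ta (\<lambda>(X, Y). To (Y, X)) (\<lambda>(f, g). Ta (g, f)) (\<lambda>(X, Y). \<gamma> X Y)"
    and pentagon: "\<lbrakk>X \<in> Obj C; Y \<in> Obj C; Z \<in> Obj C; U \<in> Obj C\<rbrakk> \<Longrightarrow>
      \<alpha> X Y (To (Z, U)) \<cdot> \<alpha> (To (X, Y)) Z U =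
      Ta (Ide C X, \<alpha> Y Z U) \<cdot> \<alpha> X (To (Y, Z)) U \<cdot> Ta (\<alpha> X Y Z, Ide C U)"
    and triangle: "\<lbrakk>X \<in> Obj C; Y \<in> Obj C\<rbrakk> \<Longrightarrow>
      Ta (Ide C X, lun Y) \<cdot> \<alpha> X I Y = Ta (run X, Ide C Y)"
    and hexagon: "\<lbrakk>X \<in> Obj C; Y \<in> Obj C; Z \<in> Obj C\<rbrakk> \<Longrightarrow>
      \<alpha> Y Z X \<cdot> \<gamma> X (To (Y, Z)) \<cdot> \<alpha> X Y Z =
      Ta (Ide C Y, \<gamma> X Z) \<cdot> \<alpha> Y X Z \<cdot> Ta (\<gamma> X Y, Ide C Z)"
    and symmetry: "\<lbrakk>X \<in> Obj C; Y \<in> Obj C\<rbrakk> \<Longrightarrow> \<gamma> Y X \<cdot> \<gamma> X Y = Ide C (To (X, Y))"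
    and braiding_unit: "X \<in> Obj C \<Longrightarrow> \<gamma> X I = inv_arrow C (lun X) \<cdot> run X"

section \<open>Matrices\<close>

definition sym_mats :: "nat \<Rightarrow> real mat set" where
  "sym_mats p = {A \<in> carrier_mat p p. A\<^sup>T = A}"

definition psd_mats :: "nat \<Rightarrow> real mat set" where
  "psd_mats p = {A \<in> sym_mats p. \<forall>v \<in> carrier_vec p. 0 \<le> scalar_prod v (A *\<^sub>v v)}"

definition pd_mats :: "nat \<Rightarrow> real mat set" where
  "pd_mats p =
     {A \<in> sym_mats p. \<forall>v \<in> carrier_vec p. v \<noteq> 0\<^sub>v p \<longrightarrow> 0 < scalar_prod v (A *\<^sub>v v)}"

definition mat_trace :: "real mat \<Rightarrow> real" where
  "mat_trace A = (\<Sum>i<dim_row A. A $$ (i, i))"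

definition dsum_mat :: "real mat \<Rightarrow> real mat \<Rightarrow> real mat"  (infixr \<open>\<oplus>\<^sub>m\<close> 65) where
  "A \<oplus>\<^sub>m B =
     four_block_mat A (0\<^sub>m (dim_row A) (dim_col B)) (0\<^sub>m (dim_row B) (dim_col A)) B"

text \<open>The matrix of \<open>(x, y) \<mapsto> (y, x)\<close> for \<open>x\<close> of length \<open>p\<close> and \<open>y\<close> of length \<open>q\<close>.\<close>

definition swap_mat :: "nat \<Rightarrow> nat \<Rightarrow> real mat" where
  "swap_mat p q = four_block_mat (0\<^sub>m q p) (1\<^sub>m q) (1\<^sub>m p) (0\<^sub>m p q)"

section \<open>Wishart distributions\<close>

definition upper_idx :: "nat \<Rightarrow> (nat \<times> nat) set" where
  "upper_idx p = {(i, j). i \<le> j \<and> j < p}"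

definition sym_of_upper :: "nat \<Rightarrow> (nat \<times> nat \<Rightarrow> real) \<Rightarrow> real mat" where
  "sym_of_upper p w = mat p p (\<lambda>(i, j). w (min i j, max i j))"

text \<open>The reference measure of the density: Lebesgue measure in the entries on and above the
  diagonal, transported to the space of symmetric matrices. For \<open>p = 0\<close> it is the unit mass at the
  empty matrix.\<close>

definition sym_lborel :: "nat \<Rightarrow> real mat measure" where
  "sym_lborel p = embed_measure (Pi\<^sub>M (upper_idx p) (\<lambda>_. lborel)) (sym_of_upper p)"

definition mv_Gamma :: "nat \<Rightarrow> real \<Rightarrow> real" where
  "mv_Gamma p a =
     pi powr (real p * (real p - 1) / 4) * (\<Prod>j = 1..p. Gamma (a - (real j - 1) / 2))"

definition wishart_density :: "nat \<Rightarrow> nat \<Rightarrow> real mat \<Rightarrow> real mat \<Rightarrow> ennreal" where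
  "wishart_density p n \<Sigma> W =
     (if W \<in> psd_mats p then
        ennreal (1 / (2 powr (real n * real p / 2) * Determinant.det \<Sigma> powr (real n / 2)
                        * mv_Gamma p (real n / 2))
          * Determinant.det W powr ((real n - real p - 1) / 2)
          * exp (- (1 / 2) * mat_trace (the (mat_inverse \<Sigma>) * W)))
      else 0)"

definition wishart :: "nat \<Rightarrow> nat \<Rightarrow> real mat \<Rightarrow> real mat measure" where
  "wishart p n \<Sigma> = density (sym_lborel p) (wishart_density p n \<Sigma>)"

definition has_wishart ::
  "'w measure \<Rightarrow> ('w \<Rightarrow> real mat) \<Rightarrow> nat \<Rightarrow> nat \<Rightarrow> real mat \<Rightarrow> bool" where
  "has_wishart M W p n \<Sigma> \<longleftrightarrow>
     prob_space M \<and> distributed M (sym_lborel p) W (wishart_density p n \<Sigma>)"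

text \<open>The admissible parameters: those of the family proper, and \<open>(0, 0, 0)\<close> for the unit. Other
  degrees of freedom are excluded in dimension \<open>0\<close>, where \<open>wishart 0 n \<Sigma>\<close> does not determine \<open>n\<close>.\<close>

definition wishart_param :: "nat \<Rightarrow> nat \<Rightarrow> real mat \<Rightarrow> bool" where
  "wishart_param p n \<Sigma> \<longleftrightarrow>
     0 < p \<and> p \<le> n \<and> \<Sigma> \<in> pd_mats p \<or> p = 0 \<and> n = 0 \<and> \<Sigma> = 0\<^sub>m 0 0"

definition param_of :: "real mat measure \<Rightarrow> nat \<times> nat \<times> real mat" where
  "param_of X = (THE (p, n, \<Sigma>). wishart_param p n \<Sigma> \<and> X = wishart p n \<Sigma>)"

definition wdim :: "real mat measure \<Rightarrow> nat" where
  "wdim X = fst (param_of X)"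

definition wdof :: "real mat measure \<Rightarrow> nat" where
  "wdof X = fst (snd (param_of X))"

definition wscale :: "real mat measure \<Rightarrow> real mat" where
  "wscale X = snd (snd (param_of X))"

section \<open>The Wishart category\<close>

text \<open>An arrow is a matrix together with its source and target distributions.\<close>

datatype warrow =
  WArrow (wsource: "real mat measure") (wmatrix: "real mat") (wtarget: "real mat measure")

definition wishart_objects :: "real mat measure set" where
  "wishart_objects =
     {wishart p n \<Sigma> | p n \<Sigma>. 0 < p \<and> p \<le> n \<and> \<Sigma> \<in> pd_mats p} \<union> {wishart 0 0 (0\<^sub>m 0 0)}"

definition wishart_arrows :: "warrow set" where
  "wishart_arrows =
     {WArrow (wishart p n \<Sigma>) A (wishart q n (A * \<Sigma> * A\<^sup>T)) | p n \<Sigma> q A.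
        wishart_param p n \<Sigma> \<and> A \<in> carrier_mat q p \<and> wishart_param q n (A * \<Sigma> * A\<^sup>T)}"

definition wishart_cat :: "(real mat measure, warrow) category" where
  "wishart_cat =
     \<lparr>Obj = wishart_objects,
      Arr = wishart_arrows,
      Dom = wsource,
      Cod = wtarget,
      Ide = (\<lambda>X. WArrow X (1\<^sub>m (wdim X)) X),
      Cmp = (\<lambda>g f. WArrow (wsource f) (wmatrix g * wmatrix f) (wtarget g))\<rparr>"

definition wtensor_obj :: "real mat measure \<times> real mat measure \<Rightarrow> real mat measure" where
  "wtensor_obj = (\<lambda>(X, Y).
     wishart (wdim X + wdim Y) (wdof X + wdof Y) (wscale X \<oplus>\<^sub>m wscale Y))"

definition wtensor_arr :: "warrow \<times> warrow \<Rightarrow> warrow" where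
  "wtensor_arr = (\<lambda>(f, g).
     WArrow (wtensor_obj (wsource f, wsource g)) (wmatrix f \<oplus>\<^sub>m wmatrix g)
       (wtensor_obj (wtarget f, wtarget g)))"

definition wunit :: "real mat measure" where
  "wunit = wishart 0 0 (0\<^sub>m 0 0)"

definition wassoc :: "real mat measure \<Rightarrow> real mat measure \<Rightarrow> real mat measure \<Rightarrow> warrow" where
  "wassoc X Y Z =
     WArrow (wtensor_obj (wtensor_obj (X, Y), Z)) (1\<^sub>m (wdim X + wdim Y + wdim Z))
       (wtensor_obj (X, wtensor_obj (Y, Z)))"

definition wlunit :: "real mat measure \<Rightarrow> warrow" where
  "wlunit X = WArrow (wtensor_obj (wunit, X)) (1\<^sub>m (wdim X)) X"

definition wrunit :: "real mat measure \<Rightarrow> warrow" where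
  "wrunit X = WArrow (wtensor_obj (X, wunit)) (1\<^sub>m (wdim X)) X"

definition wbraid :: "real mat measure \<Rightarrow> real mat measure \<Rightarrow> warrow" where
  "wbraid X Y =
     WArrow (wtensor_obj (X, Y)) (swap_mat (wdim X) (wdim Y)) (wtensor_obj (Y, X))"

end

theory Submission
  imports Defs
begin

text \<open>The density of \<open>A W A\<^sup>T\<close> for invertible \<open>A\<close> follows from the Jacobian \<open>\<bar>det A\<bar>\<^sup>p\<^sup>+\<^sup>1\<close> of the
  congruence \<open>W \<mapsto> A W A\<^sup>T\<close> on symmetric matrices. This Jacobian is multiplicative in \<open>A\<close>, and for an
  elementary matrix the congruence is a triangular substitution in the upper entries. A surjective
  \<open>A\<close> is an invertible matrix followed by the deletion of rows, so only deleting the last row and column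
  remains; by a Cholesky factorization \<open>\<Sigma> = L L\<^sup>T\<close> with lower triangular \<open>L\<close> this reduces to
  \<open>\<Sigma> = 1\<close>. There one writes a positive definite matrix with leading block \<open>V = L L\<^sup>T\<close>, last column
  \<open>L z\<close> and corner \<open>\<bar>z\<bar>\<^sup>2 + s\<close>: the density factors into that of \<open>V\<close>, a Gaussian in \<open>z\<close> and a Gamma
  density in \<open>s\<close>. The same factorization shows by induction on the dimension that the density has total mass 1.

  The category is well defined because a Wishart distribution determines its parameters. The
  images \<open>v\<^sup>T W v\<close> reduce this to dimension 1, where the first two moments \<open>n s\<close> and
  \<open>n (n + 2) s\<^sup>2\<close> determine \<open>n\<close> and \<open>s\<close>. In these parameters the tensor product is strictly associative
  and unital, so the associator and the unitors are identities, and only the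
  braiding by block swaps is nontrivial.\<close>

text \<open>Objects are bare measures, so dimension, degrees of freedom and scale must be read back
  from a measure; this is why identifiability comes before any categorical law. An arrow must end in
  a distribution that again has a density, so \<open>A * \<Sigma> * A\<^sup>T\<close> has to stay
  positive definite. This forces \<open>A\<^sup>T\<close> to be injective, hence
  \<open>q \<le> p\<close>, and it is what allows \<open>A\<close> to be completed to an invertible
  square matrix. The density is declared on semidefinite matrices, whereas Cholesky coordinates
  exist only on definite ones. No null set enters: \<open>0 powr a = 0\<close> for every
  \<open>a\<close>, so the density is exactly 0 at each singular matrix, whatever the sign of its
  exponent. The moments in dimension 1 require no integration of their own. Multiplying the density
  by \<open>det W\<close> raises \<open>n\<close> by 2, so moments are quotients of normalizing
  constants, known once the total mass is 1 for every \<open>n\<close>.\<close>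

unbundle no inner_syntax
hide_const (open) Determinants.det

abbreviation congr :: "real mat \<Rightarrow> real mat \<Rightarrow> real mat" where
  "congr A W \<equiv> A * W * A\<^sup>T"

section \<open>Positive definite matrices\<close>

lemma sym_mats_congr:
  assumes "W \<in> sym_mats p" "A \<in> carrier_mat q p"
  shows "congr A W \<in> sym_mats q"
proof -
  have W: "W \<in> carrier_mat p p" "W\<^sup>T = W" using assms by (auto simp: sym_mats_def)
  have "(congr A W)\<^sup>T = A * (W\<^sup>T * A\<^sup>T)"
    using assms W by (subst transpose_mult[of _ q p _ q]) (auto simp: transpose_mult[of A q p W p])
  also have "\<dots> = congr A W" using assms W by (simp add: assoc_mult_mat[of A q p W p "A\<^sup>T" q])
  finally show ?thesis using assms W by (auto simp: sym_mats_def)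
qed

lemma congr_congr:
  fixes A :: "real mat"
  assumes A: "A \<in> carrier_mat q p" and B: "B \<in> carrier_mat r q" and W: "W \<in> carrier_mat p p"
  shows "congr (B * A) W = congr B (congr A W)"
proof -
  have AT: "A\<^sup>T \<in> carrier_mat p q" and BT: "B\<^sup>T \<in> carrier_mat q r"
    and AW: "A * W \<in> carrier_mat q p"
    using assms by auto
  have "congr (B * A) W = B * (A * W) * (A\<^sup>T * B\<^sup>T)"
    by (simp only: transpose_mult[OF B A] assoc_mult_mat[OF B A W])
  also have "\<dots> = B * (A * W) * A\<^sup>T * B\<^sup>T"
    by (rule assoc_mult_mat[symmetric, OF mult_carrier_mat[OF B AW] AT BT])
  also have "\<dots> = congr B (congr A W)"
    by (simp only: assoc_mult_mat[OF B AW AT])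
  finally show ?thesis .
qed

lemma quad_form_congr:
  fixes A :: "real mat"
  assumes "W \<in> carrier_mat p p" "A \<in> carrier_mat q p" "v \<in> carrier_vec q"
  shows "v \<bullet> (congr A W *\<^sub>v v) = (A\<^sup>T *\<^sub>v v) \<bullet> (W *\<^sub>v (A\<^sup>T *\<^sub>v v))"
proof -
  have "congr A W *\<^sub>v v = A *\<^sub>v (W *\<^sub>v (A\<^sup>T *\<^sub>v v))"
    using assms by (simp add: assoc_mult_mat_vec[of _ q p _ q] assoc_mult_mat_vec[of _ q p _ p] assoc_mult_mat[of A q p W p "A\<^sup>T" q])
  also have "v \<bullet> \<dots> = (A\<^sup>T *\<^sub>v v) \<bullet> (W *\<^sub>v (A\<^sup>T *\<^sub>v v))"
    using transpose_vec_mult_scalar[of A q p "W *\<^sub>v (A\<^sup>T *\<^sub>v v)" v] assms by simp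
  finally show ?thesis .
qed

lemma pd_mats_carrier: "\<Sigma> \<in> pd_mats p \<Longrightarrow> \<Sigma> \<in> carrier_mat p p"
  and pd_mats_sym: "\<Sigma> \<in> pd_mats p \<Longrightarrow> \<Sigma> \<in> sym_mats p"
  and sym_mats_carrier: "\<Sigma> \<in> sym_mats p \<Longrightarrow> \<Sigma> \<in> carrier_mat p p"
  by (auto simp: pd_mats_def sym_mats_def)

lemma pd_mats_subset_psd_mats: "pd_mats p \<subseteq> psd_mats p"
proof
  fix A assume A: "A \<in> pd_mats p"
  have "0 \<le> v \<bullet> (A *\<^sub>v v)" if "v \<in> carrier_vec p" for v
    using that A pd_mats_carrier[OF A] by (cases "v = 0\<^sub>v p") (auto simp: pd_mats_def less_imp_le)
  with A show "A \<in> psd_mats p" by (auto simp: pd_mats_def psd_mats_def)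
qed

lemma psd_mats_congr:
  assumes "W \<in> psd_mats p" "A \<in> carrier_mat q p"
  shows "congr A W \<in> psd_mats q"
  using assms sym_mats_congr[of W p A q] quad_form_congr[of W p A q]
  by (auto simp: psd_mats_def sym_mats_carrier)

lemma pd_mats_congr:
  assumes "W \<in> pd_mats p" "A \<in> carrier_mat q p"
    and inj: "\<And>v. v \<in> carrier_vec q \<Longrightarrow> A\<^sup>T *\<^sub>v v = 0\<^sub>v p \<Longrightarrow> v = 0\<^sub>v q"
  shows "congr A W \<in> pd_mats q"
proof -
  have "0 < v \<bullet> (congr A W *\<^sub>v v)" if "v \<in> carrier_vec q" "v \<noteq> 0\<^sub>v q" for v
  proof -
    have "A\<^sup>T *\<^sub>v v \<in> carrier_vec p" "A\<^sup>T *\<^sub>v v \<noteq> 0\<^sub>v p" using that inj[of v] assms(2) by auto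
    then have "0 < (A\<^sup>T *\<^sub>v v) \<bullet> (W *\<^sub>v (A\<^sup>T *\<^sub>v v))" using assms(1) unfolding pd_mats_def by blast
    then show ?thesis using quad_form_congr[OF pd_mats_carrier[OF assms(1)] assms(2) that(1)] by simp
  qed
  then show ?thesis
    using assms sym_mats_congr[of W p A q] by (auto simp: pd_mats_def)
qed

text \<open>A kernel vector of \<open>A\<^sup>T\<close> would be a null vector of the quadratic form
  of the image. This turns the condition on the target of an arrow into full row rank of
  \<open>A\<close>.\<close>

lemma pd_mats_congr_inj:
  assumes "congr A W \<in> pd_mats q" "A \<in> carrier_mat q p" "W \<in> carrier_mat p p"
    "v \<in> carrier_vec q" "A\<^sup>T *\<^sub>v v = 0\<^sub>v p"
  shows "v = 0\<^sub>v q"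
proof (rule ccontr)
  assume "v \<noteq> 0\<^sub>v q"
  then have "0 < v \<bullet> (congr A W *\<^sub>v v)" using assms by (auto simp: pd_mats_def)
  then show False using assms by (subst (asm) quad_form_congr[of W p A q]) auto
qed

lemma det_nonzero_transpose_inj:
  assumes "(B :: real mat) \<in> carrier_mat p p" "det B \<noteq> 0"
    "v \<in> carrier_vec p" "B\<^sup>T *\<^sub>v v = 0\<^sub>v p"
  shows "v = 0\<^sub>v p"
  using det_0_iff_vec_prod_zero[of "B\<^sup>T" p] assms by (auto simp: det_transpose[of B p])

lemma ex_inverse_mat:
  assumes "(B :: real mat) \<in> carrier_mat p p" "det B \<noteq> 0"
  obtains C where "C \<in> carrier_mat p p" "B * C = 1\<^sub>m p" "C * B = 1\<^sub>m p"
    "det C = 1 / det B"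
proof -
  obtain C where C: "C \<in> carrier_mat p p" "B * C = 1\<^sub>m p" "C * B = 1\<^sub>m p"
    using det_non_zero_imp_unit[OF assms, of undefined] by (auto simp: Units_def ring_mat_def)
  then have "det B * det C = 1" using assms det_mult[of B p C] by simp
  then have "det C = 1 / det B" using assms by (simp add: field_simps)
  with C that show ?thesis by auto
qed

lemma mat_inverse_eq:
  assumes "(B :: real mat) \<in> carrier_mat p p" "C \<in> carrier_mat p p" "B * C = 1\<^sub>m p"
  shows "mat_inverse B = Some C"
proof -
  have CB: "C * B = 1\<^sub>m p" using assms mat_mult_left_right_inverse by blast
  have "B \<in> Units (ring_mat TYPE(real) p undefined)"
    using assms CB by (auto simp: Units_def ring_mat_def)
  then obtain D where D: "mat_inverse B = Some D"
    using mat_inverse(1)[OF assms(1), of undefined] by (cases "mat_inverse B") auto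
  have D': "B * D = 1\<^sub>m p" "D * B = 1\<^sub>m p" "D \<in> carrier_mat p p"
    using mat_inverse(2)[OF assms(1) D] by auto
  have "D = D * B * C"
    by (simp only: assoc_mult_mat[OF D'(3) assms(1,2)] assms(3) right_mult_one_mat[OF D'(3)])
  also have "\<dots> = C" by (simp only: D'(2) left_mult_one_mat[OF assms(2)])
  finally have "D = C" .
  with D show ?thesis by simp
qed

lemma congr_inverse:
  assumes "(B :: real mat) \<in> carrier_mat p p" "C \<in> carrier_mat p p" "C * B = 1\<^sub>m p" "W \<in> carrier_mat p p"
  shows "congr C (congr B W) = W"
  using congr_congr[of B p p C p W] assms by simp

lemma psd_mats_congr_iff:
  assumes "(B :: real mat) \<in> carrier_mat p p" "det B \<noteq> 0" "W \<in> carrier_mat p p"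
  shows "congr B W \<in> psd_mats p \<longleftrightarrow> W \<in> psd_mats p"
proof -
  obtain C where C: "C \<in> carrier_mat p p" "C * B = 1\<^sub>m p" using ex_inverse_mat[OF assms(1,2)] by metis
  show ?thesis
    using psd_mats_congr[OF _ C(1), of "congr B W"] psd_mats_congr[OF _ assms(1), of W]
    by (metis congr_inverse[OF assms(1) C assms(3)])
qed

lemma pd_mats_congr_iff:
  assumes "(B :: real mat) \<in> carrier_mat p p" "det B \<noteq> 0" "W \<in> carrier_mat p p"
  shows "congr B W \<in> pd_mats p \<longleftrightarrow> W \<in> pd_mats p"
proof -
  obtain C where C: "C \<in> carrier_mat p p" "C * B = 1\<^sub>m p" "det C = 1 / det B"
    using ex_inverse_mat[OF assms(1,2)] by metis
  have detC: "det C \<noteq> 0" using C(3) assms(2) by simp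
  have "congr C (congr B W) \<in> pd_mats p" if "congr B W \<in> pd_mats p"
    using that C(1) det_nonzero_transpose_inj[OF C(1) detC] by (rule pd_mats_congr)
  then have "W \<in> pd_mats p" if "congr B W \<in> pd_mats p"
    using that unfolding congr_inverse[OF assms(1) C(1,2) assms(3)] .
  moreover have "congr B W \<in> pd_mats p" if "W \<in> pd_mats p"
    using that assms(1) det_nonzero_transpose_inj[OF assms(1,2)] by (rule pd_mats_congr)
  ultimately show ?thesis by blast
qed

text \<open>For a semidefinite \<open>W\<close>, a vector \<open>v\<close> with zero quadratic form
  already lies in the kernel: moving from \<open>v\<close> in the direction \<open>u = W v\<close>
  changes the form by \<open>2 * t * d + t\<^sup>2 * c\<close> with \<open>d\<close> the squared
  length of \<open>u\<close>, which is negative for some \<open>t\<close> unless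
  \<open>u = 0\<close>.\<close>

lemma psd_mats_det_nonzero_pd:
  assumes W: "W \<in> psd_mats p" and det: "det W \<noteq> 0"
  shows "W \<in> pd_mats p"
proof -
  have Wc: "W \<in> carrier_mat p p" and Wt: "W\<^sup>T = W"
    using W by (auto simp: psd_mats_def sym_mats_def)
  have "v = 0\<^sub>v p" if v: "v \<in> carrier_vec p" and v0: "v \<bullet> (W *\<^sub>v v) = 0" for v
  proof -
    define u where "u = W *\<^sub>v v"
    have u: "u \<in> carrier_vec p" using Wc v by (simp add: u_def)
    define c where "c = u \<bullet> (W *\<^sub>v u)"
    define d where "d = u \<bullet> u"
    have Wu: "W *\<^sub>v u \<in> carrier_vec p" using Wc u by simp
    have vWu: "v \<bullet> (W *\<^sub>v u) = d"
      using transpose_vec_mult_scalar[of W p p u v] Wc Wt v u by (simp add: d_def u_def)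
    have d0: "d \<ge> 0" by (simp add: d_def scalar_prod_def sum_nonneg)
    have key: "0 \<le> 2 * t * d + t\<^sup>2 * c" for t
    proof -
      have "(v + t \<cdot>\<^sub>v u) \<bullet> (W *\<^sub>v (v + t \<cdot>\<^sub>v u)) = (v + t \<cdot>\<^sub>v u) \<bullet> (u + t \<cdot>\<^sub>v (W *\<^sub>v u))"
        using Wc v u by (simp add: mult_add_distrib_mat_vec[of W p p] mult_mat_vec[of W p p] u_def)
      also have "\<dots> = v \<bullet> u + t * (v \<bullet> (W *\<^sub>v u)) + t * (u \<bullet> u) + t * t * c"
        using v u Wu by (simp add: scalar_prod_add_distrib[of _ p] add_scalar_prod_distrib[of _ p] c_def algebra_simps)
      also have "\<dots> = 2 * t * d + t\<^sup>2 * c"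
        using v0 vWu by (simp add: u_def d_def power2_eq_square)
      finally have eq: "(v + t \<cdot>\<^sub>v u) \<bullet> (W *\<^sub>v (v + t \<cdot>\<^sub>v u)) = 2 * t * d + t\<^sup>2 * c" .
      have "v + t \<cdot>\<^sub>v u \<in> carrier_vec p" using v u by simp
      then have "0 \<le> (v + t \<cdot>\<^sub>v u) \<bullet> (W *\<^sub>v (v + t \<cdot>\<^sub>v u))"
        using W unfolding psd_mats_def by blast
      then show ?thesis unfolding eq .
    qed
    have c0: "c \<ge> 0" using W u by (auto simp: psd_mats_def c_def)
    have "d = 0"
    proof (rule ccontr)
      assume "d \<noteq> 0"
      then have d: "d > 0" using d0 by simp
      \<comment> \<open>For \<open>c > 0\<close> the quadratic is minimal at \<open>- d / c\<close>;
        adding 1 to the denominator also covers \<open>c = 0\<close> and keeps the value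
        negative.\<close>
      define t where "t = - d / (c + 1)"
      have "2 * t * d + t\<^sup>2 * c = (d\<^sup>2 / (c+1)) * (c / (c + 1) - 2)"
        using c0 by (simp add: t_def power2_eq_square divide_simps) (simp add: algebra_simps)
      moreover have "c / (c + 1) - 2 < 0" using c0 by (simp add: divide_simps)
      moreover have "d\<^sup>2 / (c+1) > 0" using d c0 by simp
      ultimately have "2 * t * d + t\<^sup>2 * c < 0" by (metis mult_pos_neg)
      then show False using key[of t] by simp
    qed
    then have "u = 0\<^sub>v p" using u by (auto simp: d_def scalar_prod_def sum_nonneg_eq_0_iff intro!: eq_vecI)
    then show ?thesis using det det_0_iff_vec_prod_zero[OF Wc] v by (auto simp: u_def)
  qed
  then show ?thesis using W
    by (auto simp: pd_mats_def psd_mats_def order_less_le)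
qed

text \<open>Gaussian elimination read backwards as an induction rule. Row swaps are avoided: a
  vanishing pivot is repaired by adding a lower row. What remains are row additions and scalings,
  whose congruences act triangularly on the upper entries.\<close>

lemma det_nonzero_mat_induct:
  fixes B :: "real mat"
  assumes B: "B \<in> carrier_mat p p" "det B \<noteq> 0"
    and one: "P (1\<^sub>m p)"
    and add: "\<And>a k l M. M \<in> carrier_mat p p \<Longrightarrow> det M \<noteq> 0 \<Longrightarrow> k < p \<Longrightarrow> l < p \<Longrightarrow> k \<noteq> l
      \<Longrightarrow> P M \<Longrightarrow> P (addrow_mat p a k l * M)"
    and mult: "\<And>a k M. M \<in> carrier_mat p p \<Longrightarrow> det M \<noteq> 0 \<Longrightarrow> k < p \<Longrightarrow> a \<noteq> 0
      \<Longrightarrow> P M \<Longrightarrow> P (multrow_mat p k a * M)"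
  shows "P B"
proof -
  \<comment> \<open>\<open>P\<close> is known for the reduced matrix; the inverse row operation,
    again elementary of the same kind, carries it back to \<open>M\<close>.\<close>
  have unadd: "P M" if M: "M \<in> carrier_mat p p" "det M \<noteq> 0" and kl: "k < p" "l < p" "k \<noteq> l"
    and P: "P (addrow a k l M)" for a k l M
  proof -
    have "M = addrow (-a) k l (addrow a k l M)"
      by (rule eq_matI) (use M kl in auto)
    also have "\<dots> = addrow_mat p (-a) k l * addrow a k l M"
      by (rule addrow_mat) (use M kl in auto)
    finally have "M = addrow_mat p (-a) k l * addrow a k l M" .
    moreover have "P (addrow_mat p (-a) k l * addrow a k l M)"
      using M kl P by (intro add) (auto simp: det_addrow[of l p k M a])
    ultimately show ?thesis by simp
  qed
  have unmult: "P M" if M: "M \<in> carrier_mat p p" "det M \<noteq> 0" and k: "k < p" "a \<noteq> 0"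
    and P: "P (multrow k a M)" for a k M
  proof -
    have "M = multrow k (1/a) (multrow k a M)"
      by (rule eq_matI) (use M k in auto)
    also have "\<dots> = multrow_mat p k (1/a) * multrow k a M"
      by (rule multrow_mat) (use M k in auto)
    finally have "M = multrow_mat p k (1/a) * multrow k a M" .
    moreover have "P (multrow_mat p k (1/a) * multrow k a M)"
      using M k P by (intro mult) (auto simp: det_multrow[of k p M a])
    ultimately show ?thesis by simp
  qed
  \<comment> \<open>\<open>E k M\<close> says that the first \<open>k\<close> columns are already
    those of the identity. The induction starts at \<open>k = p\<close>, where \<open>M\<close> is
    the identity, and goes down to \<open>k = 0\<close>.\<close>
  define E where "E k M \<longleftrightarrow> M \<in> carrier_mat p p \<and> det M \<noteq> 0 \<and>
    (\<forall>i<p. \<forall>j<k. M $$ (i, j) = (if i = j then 1 else 0))" for k and M :: "real mat"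
  have "\<forall>M. E 0 M \<longrightarrow> P M"
  proof (rule inc_induct[of 0 p])
    show "\<forall>M. E p M \<longrightarrow> P M"
    proof safe
      fix M assume "E p M"
      then have "M = 1\<^sub>m p" by (intro eq_matI) (auto simp: E_def)
      with one show "P M" by simp
    qed
  next
    fix k assume k: "k < p" and IH: "\<forall>M. E (Suc k) M \<longrightarrow> P M"
    \<comment> \<open>With pivot 1, column \<open>k\<close> is cleared one entry at a time; the
      number of its nonzero entries off the diagonal decreases.\<close>
    have clear: "P M" if "E k M" "M $$ (k, k) = 1" for M
      using that
    proof (induction "card {j. j < p \<and> j \<noteq> k \<and> M $$ (j, k) \<noteq> 0}" arbitrary: M)
      case 0
      then have "\<forall>j<p. j \<noteq> k \<longrightarrow> M $$ (j, k) = 0" by auto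
      then have "E (Suc k) M" using 0 by (auto simp: E_def less_Suc_eq)
      with IH show ?case by blast
    next
      case (Suc m)
      have "{j. j < p \<and> j \<noteq> k \<and> M $$ (j, k) \<noteq> 0} \<noteq> {}" using Suc.hyps(2) by (metis card.empty nat.distinct(1))
      then obtain j where j: "j < p" "j \<noteq> k" "M $$ (j, k) \<noteq> 0" by blast
      have M: "M \<in> carrier_mat p p" "det M \<noteq> 0" using Suc.prems by (auto simp: E_def)
      define M' where "M' = addrow (- (M $$ (j, k))) j k M"
      have entry: "M' $$ (i, l) = (if i = j then - (M $$ (j, k)) * M $$ (k, l) + M $$ (j, l) else M $$ (i, l))"
        if "i < p" "l < p" for i l using that M by (auto simp: M'_def)
      have "{i. i < p \<and> i \<noteq> k \<and> M' $$ (i, k) \<noteq> 0} = {i. i < p \<and> i \<noteq> k \<and> M $$ (i, k) \<noteq> 0} - {j}"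
        using entry k j Suc.prems(2) by (auto split: if_splits)
      then have c: "m = card {i. i < p \<and> i \<noteq> k \<and> M' $$ (i, k) \<noteq> 0}" using Suc.hyps(2) j by simp
      have "det M' \<noteq> 0" "M' \<in> carrier_mat p p"
        using M j k det_addrow[of k p j M] by (auto simp: M'_def)
      then have "E k M'" using Suc.prems k entry by (auto simp: E_def)
      moreover have "M' $$ (k, k) = 1" using entry k j Suc.prems(2) by auto
      ultimately have "P M'" using Suc.hyps(1)[OF c] by blast
      then show ?case using unadd[OF M j(1) k j(2)] by (simp add: M'_def)
    qed
    have pivot: "P M" if "E k M" "M $$ (k, k) \<noteq> 0" for M
    proof -
      have M: "M \<in> carrier_mat p p" "det M \<noteq> 0" using that by (auto simp: E_def)
      have "P (multrow k (1 / M $$ (k, k)) M)"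
        using that M k by (intro clear) (auto simp: E_def det_multrow[of k p])
      then show ?thesis using unmult[OF M k, of "1 / M $$ (k, k)"] that by simp
    qed
    show "\<forall>M. E k M \<longrightarrow> P M"
    proof safe
      fix M assume EM: "E k M"
      then have M: "M \<in> carrier_mat p p" "det M \<noteq> 0" by (auto simp: E_def)
      show "P M"
      proof (cases "M $$ (k, k) = 0")
        case False
        then show ?thesis using pivot EM by blast
      next
        case True
        have "\<exists>i. k < i \<and> i < p \<and> M $$ (i, k) \<noteq> 0"
        proof (rule ccontr)
          assume neg: "\<not> ?thesis"
          \<comment> \<open>If column \<open>k\<close> vanishes from row \<open>k\<close> on, it is
            a combination of the first \<open>k\<close> unit columns. \<open>v\<close> records this
            relation and lies in the kernel of \<open>M\<close>, against
            \<open>det M \<noteq> 0\<close>.\<close>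
          define v where "v = vec p (\<lambda>j. if j = k then 1 else if j < k then - (M $$ (j, k)) else 0)"
          have "M *\<^sub>v v = 0\<^sub>v p"
          proof (rule eq_vecI)
            fix i assume "i < dim_vec (0\<^sub>v p)"
            then have i: "i < p" by simp
            have "(M *\<^sub>v v) $ i = (\<Sum>j<p. M $$ (i, j) * v $ j)"
              using i M by (auto simp: v_def scalar_prod_def atLeast0LessThan)
            also have "\<dots> = (\<Sum>j\<in>insert k {..<k}. M $$ (i, j) * v $ j)"
              using k by (intro sum.mono_neutral_right) (auto simp: v_def)
            also have "\<dots> = M $$ (i, k) + (\<Sum>j<k. M $$ (i, j) * v $ j)"
              using k by (simp add: v_def)
            also have "(\<Sum>j<k. M $$ (i, j) * v $ j) = (\<Sum>j<k. if i = j then - (M $$ (j, k)) else 0)"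
            proof (rule sum.cong[OF refl])
              fix j assume "j \<in> {..<k}"
              then have j: "j < k" by simp
              then have "M $$ (i, j) = (if i = j then 1 else 0)" using EM i by (simp add: E_def)
              then show "M $$ (i, j) * v $ j = (if i = j then - (M $$ (j, k)) else 0)"
                using j k by (simp add: v_def)
            qed
            also have "M $$ (i, k) + (\<Sum>j<k. if i = j then - (M $$ (j, k)) else 0) = 0" using neg True i by (cases i k rule: linorder_cases) auto
            finally show "(M *\<^sub>v v) $ i = 0\<^sub>v p $ i" using i by simp
          qed (use M in auto)
          moreover have "v \<noteq> 0\<^sub>v p"
          proof
            assume "v = 0\<^sub>v p"
            then have "v $ k = 0" using k by simp
            then show False using k by (simp add: v_def)
          qed
          moreover have "v \<in> carrier_vec p" by (simp add: v_def)
          ultimately show False using M det_0_iff_vec_prod_zero[OF M(1)] by blast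
        qed
        then obtain i where i: "k < i" "i < p" "M $$ (i, k) \<noteq> 0" by blast
        have "P (addrow 1 k i M)"
          using i EM M k True by (intro pivot) (auto simp: E_def det_addrow[of i p k])
        then show ?thesis using unadd[OF M k i(2)] i by simp
      qed
    qed
  qed simp
  then show ?thesis using B by (auto simp: E_def)
qed

section \<open>Deleting the last row and column\<close>

definition drop_mat :: "nat \<Rightarrow> real mat" where
  "drop_mat p = mat p (Suc p) (\<lambda>(i, j). if i = j then 1 else 0)"

lemma drop_mat_carrier[simp]: "drop_mat p \<in> carrier_mat p (Suc p)"
  by (simp add: drop_mat_def)

lemma drop_mat_mult:
  assumes "W \<in> carrier_mat (Suc p) q" "i < p" "j < q"
  shows "(drop_mat p * W) $$ (i, j) = W $$ (i, j)"
proof -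
  have "(drop_mat p * W) $$ (i, j) = (\<Sum>k<Suc p. (if i = k then 1 else 0) * W $$ (k, j))"
    using assms by (auto simp: drop_mat_def scalar_prod_def atLeast0LessThan intro!: sum.cong)
  also have "\<dots> = (\<Sum>k<Suc p. if i = k then W $$ (k, j) else 0)"
    by (intro sum.cong) auto
  also have "\<dots> = W $$ (i, j)" using assms by (subst sum.delta') auto
  finally show ?thesis .
qed

lemma drop_last_congr:
  assumes W: "W \<in> carrier_mat (Suc p) (Suc p)"
  shows "congr (drop_mat p) W = mat p p (\<lambda>(i, j). W $$ (i, j))" (is "_ = ?M")
proof (rule eq_matI)
  fix i j assume "i < dim_row ?M" "j < dim_col ?M"
  then have ij: "i < p" "j < p" by auto
  have DW: "drop_mat p * W\<^sup>T \<in> carrier_mat p (Suc p)"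
    using W by (intro mult_carrier_mat[of _ _ "Suc p"]) auto
  have "(drop_mat p * W\<^sup>T)\<^sup>T = W * (drop_mat p)\<^sup>T"
    using W by (subst transpose_mult[of _ p "Suc p" _ "Suc p"]) auto
  then have "congr (drop_mat p) W = drop_mat p * (drop_mat p * W\<^sup>T)\<^sup>T"
    using W by (simp only:) (rule assoc_mult_mat[of _ p "Suc p" _ "Suc p" _ p], auto)
  then have "(congr (drop_mat p) W) $$ (i, j) = (drop_mat p * W\<^sup>T)\<^sup>T $$ (i, j)"
    using DW ij by (simp only:) (rule drop_mat_mult[of _ p p], auto)
  also have "\<dots> = (drop_mat p * W\<^sup>T) $$ (j, i)"
    using DW ij by (intro index_transpose_mat(1)) auto
  also have "\<dots> = W\<^sup>T $$ (j, i)"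
    using W ij by (intro drop_mat_mult[of _ p "Suc p"]) auto
  also have "\<dots> = W $$ (i, j)" using W ij by simp
  finally show "(congr (drop_mat p) W) $$ (i, j) = ?M $$ (i, j)"
    using ij by simp
qed (auto simp: drop_mat_def)

lemma drop_mat_transpose_inj:
  assumes v: "v \<in> carrier_vec p" and 0: "(drop_mat p)\<^sup>T *\<^sub>v v = 0\<^sub>v (Suc p)"
  shows "v = 0\<^sub>v p"
proof (rule eq_vecI)
  fix i assume "i < dim_vec (0\<^sub>v p)"
  then have i: "i < p" by simp
  have "((drop_mat p)\<^sup>T *\<^sub>v v) $ i = (\<Sum>k<p. (if k = i then 1 else 0) * v $ k)"
    using v i by (auto simp: drop_mat_def scalar_prod_def atLeast0LessThan intro!: sum.cong)
  also have "\<dots> = (\<Sum>k<p. if k = i then v $ k else 0)"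
    by (intro sum.cong) auto
  also have "\<dots> = v $ i" using i by simp
  finally show "v $ i = 0\<^sub>v p $ i" using 0 i by simp
qed (use v in auto)

section \<open>Bordered matrices and the Cholesky factorization\<close>

definition diag_last :: "nat \<Rightarrow> real \<Rightarrow> real mat" where
  "diag_last p s = four_block_mat (1\<^sub>m p) (0\<^sub>m p 1) (0\<^sub>m 1 p) (mat 1 1 (\<lambda>_. s))"

text \<open>With \<open>t = 1\<close>, acting by congruence on \<open>diag_last p s\<close>, this is
  the triangular factor of a block LDL decomposition with Schur complement \<open>s\<close>; with
  \<open>t = sqrt s\<close> it is a Cholesky factor. \<open>r\<close> is a row: the coordinates of
  the last column with respect to \<open>L\<close>.\<close>

definition border_mat :: "nat \<Rightarrow> real mat \<Rightarrow> real mat \<Rightarrow> real \<Rightarrow> real mat" where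
  "border_mat p L r t = four_block_mat L (0\<^sub>m p 1) r (mat 1 1 (\<lambda>_. t))"

lemma diag_last_carrier[simp]: "diag_last p s \<in> carrier_mat (Suc p) (Suc p)"
  using four_block_carrier_mat[of "1\<^sub>m p" p p "mat 1 1 (\<lambda>_. s)" 1 1] by (auto simp: diag_last_def)

lemma border_mat_carrier[simp]: "L \<in> carrier_mat p p \<Longrightarrow> border_mat p L r t \<in> carrier_mat (Suc p) (Suc p)"
  using four_block_carrier_mat[of L p p "mat 1 1 (\<lambda>_. t)" 1 1] by (auto simp: border_mat_def)

lemma det_diag_last: "det (diag_last p s) = s"
  unfolding diag_last_def
  by (subst det_four_block_mat_upper_right_zero_col[of _ p]) (auto simp: det_single)

lemma det_border_mat:
  "L \<in> carrier_mat p p \<Longrightarrow> r \<in> carrier_mat 1 p \<Longrightarrow> det (border_mat p L r t) = det L * t"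
  unfolding border_mat_def
  by (subst det_four_block_mat_upper_right_zero_col[of _ p]) (auto simp: det_single)

lemma quad_form_diag_last:
  assumes v: "v \<in> carrier_vec (Suc p)"
  shows "v \<bullet> (diag_last p s *\<^sub>v v) = (\<Sum>i<p. (v $ i)\<^sup>2) + s * (v $ p)\<^sup>2"
proof -
  have entry: "diag_last p s $$ (i, j) = (if i = j then (if i = p then s else 1) else 0)"
    if "i < Suc p" "j < Suc p" for i j
    using that by (auto simp: diag_last_def)
  have "(diag_last p s *\<^sub>v v) $ i = (if i = p then s else 1) * v $ i" if i: "i < Suc p" for i
  proof -
    have "(diag_last p s *\<^sub>v v) $ i = (\<Sum>j<Suc p. diag_last p s $$ (i, j) * v $ j)"
      using v i carrier_matD[OF diag_last_carrier[of p s]]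
      by (simp add: scalar_prod_def atLeast0LessThan del: sum.lessThan_Suc)
    also have "\<dots> = (\<Sum>j<Suc p. if i = j then (if i = p then s else 1) * v $ j else 0)"
      using i by (intro sum.cong refl) (simp add: entry del: sum.lessThan_Suc)
    also have "\<dots> = (if i = p then s else 1) * v $ i" using i by (subst sum.delta') auto
    finally show ?thesis .
  qed
  then have "v \<bullet> (diag_last p s *\<^sub>v v) = (\<Sum>i<Suc p. v $ i * ((if i = p then s else 1) * v $ i))"
    using v carrier_matD[OF diag_last_carrier[of p s]]
    by (simp add: scalar_prod_def atLeast0LessThan del: sum.lessThan_Suc)
  also have "\<dots> = (\<Sum>i<p. (v $ i)\<^sup>2) + s * (v $ p)\<^sup>2"
    by (simp add: power2_eq_square)
  finally show ?thesis .
qed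

lemma diag_last_sym: "diag_last p s \<in> sym_mats (Suc p)"
proof -
  have "(diag_last p s)\<^sup>T = diag_last p s"
    by (rule eq_matI) (auto simp: diag_last_def)
  then show ?thesis by (simp add: sym_mats_def)
qed

lemma diag_last_last:
  "diag_last p s \<in> pd_mats (Suc p) \<Longrightarrow> 0 < s"
  "diag_last p s \<in> psd_mats (Suc p) \<Longrightarrow> 0 \<le> s"
proof -
  define e where "e = (unit_vec (Suc p) p :: real vec)"
  have e: "e \<in> carrier_vec (Suc p)" "e \<noteq> 0\<^sub>v (Suc p)" by (auto simp: e_def)
  have "e \<bullet> (diag_last p s *\<^sub>v e) = s"
    using quad_form_diag_last[OF e(1), of s] by (simp add: e_def)
  then show "diag_last p s \<in> pd_mats (Suc p) \<Longrightarrow> 0 < s"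
    "diag_last p s \<in> psd_mats (Suc p) \<Longrightarrow> 0 \<le> s"
    using e unfolding pd_mats_def psd_mats_def by fastforce+
qed

lemma diag_last_psd_iff: "diag_last p s \<in> psd_mats (Suc p) \<longleftrightarrow> 0 \<le> s"
proof
  assume s: "0 \<le> s"
  have "0 \<le> v \<bullet> (diag_last p s *\<^sub>v v)" if "v \<in> carrier_vec (Suc p)" for v
    unfolding quad_form_diag_last[OF that] using s by (intro add_nonneg_nonneg sum_nonneg) auto
  then show "diag_last p s \<in> psd_mats (Suc p)"
    using diag_last_sym unfolding psd_mats_def by blast
qed (rule diag_last_last(2))

lemma border_mat_congr:
  assumes L: "L \<in> carrier_mat p p" and r: "r \<in> carrier_mat 1 p"
  shows "congr (border_mat p L r 1) (diag_last p s) =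
    four_block_mat (L * L\<^sup>T) (L * r\<^sup>T) (r * L\<^sup>T) (mat 1 1 (\<lambda>_. (r * r\<^sup>T) $$ (0, 0) + s))"
    (is "?M * ?D * _ = ?R")
    and "border_mat p L r t * (border_mat p L r t)\<^sup>T =
    four_block_mat (L * L\<^sup>T) (L * r\<^sup>T) (r * L\<^sup>T) (mat 1 1 (\<lambda>_. (r * r\<^sup>T) $$ (0, 0) + t * t))"
proof -
  have tr: "(border_mat p L r t)\<^sup>T = four_block_mat (L\<^sup>T) (r\<^sup>T) (0\<^sub>m 1 p) (mat 1 1 (\<lambda>_. t))" for t
    unfolding border_mat_def using L r
    by (subst transpose_four_block_mat[of _ p p _ 1 _ 1]) (auto intro!: cong_four_block_mat)
  have "?M * ?D = four_block_mat L (0\<^sub>m p 1) r (mat 1 1 (\<lambda>_. s))"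
    unfolding border_mat_def diag_last_def using L r
    by (subst mult_four_block_mat[of _ p p _ 1 _ 1 _ _ p _ 1])
      (auto intro!: cong_four_block_mat simp: scalar_prod_def)
  then show "congr ?M ?D = ?R"
    unfolding tr using L r
    by (simp, subst mult_four_block_mat[of _ p p _ 1 _ 1 _ _ p _ 1])
      (auto intro!: cong_four_block_mat simp: scalar_prod_def)
  show "border_mat p L r t * (border_mat p L r t)\<^sup>T =
    four_block_mat (L * L\<^sup>T) (L * r\<^sup>T) (r * L\<^sup>T) (mat 1 1 (\<lambda>_. (r * r\<^sup>T) $$ (0, 0) + t * t))"
    unfolding tr unfolding border_mat_def using L r
    by (subst mult_four_block_mat[of _ p p _ 1 _ 1 _ _ p _ 1])
      (auto intro!: cong_four_block_mat simp: scalar_prod_def)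
qed

lemma det_lower_triangular_prod:
  assumes "(L :: real mat) \<in> carrier_mat p p" "\<And>i j. i < j \<Longrightarrow> j < p \<Longrightarrow> L $$ (i, j) = 0"
  shows "det L = (\<Prod>i<p. L $$ (i, i))"
  using det_lower_triangular[of p L] assms by (simp add: prod_list_diag_prod atLeast0LessThan)

text \<open>Induction on the dimension: factor the leading block as \<open>L * L\<^sup>T\<close>,
  solve \<open>L * r\<^sup>T = b\<close> for the last column, and put the square root of the Schur
  complement in the corner.\<close>

lemma cholesky:
  assumes "\<Sigma> \<in> pd_mats p"
  obtains L where "L \<in> carrier_mat p p" "\<And>i j. i < j \<Longrightarrow> j < p \<Longrightarrow> L $$ (i, j) = 0"
    "\<And>i. i < p \<Longrightarrow> 0 < L $$ (i, i)" "L * L\<^sup>T = \<Sigma>" "0 < det L" "det \<Sigma> = (det L)\<^sup>2"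
proof -
  have "\<exists>L \<in> carrier_mat p p. (\<forall>i j. i < j \<longrightarrow> j < p \<longrightarrow> L $$ (i, j) = 0) \<and>
    (\<forall>i<p. 0 < L $$ (i, i)) \<and> L * L\<^sup>T = \<Sigma>"
    using assms
  proof (induction p arbitrary: \<Sigma>)
    case 0
    then have "\<Sigma> \<in> carrier_mat 0 0" by (rule pd_mats_carrier)
    then show ?case by (intro bexI[of _ "1\<^sub>m 0"]) auto
  next
    case (Suc p)
    have \<Sigma>: "\<Sigma> \<in> carrier_mat (Suc p) (Suc p)" "\<Sigma>\<^sup>T = \<Sigma>"
      using Suc.prems by (auto simp: pd_mats_def sym_mats_def)
    have sym: "\<Sigma> $$ (i, j) = \<Sigma> $$ (j, i)" if "i < Suc p" "j < Suc p" for i j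
      using \<Sigma> that by (metis carrier_matD index_transpose_mat(1))
    define S where "S = mat p p (\<lambda>(i, j). \<Sigma> $$ (i, j))"
    define b where "b = mat p 1 (\<lambda>(i, j). \<Sigma> $$ (i, p))"
    have b: "b \<in> carrier_mat p 1" and bT: "b\<^sup>T = mat 1 p (\<lambda>(i, j). \<Sigma> $$ (p, j))"
      using sym by (auto simp: b_def intro!: eq_matI)
    have "S \<in> pd_mats p"
      using pd_mats_congr[OF Suc.prems drop_mat_carrier drop_mat_transpose_inj]
      unfolding drop_last_congr[OF \<Sigma>(1)] S_def by simp
    then obtain L where L: "L \<in> carrier_mat p p" "\<And>i j. i < j \<Longrightarrow> j < p \<Longrightarrow> L $$ (i, j) = 0"
      "\<And>i. i < p \<Longrightarrow> 0 < L $$ (i, i)" "L * L\<^sup>T = S" using Suc.IH by blast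
    have detL: "det L > 0"
      using det_lower_triangular_prod[OF L(1,2)] L(3) by (auto intro: prod_pos)
    then obtain C where C: "C \<in> carrier_mat p p" "L * C = 1\<^sub>m p" using ex_inverse_mat[OF L(1)] by (metis less_irrefl)
    define r where "r = (C * b)\<^sup>T"
    have r: "r \<in> carrier_mat 1 p" using C b by (auto simp: r_def)
    have "L * (C * b) = (L * C) * b" by (rule assoc_mult_mat[symmetric, OF L(1) C(1) b])
    then have Lr: "L * r\<^sup>T = b" using C(2) b by (simp add: r_def)
    have "r * L\<^sup>T = (L * r\<^sup>T)\<^sup>T" using L r by (subst transpose_mult[of L p p "r\<^sup>T" 1]) auto
    then have rL: "r * L\<^sup>T = b\<^sup>T" using Lr by simp
    \<comment> \<open>The Schur complement of the leading block. \<open>diag_last p s\<close> turns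
      out to be congruent to \<open>\<Sigma>\<close>, hence positive definite, and this gives
      \<open>0 < s\<close>.\<close>
    define s where "s = \<Sigma> $$ (p, p) - (r * r\<^sup>T) $$ (0, 0)"
    have \<Sigma>_eq: "\<Sigma> = four_block_mat S b (b\<^sup>T) (mat 1 1 (\<lambda>_. \<Sigma> $$ (p, p)))"
      unfolding bT
    proof (rule eq_matI)
      let ?B = "four_block_mat S b (mat 1 p (\<lambda>(i, j). \<Sigma> $$ (p, j))) (mat 1 1 (\<lambda>_. \<Sigma> $$ (p, p)))"
      fix i j assume "i < dim_row ?B"
        "j < dim_col ?B"
      then have "i < Suc p" "j < Suc p" by (auto simp: S_def)
      then show "\<Sigma> $$ (i, j) = ?B $$ (i, j)"
        by (auto simp: S_def b_def less_Suc_eq)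
    qed (use \<Sigma> in \<open>auto simp: S_def\<close>)
    have "congr (border_mat p L r 1) (diag_last p s) = \<Sigma>"
      unfolding border_mat_congr(1)[OF L(1) r] L(4) Lr rL by (rule trans[OF _ \<Sigma>_eq[symmetric]]) (simp add: s_def)
    then have "diag_last p s \<in> pd_mats (Suc p)"
      using pd_mats_congr_iff[of "border_mat p L r 1" "Suc p" "diag_last p s"] Suc.prems L(1) r detL
      by (simp add: det_border_mat)
    then have s: "s > 0" by (rule diag_last_last)
    define M where "M = border_mat p L r (sqrt s)"
    have "M * M\<^sup>T = \<Sigma>"
      unfolding M_def border_mat_congr(2)[OF L(1) r] L(4) Lr rL by (rule trans[OF _ \<Sigma>_eq[symmetric]]) (use s in \<open>simp add: s_def\<close>)
    moreover have "M $$ (i, j) = 0" if "i < j" "j < Suc p" for i j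
      using that L(1,2) r by (auto simp: M_def border_mat_def)
    moreover have "0 < M $$ (i, i)" if "i < Suc p" for i
      using that L(1,3) r s by (auto simp: M_def border_mat_def)
    moreover have "M \<in> carrier_mat (Suc p) (Suc p)" using L by (simp add: M_def)
    ultimately show ?case by (intro bexI[of _ M]) auto
  qed
  then obtain L where L: "L \<in> carrier_mat p p" "\<And>i j. i < j \<Longrightarrow> j < p \<Longrightarrow> L $$ (i, j) = 0"
    "\<And>i. i < p \<Longrightarrow> 0 < L $$ (i, i)" "L * L\<^sup>T = \<Sigma>" by blast
  have "0 < det L" using det_lower_triangular_prod[OF L(1,2)] L(3) by (auto intro: prod_pos)
  moreover have "det \<Sigma> = (det L)\<^sup>2"
    using L(1,4) det_mult[of L p "L\<^sup>T"] det_transpose[of L p] by (simp add: power2_eq_square)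
  ultimately show ?thesis using that L by blast
qed

section \<open>Triangular substitutions in product Lebesgue measure\<close>

abbreviation PiM_lborel :: "'i set \<Rightarrow> ('i \<Rightarrow> real) measure" where
  "PiM_lborel I \<equiv> Pi\<^sub>M I (\<lambda>_. lborel)"

text \<open>Integrate over coordinate \<open>i\<close> innermost: with the others fixed the
  substitution is affine in one real variable. By \<open>dep\<close> the shift \<open>g\<close>
  ignores coordinate \<open>i\<close>, so it is constant in that integral.\<close>

lemma nn_integral_PiM_lborel_upd:
  fixes I :: "'i set" and f :: "('i \<Rightarrow> real) \<Rightarrow> ennreal"
  assumes I: "finite I" "i \<in> I" and c: "c \<noteq> 0"
    and g[measurable]: "g \<in> borel_measurable (PiM_lborel I)"
    and dep: "\<And>w y. g (w(i := y)) = g w"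
    and f[measurable]: "f \<in> borel_measurable (PiM_lborel I)"
  shows "integral\<^sup>N (PiM_lborel I) f =
    ennreal \<bar>c\<bar> * (\<integral>\<^sup>+w. f (w(i := c * w i + g w)) \<partial>PiM_lborel I)"
proof -
  interpret product_sigma_finite "\<lambda>_::'i. lborel :: real measure" by standard
  define J where "J = I - {i}"
  have J: "finite J" "i \<notin> J" and I_eq: "I = insert i J" using I by (auto simp: J_def)
  have ci[measurable]: "(\<lambda>w. w i) \<in> borel_measurable (PiM_lborel I)"
    using measurable_component_singleton[OF I(2), of "\<lambda>_. lborel"] by simp
  have "(\<lambda>w. w(i := c * w i + g w)) \<in> measurable (PiM_lborel I) (PiM_lborel I)"
    by (rule measurable_fun_upd[of I I i]) (use I in auto)
  then have F: "(\<lambda>w. f (w(i := c * w i + g w))) \<in> borel_measurable (PiM_lborel I)"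
    by (rule measurable_compose[OF _ f])
  have fm: "(\<lambda>y. f (x(i := y))) \<in> borel_measurable lborel" if "x \<in> space (PiM_lborel J)" for x
    using measurable_compose[OF measurable_component_update[OF that J(2)]] f unfolding I_eq by blast
  have "integral\<^sup>N (PiM_lborel I) f = (\<integral>\<^sup>+x. (\<integral>\<^sup>+y. f (x(i := y)) \<partial>lborel) \<partial>PiM_lborel J)"
    using f unfolding I_eq by (rule product_nn_integral_insert[OF J])
  also have "\<dots> = (\<integral>\<^sup>+x. ennreal \<bar>c\<bar> * (\<integral>\<^sup>+y. f (x(i := g x + c * y)) \<partial>lborel) \<partial>PiM_lborel J)"
  proof (rule nn_integral_cong)
    fix x assume x: "x \<in> space (PiM_lborel J)"
    show "(\<integral>\<^sup>+y. f (x(i := y)) \<partial>lborel) = ennreal \<bar>c\<bar> * (\<integral>\<^sup>+y. f (x(i := g x + c * y)) \<partial>lborel)"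
      using nn_integral_real_affine[of "\<lambda>y. f (x(i := y))" c "g x"] c fm[OF x] by simp
  qed
  also have "\<dots> = (\<integral>\<^sup>+x. (\<integral>\<^sup>+y. ennreal \<bar>c\<bar> * f (x(i := g x + c * y)) \<partial>lborel) \<partial>PiM_lborel J)"
  proof (rule nn_integral_cong, rule nn_integral_cmult[symmetric])
    fix x assume x: "x \<in> space (PiM_lborel J)"
    show "(\<lambda>y. f (x(i := g x + c * y))) \<in> borel_measurable lborel"
      using fm[OF x] by (rule measurable_compose[rotated]) simp
  qed
  also have "\<dots> = (\<integral>\<^sup>+x. (\<integral>\<^sup>+y. (\<lambda>w. ennreal \<bar>c\<bar> * f (w(i := c * w i + g w))) (x(i := y)) \<partial>lborel) \<partial>PiM_lborel J)"
    by (simp add: dep add.commute)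
  also have "\<dots> = (\<integral>\<^sup>+w. ennreal \<bar>c\<bar> * f (w(i := c * w i + g w)) \<partial>PiM_lborel I)"
    unfolding I_eq
    by (rule product_nn_integral_insert[symmetric, OF J]) (use F in \<open>simp add: I_eq borel_measurable_times\<close>)
  also have "\<dots> = ennreal \<bar>c\<bar> * (\<integral>\<^sup>+w. f (w(i := c * w i + g w)) \<partial>PiM_lborel I)"
    using F by (rule nn_integral_cmult)
  finally show ?thesis .
qed

text \<open>\<open>r\<close> ranks the coordinates and \<open>g i\<close> reads only those of
  smaller rank, which makes the substitution triangular without an order on the index type.
  Restricting it to \<open>J\<close> allows the coordinates to be substituted one at a time.\<close>

lemma nn_integral_PiM_lborel_triangular:
  fixes I :: "'i set" and r :: "'i \<Rightarrow> nat" and f :: "('i \<Rightarrow> real) \<Rightarrow> ennreal"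
  assumes I: "finite I" and J: "J \<subseteq> I"
    and c: "\<And>i. i \<in> J \<Longrightarrow> c i \<noteq> 0"
    and g: "\<And>i. i \<in> J \<Longrightarrow> g i \<in> borel_measurable (PiM_lborel I)"
    and dep: "\<And>i w w'. i \<in> J \<Longrightarrow> (\<And>j. j \<in> I \<Longrightarrow> r j < r i \<Longrightarrow> w j = w' j) \<Longrightarrow> g i w = g i w'"
    and f: "f \<in> borel_measurable (PiM_lborel I)"
  shows "integral\<^sup>N (PiM_lborel I) f = ennreal (\<Prod>i\<in>J. \<bar>c i\<bar>) *
    (\<integral>\<^sup>+w. f (\<lambda>i\<in>I. if i \<in> J then c i * w i + g i w else w i) \<partial>PiM_lborel I)"
  (is "_ = _ * (\<integral>\<^sup>+w. f (?\<Phi> J w) \<partial>_)")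
  using finite_subset[OF J I] J c g dep
proof (induction "card J" arbitrary: J)
  case 0
  have "J = {}" using 0(1,2) by simp
  moreover have "(\<integral>\<^sup>+w. f (?\<Phi> {} w) \<partial>PiM_lborel I) = integral\<^sup>N (PiM_lborel I) f"
    by (rule nn_integral_cong) (auto simp: space_PiM)
  ultimately show ?case by (simp only: prod.empty ennreal_1 mult_1)
next
  case (Suc n)
  have "J \<noteq> {}" using Suc.hyps(2) by auto
  then have "Max (r ` J) \<in> r ` J" using Suc.prems(1) by (intro Max_in) auto
  \<comment> \<open>A coordinate of maximal rank is read by no \<open>g j\<close> with
    \<open>j \<in> J\<close>, so it can be split off as a substitution in one coordinate.\<close>
  then obtain i where i: "i \<in> J" and "r i = Max (r ` J)" by auto
  then have i_max: "r j \<le> r i" if "j \<in> J" for j using that Suc.prems(1) by simp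
  define J' where "J' = J - {i}"
  define G where "G = (\<lambda>w. f (?\<Phi> J' w))"
  have iI: "i \<in> I" using i Suc.prems(2) by auto
  have [measurable]: "(\<lambda>w. w j) \<in> borel_measurable (PiM_lborel I)" if "j \<in> I" for j
    using measurable_component_singleton[OF that, of "\<lambda>_. lborel"] by simp
  have Gm: "G \<in> borel_measurable (PiM_lborel I)"
    unfolding G_def
  proof (rule measurable_compose[OF _ f], rule measurable_restrict)
    fix j assume j: "j \<in> I"
    show "(\<lambda>w. if j \<in> J' then c j * w j + g j w else w j) \<in> measurable (PiM_lborel I) lborel"
    proof (cases "j \<in> J'")
      case True
      then have [measurable]: "g j \<in> borel_measurable (PiM_lborel I)" using Suc.prems(4) by (auto simp: J'_def)
      show ?thesis using True j by simp
    qed (use j in simp)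
  qed
  have "integral\<^sup>N (PiM_lborel I) f = ennreal (\<Prod>i\<in>J'. \<bar>c i\<bar>) * integral\<^sup>N (PiM_lborel I) G"
    unfolding G_def
  proof (rule Suc.hyps(1))
    show "n = card J'" using Suc.hyps(2) Suc.prems(1) i by (simp add: J'_def)
    show "finite J'" "J' \<subseteq> I" using Suc.prems by (auto simp: J'_def)
    show "\<And>j. j \<in> J' \<Longrightarrow> c j \<noteq> 0" "\<And>j. j \<in> J' \<Longrightarrow> g j \<in> borel_measurable (PiM_lborel I)"
      using Suc.prems(3,4) by (auto simp: J'_def)
    show "g j w = g j w'" if "j \<in> J'" "\<And>k. k \<in> I \<Longrightarrow> r k < r j \<Longrightarrow> w k = w' k" for j w w'
      using Suc.prems(5)[of j w w'] that by (auto simp: J'_def)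
  qed
  also have "integral\<^sup>N (PiM_lborel I) G =
      ennreal \<bar>c i\<bar> * (\<integral>\<^sup>+w. G (w(i := c i * w i + g i w)) \<partial>PiM_lborel I)"
  proof (rule nn_integral_PiM_lborel_upd[OF I iI _ _ _ Gm])
    show "c i \<noteq> 0" "g i \<in> borel_measurable (PiM_lborel I)" using i Suc.prems by auto
    show "g i (w(i := y)) = g i w" for w y
      by (rule Suc.prems(5)[OF i]) auto
  qed
  also have "(\<integral>\<^sup>+w. G (w(i := c i * w i + g i w)) \<partial>PiM_lborel I) =
    (\<integral>\<^sup>+w. f (?\<Phi> J w) \<partial>PiM_lborel I)"
  proof (rule nn_integral_cong)
    fix w
    have "g j (w(i := c i * w i + g i w)) = g j w" if "j \<in> J'" for j
      by (rule Suc.prems(5)) (use that i_max[of j] in \<open>auto simp: J'_def\<close>)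
    then have "?\<Phi> J' (w(i := c i * w i + g i w)) = ?\<Phi> J w"
      using i iI by (auto simp: J'_def restrict_def)
    then show "G (w(i := c i * w i + g i w)) = f (?\<Phi> J w)" by (simp only: G_def)
  qed
  also have "ennreal (\<Prod>i\<in>J'. \<bar>c i\<bar>) * (ennreal \<bar>c i\<bar> * (\<integral>\<^sup>+w. f (?\<Phi> J w) \<partial>PiM_lborel I))
     = ennreal (\<Prod>i\<in>J. \<bar>c i\<bar>) * (\<integral>\<^sup>+w. f (?\<Phi> J w) \<partial>PiM_lborel I)"
    using Suc.prems(1) i
    by (simp add: J'_def prod.remove[of J i] ennreal_mult[symmetric] prod_nonneg mult_ac flip: mult.assoc)
  finally show ?case .
qed

section \<open>The reference measure on symmetric matrices\<close>

abbreviation upper_lborel :: "nat \<Rightarrow> (nat \<times> nat \<Rightarrow> real) measure" where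
  "upper_lborel p \<equiv> PiM_lborel (upper_idx p)"

lemma finite_upper_idx[simp]: "finite (upper_idx p)"
  by (rule finite_subset[of _ "{..<p} \<times> {..<p}"]) (auto simp: upper_idx_def)

lemma sym_of_upper_index[simp]:
  "i < p \<Longrightarrow> j < p \<Longrightarrow> sym_of_upper p w $$ (i, j) = w (min i j, max i j)"
  "dim_row (sym_of_upper p w) = p" "dim_col (sym_of_upper p w) = p"
  by (auto simp: sym_of_upper_def)

lemma sym_of_upper_sym: "sym_of_upper p w \<in> sym_mats p"
  by (auto simp: sym_mats_def min.commute max.commute intro!: eq_matI carrier_matI)

lemma sym_of_upper_carrier[simp]: "sym_of_upper p w \<in> carrier_mat p p"
  by (auto intro: carrier_matI)

lemma sym_mats_index: "W \<in> sym_mats p \<Longrightarrow> i < p \<Longrightarrow> j < p \<Longrightarrow> W $$ (i, j) = W $$ (j, i)"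
  unfolding sym_mats_def by (metis (mono_tags, lifting) carrier_matD index_transpose_mat(1) mem_Collect_eq)

lemma sym_mats_eqI:
  assumes "V \<in> sym_mats p" "W \<in> sym_mats p" "\<And>i j. i \<le> j \<Longrightarrow> j < p \<Longrightarrow> V $$ (i, j) = W $$ (i, j)"
  shows "V = W"
proof (rule eq_matI)
  fix i j assume "i < dim_row W" "j < dim_col W"
  then have ij: "i < p" "j < p" using assms(2) by (auto simp: sym_mats_def)
  show "V $$ (i, j) = W $$ (i, j)"
  proof (cases "i \<le> j")
    case False
    then show ?thesis
      using assms(3)[of j i] ij sym_mats_index[OF assms(1) ij] sym_mats_index[OF assms(2) ij] by simp
  qed (use assms(3) ij in simp)
qed (use assms in \<open>auto simp: sym_mats_def\<close>)

lemma sym_of_upper_surj: "W \<in> sym_mats p \<Longrightarrow> sym_of_upper p (\<lambda>x\<in>upper_idx p. W $$ x) = W"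
  by (rule sym_mats_eqI[OF sym_of_upper_sym]) (auto simp: upper_idx_def)

text \<open>The matrix does not see values outside \<open>upper_idx p\<close>; points of the product
  space are extensional, so these values are all \<open>undefined\<close>.\<close>

lemma inj_on_sym_of_upper: "inj_on (sym_of_upper p) (space (upper_lborel p))"
proof (rule inj_onI, rule ext)
  fix v w and x :: "nat \<times> nat"
  assume vw: "v \<in> space (upper_lborel p)" "w \<in> space (upper_lborel p)" and eq: "sym_of_upper p v = sym_of_upper p w"
  show "v x = w x"
  proof (cases "x \<in> upper_idx p")
    case True
    then obtain i j where x: "x = (i, j)" "i \<le> j" "j < p" by (auto simp: upper_idx_def)
    then have "sym_of_upper p v $$ (i, j) = sym_of_upper p w $$ (i, j)" using eq by simp
    then show ?thesis using x by simp
  next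
    case False
    then have "v x = undefined" "w x = undefined" using vw by (simp_all add: space_PiM PiE_arb[OF _ False])
    then show ?thesis by simp
  qed
qed

lemma space_sym_lborel[simp]: "space (sym_lborel p) = sym_mats p"
proof -
  have "W \<in> sym_of_upper p ` space (upper_lborel p)" if "W \<in> sym_mats p" for W
    by (rule image_eqI[where x = "\<lambda>x\<in>upper_idx p. W $$ x"])
      (simp_all add: sym_of_upper_surj[OF that] space_PiM)
  then show ?thesis unfolding sym_lborel_def space_embed_measure using sym_of_upper_sym by auto
qed

lemma measurable_sym_of_upper: "sym_of_upper p \<in> measurable (upper_lborel p) (sym_lborel p)"
  unfolding sym_lborel_def by (rule measurable_embed_measure2'[OF inj_on_sym_of_upper])

lemma nn_integral_sym_lborel:
  "F \<in> borel_measurable (sym_lborel p) \<Longrightarrow>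
    integral\<^sup>N (sym_lborel p) F = (\<integral>\<^sup>+w. F (sym_of_upper p w) \<partial>upper_lborel p)"
  unfolding sym_lborel_def by (rule nn_integral_embed_measure'[OF inj_on_sym_of_upper])

section \<open>Measurability of entries and congruences\<close>

lemma measurable_PiM_component:
  "i \<in> I \<Longrightarrow> (\<lambda>w. w i) \<in> borel_measurable (PiM_lborel I)"
  using measurable_component_singleton[of i I "\<lambda>_. lborel"] by simp

lemma measurable_sym_lborel_entry:
  assumes "i < p" "j < p"
  shows "(\<lambda>W. W $$ (i, j)) \<in> borel_measurable (sym_lborel p)"
  unfolding sym_lborel_def
proof (rule measurable_embed_measure1)
  have "(min i j, max i j) \<in> upper_idx p" using assms by (auto simp: upper_idx_def)
  then show "(\<lambda>w. sym_of_upper p w $$ (i, j)) \<in> borel_measurable (upper_lborel p)"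
    using assms by simp
qed

lemma measurable_sym_lborelI:
  assumes X: "\<And>x. x \<in> space M \<Longrightarrow> X x \<in> sym_mats p"
    and entry: "\<And>i j. i \<le> j \<Longrightarrow> j < p \<Longrightarrow> (\<lambda>x. X x $$ (i, j)) \<in> borel_measurable M"
  shows "X \<in> measurable M (sym_lborel p)"
proof -
  have "(\<lambda>x. \<lambda>ij\<in>upper_idx p. X x $$ ij) \<in> measurable M (upper_lborel p)"
  proof (rule measurable_restrict)
    fix ij :: "nat \<times> nat" assume "ij \<in> upper_idx p"
    then obtain i j where ij: "ij = (i, j)" "i \<le> j" "j < p" by (auto simp: upper_idx_def)
    show "(\<lambda>x. X x $$ ij) \<in> measurable M lborel"
      unfolding ij(1) measurable_lborel1 by (rule entry[OF ij(2,3)])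
  qed
  then have "(\<lambda>x. sym_of_upper p (\<lambda>ij\<in>upper_idx p. X x $$ ij)) \<in> measurable M (sym_lborel p)"
    using measurable_sym_of_upper by (rule measurable_compose)
  then show ?thesis
    by (rule measurable_cong[THEN iffD1, rotated]) (rule sym_of_upper_surj[OF X])
qed

lemma congr_mat_index:
  assumes "(A :: real mat) \<in> carrier_mat q p" "W \<in> carrier_mat p p" "i < q" "j < q"
  shows "(congr A W) $$ (i, j) = (\<Sum>k<p. \<Sum>l<p. A $$ (i, k) * W $$ (k, l) * A $$ (j, l))"
  using assms by (auto simp: scalar_prod_def atLeast0LessThan sum_distrib_left mult.assoc intro!: sum.cong)

lemma measurable_congr_mat:
  assumes A: "A \<in> carrier_mat q p"
  shows "(congr A) \<in> measurable (sym_lborel p) (sym_lborel q)"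
proof (rule measurable_sym_lborelI)
  show "congr A W \<in> sym_mats q" if "W \<in> space (sym_lborel p)" for W
    using that sym_mats_congr[of W p A q] A by simp
  fix i j assume ij: "i \<le> j" "j < q"
  have "(\<lambda>W. \<Sum>k<p. \<Sum>l<p. A $$ (i, k) * W $$ (k, l) * A $$ (j, l)) \<in> borel_measurable (sym_lborel p)"
    by (intro borel_measurable_sum borel_measurable_times borel_measurable_const measurable_sym_lborel_entry)
      simp_all
  then show "(\<lambda>W. (congr A W) $$ (i, j)) \<in> borel_measurable (sym_lborel p)"
    by (rule measurable_cong[THEN iffD1, rotated])
      (use ij in \<open>simp add: congr_mat_index[OF A sym_mats_carrier]\<close>)
qed

text \<open>Elementary matrices act as row operations from the left; transposing twice turns the
  right factor of a congruence into a second row operation.\<close>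

lemma congr_mat_transpose:
  assumes E: "(E :: real mat) \<in> carrier_mat p p" and W: "W \<in> sym_mats p"
  shows "congr E W = (E * (E * W)\<^sup>T)\<^sup>T"
proof -
  have "(E * (E * W)\<^sup>T)\<^sup>T = (E * W)\<^sup>T\<^sup>T * E\<^sup>T"
    using E sym_mats_carrier[OF W] by (intro transpose_mult[of _ p p _ p]) auto
  then show ?thesis by simp
qed

text \<open>\<open>S\<close> expresses the congruence in upper coordinates as a triangular
  substitution with diagonal \<open>c\<close> and shifts \<open>g\<close>, so its Jacobian is the
  product of the diagonal.\<close>

lemma nn_integral_sym_lborel_congr_triangular:
  fixes r :: "nat \<times> nat \<Rightarrow> nat"
  assumes E: "E \<in> carrier_mat p p" and F: "F \<in> borel_measurable (sym_lborel p)"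
    and c: "\<And>x. x \<in> upper_idx p \<Longrightarrow> c x \<noteq> 0"
    and g: "\<And>x. x \<in> upper_idx p \<Longrightarrow> g x \<in> borel_measurable (upper_lborel p)"
    and dep: "\<And>x w w'. x \<in> upper_idx p \<Longrightarrow> (\<And>y. y \<in> upper_idx p \<Longrightarrow> r y < r x \<Longrightarrow> w y = w' y) \<Longrightarrow> g x w = g x w'"
    and S: "\<And>w. sym_of_upper p (\<lambda>x\<in>upper_idx p. c x * w x + g x w) = congr E (sym_of_upper p w)"
  shows "integral\<^sup>N (sym_lborel p) F =
    ennreal (\<Prod>x\<in>upper_idx p. \<bar>c x\<bar>) * (\<integral>\<^sup>+W. F (congr E W) \<partial>sym_lborel p)"
proof -
  let ?I = "upper_idx p"
  have if_eq: "(\<lambda>x\<in>?I. if x \<in> ?I then c x * w x + g x w else w x) = (\<lambda>x\<in>?I. c x * w x + g x w)" for w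
    by (auto simp: restrict_def)
  have FS: "(\<lambda>w. F (sym_of_upper p w)) \<in> borel_measurable (upper_lborel p)"
    by (rule measurable_compose[OF measurable_sym_of_upper F])
  have "(\<integral>\<^sup>+w. F (sym_of_upper p w) \<partial>upper_lborel p) = ennreal (\<Prod>x\<in>?I. \<bar>c x\<bar>) *
    (\<integral>\<^sup>+w. F (sym_of_upper p (\<lambda>x\<in>?I. if x \<in> ?I then c x * w x + g x w else w x)) \<partial>upper_lborel p)"
    by (rule nn_integral_PiM_lborel_triangular[OF finite_upper_idx subset_refl c g dep FS]) simp_all
  then show ?thesis
    unfolding if_eq S nn_integral_sym_lborel[OF F]
      nn_integral_sym_lborel[OF measurable_compose[OF measurable_congr_mat[OF E] F]] .
qed

lemma nn_integral_sym_lborel_addrow: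
  assumes kl: "k < p" "l < p" "k \<noteq> l" and F: "F \<in> borel_measurable (sym_lborel p)"
  shows "integral\<^sup>N (sym_lborel p) F =
    (\<integral>\<^sup>+W. F (addrow_mat p a k l * W * (addrow_mat p a k l)\<^sup>T) \<partial>sym_lborel p)"
proof -
  let ?E = "addrow_mat p a k l"
  define g :: "nat \<times> nat \<Rightarrow> (nat \<times> nat \<Rightarrow> real) \<Rightarrow> real" where
    "g = (\<lambda>(i, j) w. (if i = k then a * w (min l j, max l j) else 0) + (if j = k then a * w (min i l, max i l) else 0)
      + (if i = k \<and> j = k then a * a * w (l, l) else 0))"
  \<comment> \<open>The rank counts the indices equal to \<open>k\<close>: the entry at
    \<open>(k, k)\<close> reads those at \<open>(k, l)\<close> and \<open>(l, l)\<close>, and an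
    entry with exactly one index \<open>k\<close> reads only an entry with none. All diagonal
    coefficients are 1.\<close>
  define r :: "nat \<times> nat \<Rightarrow> nat" where "r = (\<lambda>(i, j). (if i = k then 1 else 0) + (if j = k then 1 else 0))"
  have gm: "g x \<in> borel_measurable (upper_lborel p)" if x: "x \<in> upper_idx p" for x
  proof -
    obtain i j where ij: "x = (i, j)" "i \<le> j" "j < p" using x by (auto simp: upper_idx_def)
    have idx: "(min l j, max l j) \<in> upper_idx p" "(min i l, max i l) \<in> upper_idx p" "(l, l) \<in> upper_idx p"
      using ij kl by (auto simp: upper_idx_def)
    have if_meas: "(\<lambda>w. if b then b' * w y else 0) \<in> borel_measurable (upper_lborel p)"
      if "y \<in> upper_idx p" for b y and b' :: real
      using borel_measurable_times[OF borel_measurable_const measurable_PiM_component[OF that], of b']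
      by (cases b) (simp_all only: if_True if_False borel_measurable_const)
    show ?thesis unfolding g_def ij(1) prod.case
      by (intro borel_measurable_add if_meas idx)
  qed
  have dep: "g x w = g x w'" if x: "x \<in> upper_idx p" and eq: "\<And>y. y \<in> upper_idx p \<Longrightarrow> r y < r x \<Longrightarrow> w y = w' y" for x w w'
  proof -
    obtain i j where ij: "x = (i, j)" "i \<le> j" "j < p" using x by (auto simp: upper_idx_def)
    have "w (min l j, max l j) = w' (min l j, max l j)" if "i = k"
      by (rule eq) (use that kl ij in \<open>auto simp: upper_idx_def r_def min_def max_def\<close>)
    moreover have "w (min i l, max i l) = w' (min i l, max i l)" if "j = k"
      by (rule eq) (use that kl ij in \<open>auto simp: upper_idx_def r_def min_def max_def\<close>)
    moreover have "w (l, l) = w' (l, l)" if "i = k" "j = k"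
      by (rule eq) (use that kl ij in \<open>auto simp: upper_idx_def r_def\<close>)
    ultimately show ?thesis by (cases "i = k"; cases "j = k") (simp_all add: g_def ij(1))
  qed
  have S: "sym_of_upper p (\<lambda>x\<in>upper_idx p. 1 * w x + g x w) =
    ?E * sym_of_upper p w * ?E\<^sup>T" for w
  proof (rule sym_mats_eqI[OF sym_of_upper_sym sym_mats_congr[OF sym_of_upper_sym addrow_mat_carrier]])
    fix i j assume ij: "i \<le> j" "j < p"
    let ?S = "sym_of_upper p w"
    have "congr ?E ?S = (?E * (?E * ?S)\<^sup>T)\<^sup>T"
      by (rule congr_mat_transpose[OF addrow_mat_carrier sym_of_upper_sym])
    moreover have "?E * ?S = addrow a k l ?S"
      by (rule addrow_mat[symmetric, OF sym_of_upper_carrier kl(2)])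
    moreover have "?E * (addrow a k l ?S)\<^sup>T = addrow a k l ((addrow a k l ?S)\<^sup>T)"
      by (rule addrow_mat[symmetric, of _ p p]) (use kl in auto)
    ultimately have "congr ?E ?S = (addrow a k l ((addrow a k l ?S)\<^sup>T))\<^sup>T" by (simp only:)
    then show "sym_of_upper p (\<lambda>x\<in>upper_idx p. 1 * w x + g x w) $$ (i, j) =
      (congr ?E ?S) $$ (i, j)"
      using ij kl by (auto simp: upper_idx_def g_def min_absorb1 max_absorb2 algebra_simps)
  qed
  have "integral\<^sup>N (sym_lborel p) F =
    ennreal (\<Prod>x\<in>upper_idx p. \<bar>1\<bar>) * (\<integral>\<^sup>+W. F (congr ?E W) \<partial>sym_lborel p)"
    by (rule nn_integral_sym_lborel_congr_triangular[OF addrow_mat_carrier F _ gm dep S]) simp_all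
  then show ?thesis by simp
qed

text \<open>The origin of the exponent \<open>p + 1\<close>: \<open>k\<close> is the first index of
  \<open>p - k\<close> upper entries and the second index of \<open>k + 1\<close>, the diagonal
  entry being counted in both.\<close>

lemma prod_upper_idx_row_col:
  assumes k: "k < p"
  shows "(\<Prod>(i, j)\<in>upper_idx p. (if i = k then a else 1) * (if j = k then a else 1 :: real)) = a ^ Suc p"
proof -
  have "(\<Prod>(i, j)\<in>upper_idx p. (if i = k then a else 1) * (if j = k then a else 1)) =
    (\<Prod>x\<in>upper_idx p. if fst x = k then a else 1) * (\<Prod>x\<in>upper_idx p. if snd x = k then a else 1)"
    by (simp add: case_prod_unfold prod.distrib)
  also have "\<dots> = a ^ card {x \<in> upper_idx p. fst x = k} * a ^ card {x \<in> upper_idx p. snd x = k}"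
    by (simp flip: prod.inter_filter)
  also have "{x \<in> upper_idx p. fst x = k} = Pair k ` {k..<p}" by (auto simp: upper_idx_def)
  also have "card \<dots> = p - k" by (simp add: card_image inj_on_def)
  also have "{x \<in> upper_idx p. snd x = k} = (\<lambda>i. (i, k)) ` {..k}" using k by (auto simp: upper_idx_def)
  also have "card \<dots> = Suc k" by (simp add: card_image inj_on_def)
  also have "a ^ (p - k) * a ^ Suc k = a ^ Suc p" using k by (simp flip: power_add)
  finally show ?thesis .
qed

lemma nn_integral_sym_lborel_multrow:
  assumes k: "k < p" and a: "a \<noteq> 0" and F: "F \<in> borel_measurable (sym_lborel p)"
  shows "integral\<^sup>N (sym_lborel p) F = ennreal (\<bar>a\<bar> ^ Suc p) *
    (\<integral>\<^sup>+W. F (multrow_mat p k a * W * (multrow_mat p k a)\<^sup>T) \<partial>sym_lborel p)"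
proof -
  let ?E = "multrow_mat p k a"
  define c :: "nat \<times> nat \<Rightarrow> real" where "c = (\<lambda>(i, j). (if i = k then a else 1) * (if j = k then a else 1))"
  have c_prod: "(\<Prod>i\<in>upper_idx p. \<bar>c i\<bar>) = \<bar>a\<bar> ^ Suc p"
    unfolding prod_upper_idx_row_col[OF k, symmetric] by (intro prod.cong) (auto simp: c_def abs_mult)
  have S: "sym_of_upper p (\<lambda>x\<in>upper_idx p. c x * w x + 0) =
    ?E * sym_of_upper p w * ?E\<^sup>T" for w
  proof (rule sym_mats_eqI[OF sym_of_upper_sym sym_mats_congr[OF sym_of_upper_sym multrow_mat_carrier]])
    fix i j assume ij: "i \<le> j" "j < p"
    let ?S = "sym_of_upper p w"
    have "congr ?E ?S = (?E * (?E * ?S)\<^sup>T)\<^sup>T"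
      by (rule congr_mat_transpose[OF multrow_mat_carrier sym_of_upper_sym])
    moreover have "?E * ?S = multrow k a ?S"
      by (rule multrow_mat[symmetric, OF sym_of_upper_carrier])
    moreover have "?E * (multrow k a ?S)\<^sup>T = multrow k a ((multrow k a ?S)\<^sup>T)"
      by (rule multrow_mat[symmetric, of _ p p]) (use k in auto)
    ultimately have "congr ?E ?S = (multrow k a ((multrow k a ?S)\<^sup>T))\<^sup>T" by (simp only:)
    then show "sym_of_upper p (\<lambda>x\<in>upper_idx p. c x * w x + 0) $$ (i, j) =
      (congr ?E ?S) $$ (i, j)"
      using ij k by (auto simp: upper_idx_def c_def min_absorb1 max_absorb2)
  qed
  have "c x \<noteq> 0" if "x \<in> upper_idx p" for x using a by (auto simp: c_def case_prod_unfold)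
  then show ?thesis
    unfolding c_prod[symmetric]
    by (intro nn_integral_sym_lborel_congr_triangular[OF multrow_mat_carrier F _ borel_measurable_const refl S]) simp_all
qed

lemma nn_integral_sym_lborel_congr:
  assumes "B \<in> carrier_mat p p" "det B \<noteq> 0" "F \<in> borel_measurable (sym_lborel p)"
  shows "integral\<^sup>N (sym_lborel p) F =
    ennreal (\<bar>det B\<bar> ^ Suc p) * (\<integral>\<^sup>+W. F (congr B W) \<partial>sym_lborel p)"
proof -
  let ?c = "\<lambda>B. ennreal (\<bar>det B\<bar> ^ Suc p)"
  \<comment> \<open>\<open>P\<close> quantifies over all \<open>F\<close>, because for a product of
    matrices the rule is applied to \<open>F\<close> composed with a congruence.\<close>
  define P where "P B \<longleftrightarrow> (\<forall>F. F \<in> borel_measurable (sym_lborel p) \<longrightarrow> integral\<^sup>N (sym_lborel p) F =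
    ?c B * (\<integral>\<^sup>+W. F (congr B W) \<partial>sym_lborel p))" for B
  have P_mult: "P (E * M)" if E: "E \<in> carrier_mat p p" "P E" and M: "M \<in> carrier_mat p p" "P M" for E M
    unfolding P_def
  proof (intro allI impI)
    fix F :: "real mat \<Rightarrow> ennreal" assume F: "F \<in> borel_measurable (sym_lborel p)"
    have FE: "(\<lambda>W. F (congr E W)) \<in> borel_measurable (sym_lborel p)"
      by (rule measurable_compose[OF measurable_congr_mat[OF E(1)] F])
    have "integral\<^sup>N (sym_lborel p) F =
      ?c E * (\<integral>\<^sup>+W. F (congr E W) \<partial>sym_lborel p)"
      using E(2) F unfolding P_def by blast
    also have "(\<integral>\<^sup>+W. F (congr E W) \<partial>sym_lborel p) =
      ?c M * (\<integral>\<^sup>+W. F (congr E (congr M W)) \<partial>sym_lborel p)"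
      using M(2) FE unfolding P_def by blast
    also have "\<dots> = ?c M * (\<integral>\<^sup>+W. F (E * M * W * (E * M)\<^sup>T) \<partial>sym_lborel p)"
      by (intro arg_cong2[where f = "(*)"] refl nn_integral_cong)
        (simp only: space_sym_lborel congr_congr[OF M(1) E(1) sym_mats_carrier])
    finally show "integral\<^sup>N (sym_lborel p) F =
      ?c (E * M) * (\<integral>\<^sup>+W. F (E * M * W * (E * M)\<^sup>T) \<partial>sym_lborel p)"
      unfolding det_mult[OF E(1) M(1)] abs_mult power_mult_distrib
      by (simp add: ennreal_mult mult.assoc del: power_Suc)
  qed
  have "P B"
  proof (rule det_nonzero_mat_induct[OF assms(1,2)])
    have "(\<integral>\<^sup>+W. F (1\<^sub>m p * W * (1\<^sub>m p)\<^sup>T) \<partial>sym_lborel p) = integral\<^sup>N (sym_lborel p) F" for F :: "real mat \<Rightarrow> ennreal"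
      by (rule nn_integral_cong) (auto dest!: sym_mats_carrier)
    then show "P (1\<^sub>m p)" unfolding P_def by simp
    show "P (addrow_mat p a k l * M)" if "M \<in> carrier_mat p p" "k < p" "l < p" "k \<noteq> l" "P M" for a k l M
    proof (rule P_mult[OF addrow_mat_carrier _ that(1,5)])
      show "P (addrow_mat p a k l)"
        unfolding P_def det_addrow_mat[OF that(4)]
        using nn_integral_sym_lborel_addrow[OF that(2,3,4)] by simp
    qed
    show "P (multrow_mat p k a * M)" if "M \<in> carrier_mat p p" "k < p" "a \<noteq> 0" "P M" for a k M
    proof (rule P_mult[OF multrow_mat_carrier _ that(1,4)])
      show "P (multrow_mat p k a)"
        unfolding P_def det_multrow_mat[OF that(2)]
        using nn_integral_sym_lborel_multrow[OF that(2,3)] by simp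
    qed
  qed
  then show ?thesis using assms(3) unfolding P_def by blast
qed

section \<open>The Wishart density under congruence\<close>

lemma quad_form_sum:
  fixes W :: "real mat"
  assumes "W \<in> carrier_mat p p" "v \<in> carrier_vec p"
  shows "v \<bullet> (W *\<^sub>v v) = (\<Sum>i<p. \<Sum>j<p. v $ i * (W $$ (i, j) * v $ j))"
  using assms by (auto simp: scalar_prod_def atLeast0LessThan sum_distrib_left intro!: sum.cong)

text \<open>Exhibits the cone as a countable intersection of closed half-spaces, hence as
  measurable. Rational vectors are coded by lists to have a countable type; reading a list beyond
  its length still gives some rational, so every list is a legitimate test vector.\<close>

lemma psd_mats_rat_iff:
  assumes W: "W \<in> sym_mats p"
  shows "W \<in> psd_mats p \<longleftrightarrow>
    (\<forall>l :: rat list. 0 \<le> (\<Sum>i<p. \<Sum>j<p. of_rat (l ! i) * (W $$ (i, j) * of_rat (l ! j))))"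
    (is "_ \<longleftrightarrow> (\<forall>l. 0 \<le> ?q l)")
proof
  assume psd: "W \<in> psd_mats p"
  show "\<forall>l :: rat list. 0 \<le> ?q l"
  proof
    fix l :: "rat list"
    define v where "v = vec p (\<lambda>i. of_rat (l ! i) :: real)"
    have v: "v \<in> carrier_vec p" by (simp add: v_def)
    then have "0 \<le> v \<bullet> (W *\<^sub>v v)" using psd unfolding psd_mats_def by blast
    also have "\<dots> = ?q l"
      unfolding quad_form_sum[OF sym_mats_carrier[OF W] v] by (simp add: v_def)
    finally show "0 \<le> ?q l" .
  qed
next
  assume rat: "\<forall>l :: rat list. 0 \<le> ?q l"
  have "0 \<le> v \<bullet> (W *\<^sub>v v)" if v: "v \<in> carrier_vec p" for v
  proof -
    \<comment> \<open>Rationals between \<open>v $ i\<close> and \<open>v $ i + 1 / (n + 1)\<close>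
      converge to \<open>v $ i\<close>, and nonnegativity of the quadratic form passes to the limit
      by continuity.\<close>
    have "\<forall>i n. \<exists>q :: rat. v $ i < of_rat q \<and> of_rat q < v $ i + 1 / real (Suc n)"
      by (intro allI of_rat_dense) simp
    then obtain q :: "nat \<Rightarrow> nat \<Rightarrow> rat" where
      q: "\<And>i n. v $ i < of_rat (q i n)" "\<And>i n. of_rat (q i n) < v $ i + 1 / real (Suc n)"
      by metis
    have lim: "(\<lambda>n. of_rat (q i n) :: real) \<longlonglongrightarrow> v $ i" for i
    proof (rule tendsto_sandwich[of "\<lambda>_. v $ i" _ _ "\<lambda>n. v $ i + 1 / real (Suc n)"])
      show "(\<lambda>n. v $ i + 1 / real (Suc n)) \<longlonglongrightarrow> v $ i"
        using tendsto_add[OF tendsto_const LIMSEQ_inverse_real_of_nat, of "v $ i"]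
        by (simp add: inverse_eq_divide)
    qed (use q in \<open>auto intro!: always_eventually less_imp_le\<close>)
    have "(\<lambda>n. \<Sum>i<p. \<Sum>j<p. of_rat (q i n) * (W $$ (i, j) * of_rat (q j n))) \<longlonglongrightarrow>
      (\<Sum>i<p. \<Sum>j<p. v $ i * (W $$ (i, j) * v $ j))"
      by (intro tendsto_sum tendsto_mult tendsto_const lim)
    moreover have "0 \<le> (\<Sum>i<p. \<Sum>j<p. of_rat (q i n) * (W $$ (i, j) * of_rat (q j n)))" for n
      using rat[rule_format, of "map (\<lambda>i. q i n) [0..<p]"] by simp
    ultimately show ?thesis
      unfolding quad_form_sum[OF sym_mats_carrier[OF W] v] by (intro LIMSEQ_le_const) auto
  qed
  with W show "W \<in> psd_mats p" unfolding psd_mats_def by blast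
qed

lemma sets_sym_lborel_psd_mats: "{W \<in> space (sym_lborel p). W \<in> psd_mats p} \<in> sets (sym_lborel p)"
proof -
  let ?q = "\<lambda>(l :: rat list) W. \<Sum>i<p. \<Sum>j<p. of_rat (l ! i) * (W $$ (i, j) * of_rat (l ! j)) :: real"
  have "{W \<in> space (sym_lborel p). W \<in> psd_mats p} = {W \<in> space (sym_lborel p). \<forall>l :: rat list.
    0 \<le> ?q l W}"
    using psd_mats_rat_iff by auto
  also have "\<dots> \<in> sets (sym_lborel p)"
  proof (rule sets.sets_Collect_countable_All)
    fix l :: "rat list"
    have "?q l \<in> borel_measurable (sym_lborel p)"
      by (intro borel_measurable_sum borel_measurable_times borel_measurable_const measurable_sym_lborel_entry)
        simp_all
    then show "{W \<in> space (sym_lborel p). 0 \<le> ?q l W}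
      \<in> sets (sym_lborel p)"
      by (rule borel_measurable_le[OF borel_measurable_const])
  qed
  finally show ?thesis .
qed

lemma borel_measurable_det: "det \<in> borel_measurable (sym_lborel p)"
proof -
  have "(\<lambda>W. \<Sum>\<pi>\<in>{\<pi>. \<pi> permutes {0..<p}}. signof \<pi> * (\<Prod>i = 0..<p. W $$ (i, \<pi> i))) \<in> borel_measurable (sym_lborel p)"
    by (intro borel_measurable_sum borel_measurable_times borel_measurable_const borel_measurable_prod
        measurable_sym_lborel_entry) (auto dest: permutes_in_image)
  then show ?thesis
    by (rule measurable_cong[THEN iffD1, rotated]) (simp add: det_def'[OF sym_mats_carrier])
qed

lemma mat_trace_mult:
  assumes "A \<in> carrier_mat p q" "B \<in> carrier_mat q p"
  shows "mat_trace (A * B) = (\<Sum>i<p. \<Sum>j<q. A $$ (i, j) * B $$ (j, i))"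
  using assms by (auto simp: mat_trace_def scalar_prod_def atLeast0LessThan intro!: sum.cong)

lemma mat_trace_mult_commute:
  assumes "A \<in> carrier_mat p q" "B \<in> carrier_mat q p"
  shows "mat_trace (A * B) = mat_trace (B * A)"
  unfolding mat_trace_mult[OF assms] mat_trace_mult[OF assms(2,1)]
  by (subst sum.swap) (simp add: mult.commute)

lemma measurable_mat_trace_mult:
  assumes C: "C \<in> carrier_mat p p"
  shows "(\<lambda>W. mat_trace (C * W)) \<in> borel_measurable (sym_lborel p)"
proof -
  have "(\<lambda>W. \<Sum>i<p. \<Sum>j<p. C $$ (i, j) * W $$ (j, i)) \<in> borel_measurable (sym_lborel p)"
    by (intro borel_measurable_sum borel_measurable_times borel_measurable_const measurable_sym_lborel_entry)
      simp_all
  then show ?thesis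
    by (rule measurable_cong[THEN iffD1, rotated]) (simp add: mat_trace_mult[OF C sym_mats_carrier])
qed

lemma det_pd_mats_pos: "\<Sigma> \<in> pd_mats p \<Longrightarrow> 0 < det \<Sigma>"
  by (erule cholesky) simp

lemma det_psd_mats_nonneg: "W \<in> psd_mats p \<Longrightarrow> 0 \<le> det W"
  using psd_mats_det_nonzero_pd[of W p] det_pd_mats_pos[of W p] by (cases "det W = 0") auto

lemma pd_mats_inverse:
  assumes "\<Sigma> \<in> pd_mats p"
  obtains C where "C \<in> carrier_mat p p" "\<Sigma> * C = 1\<^sub>m p" "C * \<Sigma> = 1\<^sub>m p" "mat_inverse \<Sigma> = Some C"
proof -
  have "det \<Sigma> \<noteq> 0" using det_pd_mats_pos[OF assms] by simp
  then obtain C where "C \<in> carrier_mat p p" "\<Sigma> * C = 1\<^sub>m p" "C * \<Sigma> = 1\<^sub>m p"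
    using ex_inverse_mat[OF pd_mats_carrier[OF assms]] by metis
  then show ?thesis using that mat_inverse_eq[OF pd_mats_carrier[OF assms]] by blast
qed

lemma measurable_wishart_density:
  assumes "\<Sigma> \<in> pd_mats p"
  shows "wishart_density p n \<Sigma> \<in> borel_measurable (sym_lborel p)"
proof -
  obtain C where C: "C \<in> carrier_mat p p" "mat_inverse \<Sigma> = Some C" using pd_mats_inverse[OF assms] by metis
  have det: "(\<lambda>W. det W powr ((real n - real p - 1) / 2)) \<in> borel_measurable (sym_lborel p)"
    using borel_measurable_det by (rule powr_real_measurable) (rule borel_measurable_const)
  have ex: "(\<lambda>W. exp (- (1 / 2) * mat_trace (C * W))) \<in> borel_measurable (sym_lborel p)"
    by (rule measurable_compose[OF _ borel_measurable_exp], intro borel_measurable_times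
        borel_measurable_const measurable_mat_trace_mult C)
  show ?thesis
    unfolding wishart_density_def C(2) option.sel
    by (rule measurable_If[OF measurable_compose[OF borel_measurable_times[OF
      borel_measurable_times[OF borel_measurable_const det] ex] measurable_ennreal]
      borel_measurable_const sets_sym_lborel_psd_mats])
qed

lemma sets_wishart[simp]: "sets (wishart p n \<Sigma>) = sets (sym_lborel p)"
  and space_wishart[simp]: "space (wishart p n \<Sigma>) = sym_mats p"
  by (simp_all add: wishart_def)

text \<open>Comparing integrals of test functions lets the substitution rules act directly, and it
  is available before the total mass is known to be 1.\<close>

lemma distr_wishart_eqI:
  assumes \<Sigma>: "\<Sigma> \<in> pd_mats p" "\<Sigma>' \<in> pd_mats q" and T: "T \<in> measurable (sym_lborel p) (sym_lborel q)"
    and eq: "\<And>G. G \<in> borel_measurable (sym_lborel q) \<Longrightarrow>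
      (\<integral>\<^sup>+W. wishart_density p n \<Sigma> W * G (T W) \<partial>sym_lborel p) =
      (\<integral>\<^sup>+V. wishart_density q m \<Sigma>' V * G V \<partial>sym_lborel q)"
  shows "distr (wishart p n \<Sigma>) (sym_lborel q) T = wishart q m \<Sigma>'"
proof (rule measure_eqI)
  fix X assume "X \<in> sets (distr (wishart p n \<Sigma>) (sym_lborel q) T)"
  then have X: "X \<in> sets (sym_lborel q)" by simp
  have T': "T \<in> measurable (wishart p n \<Sigma>) (sym_lborel q)"
    using T by (simp add: measurable_cong_sets[OF sets_wishart refl])
  have TX: "T -` X \<inter> space (sym_lborel p) \<in> sets (sym_lborel p)"
    using T X by (rule measurable_sets)
  have "emeasure (distr (wishart p n \<Sigma>) (sym_lborel q) T) X = emeasure (wishart p n \<Sigma>) (T -` X \<inter> space (sym_lborel p))"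
    by (simp add: emeasure_distr[OF T' X])
  also have "\<dots> = (\<integral>\<^sup>+W. wishart_density p n \<Sigma> W * indicator (T -` X \<inter> space (sym_lborel p)) W \<partial>sym_lborel p)"
    unfolding wishart_def by (rule emeasure_density[OF measurable_wishart_density[OF \<Sigma>(1)] TX])
  also have "\<dots> = (\<integral>\<^sup>+W. wishart_density p n \<Sigma> W * indicator X (T W) \<partial>sym_lborel p)"
    by (rule nn_integral_cong) (simp add: indicator_def)
  also have "\<dots> = (\<integral>\<^sup>+V. wishart_density q m \<Sigma>' V * indicator X V \<partial>sym_lborel q)"
    using X by (intro eq borel_measurable_indicator)
  also have "\<dots> = emeasure (wishart q m \<Sigma>') X"
    unfolding wishart_def by (rule emeasure_density[symmetric, OF measurable_wishart_density[OF \<Sigma>(2)] X])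
  finally show "emeasure (distr (wishart p n \<Sigma>) (sym_lborel q) T) X = emeasure (wishart q m \<Sigma>') X" .
qed simp

section \<open>The density under an invertible congruence\<close>

lemma inverse_congr:
  assumes B: "(B :: real mat) \<in> carrier_mat p p" and D: "D \<in> carrier_mat p p" "D * B = 1\<^sub>m p"
    and S: "S \<in> carrier_mat p p" and C: "C \<in> carrier_mat p p" "S * C = 1\<^sub>m p"
  shows "congr B S * (D\<^sup>T * C * D) = 1\<^sub>m p"
proof -
  have BT: "B\<^sup>T \<in> carrier_mat p p" and DT: "D\<^sup>T \<in> carrier_mat p p" using B D by auto
  have BD: "B * D = 1\<^sub>m p" using mat_mult_left_right_inverse[OF D(1) B D(2)] .
  have "B\<^sup>T * D\<^sup>T = (D * B)\<^sup>T" using transpose_mult[OF D(1) B] by simp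
  then have BTDT: "B\<^sup>T * D\<^sup>T = 1\<^sub>m p" using D by simp
  have CD: "C * D \<in> carrier_mat p p" using C D by auto
  have "congr B S * (D\<^sup>T * C * D) = B * S * (B\<^sup>T * (D\<^sup>T * C * D))"
    using B S by (intro assoc_mult_mat[of _ p p _ p _ p]) (use C D in auto)
  also have "D\<^sup>T * C * D = D\<^sup>T * (C * D)" by (rule assoc_mult_mat[OF DT C(1) D(1)])
  also have "B\<^sup>T * (D\<^sup>T * (C * D)) = B\<^sup>T * D\<^sup>T * (C * D)" by (rule assoc_mult_mat[symmetric, OF BT DT CD])
  also have "\<dots> = C * D" unfolding BTDT by (rule left_mult_one_mat[OF CD])
  also have "B * S * (C * D) = B * (S * (C * D))" by (rule assoc_mult_mat[OF B S CD])
  also have "S * (C * D) = S * C * D" by (rule assoc_mult_mat[symmetric, OF S C(1) D(1)])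
  also have "\<dots> = D" unfolding C(2) by (rule left_mult_one_mat[OF D(1)])
  finally show ?thesis using BD by (simp only: assoc_mult_mat[OF DT C(1) D(1)])
qed

text \<open>The argument of the exponential is invariant under simultaneous congruence of \<Sigma>
  and \<open>W\<close>: \<open>D * B\<close> cancels in the middle, and cyclicity of the trace
  brings \<open>B\<^sup>T\<close> and \<open>D\<^sup>T\<close> together.\<close>

lemma mat_trace_inverse_congr:
  assumes B: "(B :: real mat) \<in> carrier_mat p p" and D: "D \<in> carrier_mat p p" "D * B = 1\<^sub>m p"
    and C: "C \<in> carrier_mat p p" and W: "W \<in> carrier_mat p p"
  shows "mat_trace ((D\<^sup>T * C * D) * congr B W) = mat_trace (C * W)"
proof -
  have BT: "B\<^sup>T \<in> carrier_mat p p" and DT: "D\<^sup>T \<in> carrier_mat p p" and WBT: "W * B\<^sup>T \<in> carrier_mat p p"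
    and DTC: "D\<^sup>T * C \<in> carrier_mat p p"
    and CWBT: "C * (W * B\<^sup>T) \<in> carrier_mat p p"
    using B D C W by auto
  have "B\<^sup>T * D\<^sup>T = (D * B)\<^sup>T" using transpose_mult[OF D(1) B] by simp
  then have BTDT: "B\<^sup>T * D\<^sup>T = 1\<^sub>m p" using D by simp
  have "(D\<^sup>T * C * D) * congr B W = D\<^sup>T * C * (D * (B * (W * B\<^sup>T)))"
    using assoc_mult_mat[OF B W BT] assoc_mult_mat[OF DTC D(1) mult_carrier_mat[OF B WBT]] by simp
  also have "D * (B * (W * B\<^sup>T)) = D * B * (W * B\<^sup>T)" by (rule assoc_mult_mat[symmetric, OF D(1) B WBT])
  also have "\<dots> = W * B\<^sup>T" unfolding D(2) by (rule left_mult_one_mat[OF WBT])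
  also have "D\<^sup>T * C * (W * B\<^sup>T) = D\<^sup>T * (C * (W * B\<^sup>T))" by (rule assoc_mult_mat[OF DT C WBT])
  finally have "mat_trace ((D\<^sup>T * C * D) * congr B W) = mat_trace (C * (W * B\<^sup>T) * D\<^sup>T)"
    using mat_trace_mult_commute[OF DT CWBT] by simp
  also have "C * (W * B\<^sup>T) * D\<^sup>T = C * (W * B\<^sup>T * D\<^sup>T)" by (rule assoc_mult_mat[OF C WBT DT])
  also have "W * B\<^sup>T * D\<^sup>T = W * (B\<^sup>T * D\<^sup>T)" by (rule assoc_mult_mat[OF W BT DT])
  also have "\<dots> = W" unfolding BTDT by (rule right_mult_one_mat[OF W])
  finally show ?thesis .
qed

lemma det_congr:
  assumes "(B :: real mat) \<in> carrier_mat p p" "W \<in> carrier_mat p p"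
  shows "det (congr B W) = (det B)\<^sup>2 * det W"
proof -
  have "det (congr B W) = det (B * W) * det (B\<^sup>T)"
    using assms by (intro det_mult) auto
  then show ?thesis using det_mult[OF assms] det_transpose[OF assms(1)] by (simp add: power2_eq_square)
qed

text \<open>The powers of \<open>\<bar>det B\<bar>\<close> cancel: \<open>p + 1\<close> from the
  Jacobian, \<open>n - p - 1\<close> from the determinant of the argument and \<open>- n\<close>
  from the determinant of the scale matrix.\<close>

lemma wishart_density_congr:
  assumes \<Sigma>: "\<Sigma> \<in> pd_mats p" and B: "B \<in> carrier_mat p p" "det B \<noteq> 0" and W: "W \<in> sym_mats p"
  shows "ennreal (\<bar>det B\<bar> ^ Suc p) * wishart_density p n (congr B \<Sigma>) (congr B W) =
    wishart_density p n \<Sigma> W"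
proof (cases "W \<in> psd_mats p")
  case False
  then show ?thesis
    using psd_mats_congr_iff[OF B sym_mats_carrier[OF W]] by (simp add: wishart_density_def)
next
  case True
  note Wc = sym_mats_carrier[OF W] and \<Sigma>c = pd_mats_carrier[OF \<Sigma>]
  obtain C where C: "C \<in> carrier_mat p p" "\<Sigma> * C = 1\<^sub>m p" "mat_inverse \<Sigma> = Some C"
    using pd_mats_inverse[OF \<Sigma>] by metis
  obtain D where D: "D \<in> carrier_mat p p" "D * B = 1\<^sub>m p" using ex_inverse_mat[OF B] by metis
  have inv: "mat_inverse (congr B \<Sigma>) = Some (D\<^sup>T * C * D)"
    by (rule mat_inverse_eq[OF _ _ inverse_congr[OF B(1) D \<Sigma>c C(1,2)]]) (use B \<Sigma>c C D in auto)
  define d where "d = \<bar>det B\<bar>"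
  have d: "d > 0" using B by (simp add: d_def)
  define w where "w = det W"
  have w: "w \<ge> 0" using det_psd_mats_nonneg[OF True] by (simp add: w_def)
  define s where "s = det \<Sigma>"
  have s: "s > 0" using det_pd_mats_pos[OF \<Sigma>] by (simp add: s_def)
  define G where "G = mv_Gamma p (real n / 2)"
  define e where "e = exp (- (1 / 2) * mat_trace (C * W))"
  define t where "t = 2 powr (real n * real p / 2)"
  have det2: "(det B)\<^sup>2 = d\<^sup>2" by (simp add: d_def)
  \<comment> \<open>Each determinant changes by the factor \<open>(det B)\<^sup>2\<close>, and the
    halved exponents of the density turn this into a plain power of \<open>d\<close>.\<close>
  have sq_powr: "(d\<^sup>2 * x) powr (a / 2) = d powr a * x powr (a / 2)" if "x \<ge> 0" for x a
  proof -
    have "(d\<^sup>2) powr (a / 2) = d powr a" using d by (simp add: powr_powr flip: powr_numeral)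
    then show ?thesis using d that by (simp add: powr_mult)
  qed
  let ?K = "1 / (t * (d powr (real n) * s powr (real n / 2)) * G)
      * (d powr (real n - real p - 1) * w powr ((real n - real p - 1) / 2)) * e"
  have "d ^ Suc p = d powr (real p + 1)" using d by (subst powr_realpow[symmetric]) (auto simp: add.commute)
  moreover have "d powr (real p + 1) * (d powr (real n - real p - 1) / d powr (real n)) = 1"
    using d by (simp flip: powr_add powr_diff)
  ultimately have key: "d ^ Suc p * ?K
    = 1 / (t * s powr (real n / 2) * G) * w powr ((real n - real p - 1) / 2) * e"
    using d s by (simp add: field_simps del: power_Suc)
  have "ennreal (d ^ Suc p) * wishart_density p n (congr B \<Sigma>) (congr B W) =
    ennreal (d ^ Suc p) * ennreal ?K"
    using True psd_mats_congr_iff[OF B Wc] s w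
    unfolding wishart_density_def inv option.sel mat_trace_inverse_congr[OF B(1) D C(1) Wc]
      det_congr[OF B(1) Wc] det_congr[OF B(1) \<Sigma>c] det2 t_def[symmetric] s_def[symmetric] w_def[symmetric]
      e_def[symmetric] G_def[symmetric] sq_powr[OF less_imp_le[OF s]] sq_powr[OF w]
    by simp
  also have "\<dots> = ennreal (d ^ Suc p * ?K)"
    using d by (intro ennreal_mult'[symmetric]) simp
  also have "\<dots> = wishart_density p n \<Sigma> W"
    unfolding key using True unfolding wishart_density_def C(3) option.sel
    by (simp add: t_def s_def w_def e_def G_def)
  finally show ?thesis by (simp add: d_def)
qed

lemma distr_wishart_congr_square:
  assumes \<Sigma>: "\<Sigma> \<in> pd_mats p" and B: "B \<in> carrier_mat p p" "det B \<noteq> 0"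
  shows "distr (wishart p n \<Sigma>) (sym_lborel p) (congr B) = wishart p n (congr B \<Sigma>)"
proof -
  have \<Sigma>': "congr B \<Sigma> \<in> pd_mats p" using pd_mats_congr_iff[OF B pd_mats_carrier[OF \<Sigma>]] \<Sigma> by simp
  show ?thesis
  proof (rule distr_wishart_eqI[OF \<Sigma> \<Sigma>' measurable_congr_mat[OF B(1)]])
    fix G :: "real mat \<Rightarrow> ennreal" assume G: "G \<in> borel_measurable (sym_lborel p)"
    let ?F = "\<lambda>V. wishart_density p n (congr B \<Sigma>) V * G V"
    have F: "?F \<in> borel_measurable (sym_lborel p)"
      by (rule borel_measurable_times_ennreal[OF measurable_wishart_density[OF \<Sigma>'] G])
    have "(\<integral>\<^sup>+V. ?F V \<partial>sym_lborel p) =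
      ennreal (\<bar>det B\<bar> ^ Suc p) * (\<integral>\<^sup>+W. ?F (congr B W) \<partial>sym_lborel p)"
      by (rule nn_integral_sym_lborel_congr[OF B F])
    also have "\<dots> = (\<integral>\<^sup>+W. ennreal (\<bar>det B\<bar> ^ Suc p) * ?F (congr B W) \<partial>sym_lborel p)"
      by (rule nn_integral_cmult[symmetric]) (rule measurable_compose[OF measurable_congr_mat[OF B(1)] F])
    also have "\<dots> = (\<integral>\<^sup>+W. wishart_density p n \<Sigma> W * G (congr B W) \<partial>sym_lborel p)"
      by (rule nn_integral_cong)
        (simp only: space_sym_lborel mult.assoc[symmetric] wishart_density_congr[OF \<Sigma> B])
    finally show "(\<integral>\<^sup>+W. wishart_density p n \<Sigma> W * G (congr B W) \<partial>sym_lborel p) = (\<integral>\<^sup>+V. ?F V \<partial>sym_lborel p)"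
      by (rule sym)
  qed
qed

section \<open>Splitting off the last row and column\<close>

text \<open>The last column keeps the pairs \<open>(i, p)\<close> that it has inside
  \<open>upper_idx (Suc p)\<close>, so the coordinates split as a disjoint union without
  renaming.\<close>

definition col_idx :: "nat \<Rightarrow> (nat \<times> nat) set" where
  "col_idx p = (\<lambda>i. (i, p)) ` {..<p}"

definition bordered :: "nat \<Rightarrow> real mat \<Rightarrow> (nat \<times> nat \<Rightarrow> real) \<Rightarrow> real \<Rightarrow> real mat" where
  "bordered p V x y = four_block_mat V (mat p 1 (\<lambda>(i, _). x (i, p))) (mat 1 p (\<lambda>(_, j). x (j, p))) (mat 1 1 (\<lambda>_. y))"

abbreviation col_lborel :: "nat \<Rightarrow> (nat \<times> nat \<Rightarrow> real) measure" where
  "col_lborel p \<equiv> PiM_lborel (col_idx p)"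

lemma finite_col_idx[simp]: "finite (col_idx p)"
  by (simp add: col_idx_def)

lemma bordered_index:
  assumes "V \<in> carrier_mat p p" "i < Suc p" "j < Suc p"
  shows "bordered p V x y $$ (i, j) = (if i < p then if j < p then V $$ (i, j) else x (i, p)
    else if j < p then x (j, p) else y)"
  using assms by (auto simp: bordered_def)

lemma bordered_dim[simp]:
  "V \<in> carrier_mat p p \<Longrightarrow> bordered p V x y \<in> carrier_mat (Suc p) (Suc p)"
  using four_block_carrier_mat[of V p p "mat 1 1 (\<lambda>_. y)" 1 1] by (simp add: bordered_def)

lemma bordered_sym:
  assumes V: "V \<in> sym_mats p"
  shows "bordered p V x y \<in> sym_mats (Suc p)"
proof -
  note Vc = sym_mats_carrier[OF V]
  have "(bordered p V x y)\<^sup>T = bordered p V x y"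
  proof (rule eq_matI)
    fix i j assume "i < dim_row (bordered p V x y)" "j < dim_col (bordered p V x y)"
    then have ij: "i < Suc p" "j < Suc p" using Vc by (auto simp: bordered_def)
    then have "(bordered p V x y)\<^sup>T $$ (i, j) = bordered p V x y $$ (j, i)"
      using Vc by (intro index_transpose_mat(1)) (auto simp: bordered_def)
    also have "\<dots> = bordered p V x y $$ (i, j)"
      unfolding bordered_index[OF Vc ij] bordered_index[OF Vc ij(2,1)] using sym_mats_index[OF V] by simp
    finally show "(bordered p V x y)\<^sup>T $$ (i, j) = bordered p V x y $$ (i, j)" .
  qed (use Vc in \<open>auto simp: bordered_def\<close>)
  then show ?thesis using Vc by (simp add: sym_mats_def)
qed

lemma drop_last_bordered:
  assumes V: "V \<in> carrier_mat p p"
  shows "congr (drop_mat p) (bordered p V x y) = V"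
  unfolding drop_last_congr[OF bordered_dim[OF V]]
  by (rule eq_matI) (use V in \<open>auto simp: bordered_index[OF V]\<close>)

lemma measurable_bordered:
  assumes V: "V \<in> sym_mats p"
  shows "(\<lambda>(x, y). bordered p V x y) \<in> measurable (col_lborel p \<Otimes>\<^sub>M lborel) (sym_lborel (Suc p))"
proof (rule measurable_sym_lborelI)
  let ?M = "col_lborel p \<Otimes>\<^sub>M (lborel :: real measure)"
  show "(case xy of (x, y) \<Rightarrow> bordered p V x y) \<in> sym_mats (Suc p)" for xy
    using bordered_sym[OF V] by (simp add: case_prod_unfold)
  fix i j :: nat assume ij: "i \<le> j" "j < Suc p"
  have eq: "(case xy of (x, y) \<Rightarrow> bordered p V x y) $$ (i, j) =
    (if j < p then V $$ (i, j) else if i < p then fst xy (i, p) else snd xy)" for xy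
    using ij bordered_index[OF sym_mats_carrier[OF V], of i j] by (simp add: case_prod_unfold)
  have x: "(\<lambda>xy. fst xy (i, p)) \<in> borel_measurable ?M" if "i < p"
    by (rule measurable_compose[OF measurable_fst measurable_PiM_component])
      (use that in \<open>simp add: col_idx_def\<close>)
  have y: "snd \<in> borel_measurable ?M"
    using measurable_snd[of "col_lborel p" "lborel :: real measure"] by simp
  show "(\<lambda>xy. (case xy of (x, y) \<Rightarrow> bordered p V x y) $$ (i, j)) \<in> borel_measurable ?M"
    unfolding eq using x y by (cases "j < p"; cases "i < p") (simp_all only: if_True if_False borel_measurable_const simp_thms)
qed

lemma upper_idx_Suc: "upper_idx (Suc p) = upper_idx p \<union> insert (p, p) (col_idx p)"
  by (auto simp: upper_idx_def col_idx_def less_Suc_eq)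

text \<open>Fubini for leading block, last column and corner. The corner is innermost because the
  Gamma integral will be evaluated at a fixed column.\<close>

lemma nn_integral_sym_lborel_Suc:
  assumes F: "F \<in> borel_measurable (sym_lborel (Suc p))"
  shows "integral\<^sup>N (sym_lborel (Suc p)) F =
    (\<integral>\<^sup>+v. (\<integral>\<^sup>+x. (\<integral>\<^sup>+y. F (bordered p (sym_of_upper p v) x y) \<partial>lborel) \<partial>col_lborel p) \<partial>upper_lborel p)"
proof -
  interpret product_sigma_finite "\<lambda>_ :: nat \<times> nat. lborel :: real measure" by standard
  let ?I = "upper_idx p" and ?J = "insert (p, p) (col_idx p)"
  let ?f = "\<lambda>w. F (sym_of_upper (Suc p) w)"
  have disj: "?I \<inter> ?J = {}" and new: "(p, p) \<notin> col_idx p"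
    by (auto simp: upper_idx_def col_idx_def)
  have f: "?f \<in> borel_measurable (PiM_lborel (?I \<union> ?J))"
    using measurable_compose[OF measurable_sym_of_upper F] by (simp add: upper_idx_Suc)
  have eq: "sym_of_upper (Suc p) (merge ?I ?J (v, x((p, p) := y))) = bordered p (sym_of_upper p v) x y" for v x y
  proof (rule sym_mats_eqI[OF sym_of_upper_sym bordered_sym[OF sym_of_upper_sym]])
    fix i j :: nat assume ij: "i \<le> j" "j < Suc p"
    then show "sym_of_upper (Suc p) (merge ?I ?J (v, x((p, p) := y))) $$ (i, j) = bordered p (sym_of_upper p v) x y $$ (i, j)"
      unfolding bordered_index[OF sym_of_upper_carrier le_less_trans[OF ij] ij(2)]
      by (cases "j = p") (auto simp: merge_def upper_idx_def col_idx_def min_absorb1 max_absorb2)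
  qed
  have "integral\<^sup>N (sym_lborel (Suc p)) F = (\<integral>\<^sup>+w. ?f w \<partial>PiM_lborel (?I \<union> ?J))"
    unfolding nn_integral_sym_lborel[OF F] upper_idx_Suc ..
  also have "\<dots> = (\<integral>\<^sup>+v. (\<integral>\<^sup>+z. ?f (merge ?I ?J (v, z)) \<partial>PiM_lborel ?J) \<partial>upper_lborel p)"
    by (rule product_nn_integral_fold[OF disj _ _ f]) simp_all
  also have "\<dots> = (\<integral>\<^sup>+v. (\<integral>\<^sup>+x. (\<integral>\<^sup>+y. ?f (merge ?I ?J (v, x((p, p) := y))) \<partial>lborel) \<partial>col_lborel p) \<partial>upper_lborel p)"
  proof (rule nn_integral_cong, rule product_nn_integral_insert[OF finite_col_idx new])
    fix v assume "v \<in> space (upper_lborel p)"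
    then show "(\<lambda>z. ?f (merge ?I ?J (v, z))) \<in> borel_measurable (PiM_lborel ?J)"
      by (intro measurable_compose[OF measurable_compose[OF measurable_Pair1' measurable_merge] f])
  qed
  finally show ?thesis unfolding eq .
qed

section \<open>One-dimensional Gaussian and Gamma integrals\<close>

lemma nn_integral_exp_square_half:
  "(\<integral>\<^sup>+z. ennreal (exp (- z\<^sup>2 / 2)) \<partial>lborel) = ennreal (sqrt (2 * pi))"
proof -
  have "(\<integral>\<^sup>+z. ennreal (exp (- z\<^sup>2 / 2)) \<partial>lborel) =
      (\<integral>\<^sup>+z. ennreal (sqrt (2 * pi)) * ennreal (std_normal_density z) \<partial>lborel)"
    by (intro nn_integral_cong) (simp add: std_normal_density_def flip: ennreal_mult)
  also have "\<dots> = ennreal (sqrt (2 * pi)) * (\<integral>\<^sup>+z. ennreal (std_normal_density z) \<partial>lborel)"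
    by (rule nn_integral_cmult) simp
  also have "(\<integral>\<^sup>+z. ennreal (std_normal_density z) \<partial>lborel) = 1"
    by (subst nn_integral_eq_integral) auto
  finally show ?thesis by simp
qed

text \<open>The Gamma integral after the substitution \<open>t = s / 2\<close>. For
  \<open>b = (n - p) / 2\<close> it is the normalizing constant of the chi-square density with
  \<open>n - p\<close> degrees of freedom, the law of the Schur complement.\<close>

lemma nn_integral_powr_exp_half:
  assumes b: "b > 0"
  shows "(\<integral>\<^sup>+s. indicator {0..} s * ennreal (s powr (b - 1) * exp (- s / 2)) \<partial>lborel) = ennreal (2 powr b * Gamma b)"
proof -
  let ?f = "\<lambda>t. indicator {0..} t * t powr (b - 1) / exp t"
    and ?g = "\<lambda>s. indicator {0..} s * ennreal (s powr (b - 1) * exp (- s / 2))"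
  have "ennreal (Gamma b) = (\<integral>\<^sup>+t. ennreal (?f t) \<partial>lborel)"
    by (rule Gamma_conv_nn_integral_real[OF b])
  also have "\<dots> = ennreal \<bar>1 / 2\<bar> * (\<integral>\<^sup>+s. ennreal (?f (0 + 1 / 2 * s)) \<partial>lborel)"
    by (rule nn_integral_real_affine) simp_all
  also have "(\<integral>\<^sup>+s. ennreal (?f (0 + 1 / 2 * s)) \<partial>lborel) =
    (\<integral>\<^sup>+s. ennreal ((1 / 2) powr (b - 1)) * ?g s \<partial>lborel)"
  proof (rule nn_integral_cong)
    fix s :: real
    have "(s / 2) powr (b - 1) / exp (s / 2) = (1 / 2) powr (b - 1) * (s powr (b - 1) * exp (- s / 2))" if "s \<ge> 0"
      using that by (simp add: powr_divide exp_minus field_simps)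
    then show "ennreal (?f (0 + 1 / 2 * s)) =
      ennreal ((1 / 2) powr (b - 1)) * ?g s"
      by (cases "s \<ge> 0") (simp_all add: indicator_def flip: ennreal_mult)
  qed
  also have "\<dots> = ennreal ((1 / 2) powr (b - 1)) * integral\<^sup>N lborel ?g"
    by (rule nn_integral_cmult) simp
  finally have eq: "ennreal (Gamma b) = ennreal \<bar>1 / 2\<bar> * (ennreal ((1 / 2) powr (b - 1)) *
    integral\<^sup>N lborel ?g)" .
  have half: "1 / 2 * (1 / 2) powr (b - 1) = (1 / 2 :: real) powr b"
    by (simp add: powr_diff)
  have "2 powr b * (1 / 2 :: real) powr b = 1" by (simp add: powr_mult[symmetric])
  then have one: "2 powr b * (\<bar>1 / 2\<bar> * (1 / 2) powr (b - 1)) = (1 :: real)" using half by simp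
  have "ennreal (2 powr b * Gamma b) = ennreal (2 powr b) * ennreal (Gamma b)"
    using b by (intro ennreal_mult) (auto intro: Gamma_real_nonneg)
  also have "\<dots> = ennreal (2 powr b) * (ennreal \<bar>1 / 2\<bar> * ennreal ((1 / 2) powr (b - 1))) *
    integral\<^sup>N lborel ?g"
    unfolding eq by (simp add: mult.assoc)
  also have "ennreal (2 powr b) * (ennreal \<bar>1 / 2\<bar> * ennreal ((1 / 2) powr (b - 1))) = 1"
    using arg_cong[OF one, of ennreal]
    by (simp only: ennreal_mult powr_ge_zero abs_ge_zero mult_nonneg_nonneg ennreal_1)
  finally show ?thesis by simp
qed

text \<open>The exponent of \<open>pi\<close> grows from \<open>p (p - 1) / 4\<close> to
  \<open>(p + 1) p / 4\<close>. The new power of \<open>pi\<close> will be supplied by the Gaussian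
  integral over the last column, the new \<open>Gamma\<close> factor by the integral over the
  corner.\<close>

lemma mv_Gamma_Suc:
  "mv_Gamma (Suc p) a = pi powr (real p / 2) * mv_Gamma p a * Gamma (a - real p / 2)"
proof -
  have "pi powr (real (Suc p) * (real (Suc p) - 1) / 4) = pi powr (real p / 2) * pi powr (real p * (real p - 1) / 4)"
    by (simp flip: powr_add) (simp add: field_simps)
  then show ?thesis by (simp add: mv_Gamma_def)
qed

lemma one_mat_pd: "1\<^sub>m p \<in> pd_mats p"
proof -
  have "0 < v \<bullet> (1\<^sub>m p *\<^sub>v v)" if v: "v \<in> carrier_vec p" "v \<noteq> 0\<^sub>v p" for v :: "real vec"
  proof -
    have "\<exists>i<p. v $ i \<noteq> 0" using v by (metis carrier_vecD eq_vecI index_zero_vec)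
    then have "0 < (\<Sum>i<p. v $ i * v $ i)"
      by (auto intro!: sum_pos2 simp: zero_less_mult_iff linorder_neq_iff)
    then show ?thesis using v by (simp add: scalar_prod_def atLeast0LessThan)
  qed
  then show ?thesis by (simp add: pd_mats_def sym_mats_def)
qed

lemma mat_inverse_one: "mat_inverse (1\<^sub>m p :: real mat) = Some (1\<^sub>m p)"
  by (rule mat_inverse_eq) auto

lemma wishart_density_one:
  assumes "W \<in> sym_mats p"
  shows "wishart_density p n (1\<^sub>m p) W = (if W \<in> psd_mats p then
    ennreal (1 / (2 powr (real n * real p / 2) * mv_Gamma p (real n / 2)) *
      det W powr ((real n - real p - 1) / 2) * exp (- mat_trace W / 2)) else 0)"
  using sym_mats_carrier[OF assms] by (simp add: wishart_density_def mat_inverse_one)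

text \<open>A semidefinite matrix that is not definite has determinant 0, and
  \<open>0 powr a = 0\<close> for every real \<open>a\<close>, even where the usual power would be
  infinite.\<close>

lemma wishart_density_not_pd:
  assumes W: "W \<in> sym_mats p" "W \<notin> pd_mats p"
  shows "wishart_density p n \<Sigma> W = 0"
  using psd_mats_det_nonzero_pd[of W p] W
  by (cases "det W = 0") (auto simp: wishart_density_def)

lemma mat_trace_bordered:
  assumes "V \<in> carrier_mat p p"
  shows "mat_trace (bordered p V x y) = mat_trace V + y"
  using assms bordered_index[OF assms] carrier_matD[OF bordered_dim[OF assms, of x y]]
  by (simp add: mat_trace_def)

abbreviation col_image :: "nat \<Rightarrow> real mat \<Rightarrow> (nat \<times> nat \<Rightarrow> real) \<Rightarrow> nat \<times> nat \<Rightarrow> real" where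
  "col_image p L z \<equiv> \<lambda>(i, j)\<in>col_idx p. \<Sum>k<p. L $$ (i, k) * z (k, p)"

text \<open>The column \<open>L z\<close> and the corner \<open>|z|^2 + s\<close> are chosen so that
  the Schur complement of the leading block is exactly \<open>s\<close>.\<close>

lemma bordered_cholesky:
  assumes L: "L \<in> carrier_mat p p"
  shows "bordered p (L * L\<^sup>T) (col_image p L z) ((\<Sum>k<p. (z (k, p))\<^sup>2) + s) =
    border_mat p L (mat 1 p (\<lambda>(_, j). z (j, p))) 1 * diag_last p s * (border_mat p L (mat 1 p (\<lambda>(_, j). z (j, p))) 1)\<^sup>T"
proof -
  define r where "r = mat 1 p (\<lambda>(_, j). z (j, p))"
  define x where "x = col_image p L z"
  have r: "r \<in> carrier_mat 1 p" by (simp add: r_def)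
  have x: "x (i, p) = (\<Sum>k<p. L $$ (i, k) * z (k, p))" if "i < p" for i
    using that by (simp add: x_def col_idx_def)
  have Lr: "L * r\<^sup>T = mat p 1 (\<lambda>(i, _). x (i, p))"
    by (rule eq_matI) (use L in \<open>auto simp: r_def x scalar_prod_def atLeast0LessThan intro!: sum.cong\<close>)
  have rL: "r * L\<^sup>T = mat 1 p (\<lambda>(_, j). x (j, p))"
    by (rule eq_matI) (use L in \<open>auto simp: r_def x scalar_prod_def atLeast0LessThan mult.commute intro!: sum.cong\<close>)
  have rr: "(r * r\<^sup>T) $$ (0, 0) = (\<Sum>k<p. (z (k, p))\<^sup>2)"
    by (auto simp: r_def scalar_prod_def atLeast0LessThan power2_eq_square intro!: sum.cong)
  show ?thesis
    unfolding r_def[symmetric] x_def[symmetric] border_mat_congr(1)[OF L r] Lr rL rr bordered_def ..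
qed

text \<open>Row \<open>i\<close> of a lower triangular \<open>L\<close> reads only the coordinates
  up to \<open>i\<close>, so the substitution is triangular when ranked by the row index; its
  Jacobian is the product of the diagonal of \<open>L\<close>.\<close>

lemma nn_integral_col_cholesky:
  assumes L: "L \<in> carrier_mat p p" "\<And>i j. i < j \<Longrightarrow> j < p \<Longrightarrow> L $$ (i, j) = 0" "\<And>i. i < p \<Longrightarrow> 0 < L $$ (i, i)"
    and f: "f \<in> borel_measurable (col_lborel p)"
  shows "(\<integral>\<^sup>+x. f x \<partial>col_lborel p) = ennreal (det L) *
    (\<integral>\<^sup>+z. f (col_image p L z) \<partial>col_lborel p)"
proof -
  let ?K = "col_idx p"
  define g where "g = (\<lambda>(i :: nat, j :: nat) z. \<Sum>k<i. L $$ (i, k) * z (k, p))"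
  define c where "c = (\<lambda>(i, j :: nat). L $$ (i, i))"
  have gm: "g x \<in> borel_measurable (col_lborel p)" if x: "x \<in> ?K" for x
  proof -
    obtain i where i: "x = (i, p)" "i < p" using x by (auto simp: col_idx_def)
    show ?thesis unfolding i(1) g_def prod.case
      by (intro borel_measurable_sum borel_measurable_times borel_measurable_const measurable_PiM_component)
        (use i(2) in \<open>auto simp: col_idx_def\<close>)
  qed
  have dep: "g x w = g x w'" if x: "x \<in> ?K" and eq: "\<And>y. y \<in> ?K \<Longrightarrow> fst y < fst x \<Longrightarrow> w y = w' y" for x w w'
  proof -
    obtain i where i: "x = (i, p)" "i < p" using x by (auto simp: col_idx_def)
    have "w (k, p) = w' (k, p)" if "k < i" for k
      by (rule eq) (use that i in \<open>auto simp: col_idx_def\<close>)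
    then show ?thesis unfolding i(1) g_def prod.case by (intro sum.cong) auto
  qed
  have c: "(\<Prod>x\<in>?K. \<bar>c x\<bar>) = det L"
  proof -
    have "(\<Prod>x\<in>?K. \<bar>c x\<bar>) = (\<Prod>i<p. \<bar>L $$ (i, i)\<bar>)"
      unfolding col_idx_def by (subst prod.reindex) (auto simp: inj_on_def c_def)
    also have "\<dots> = (\<Prod>i<p. L $$ (i, i))" using L(3) by (intro prod.cong) (auto simp: abs_of_pos)
    also have "\<dots> = det L" by (rule det_lower_triangular_prod[symmetric, OF L(1,2)])
    finally show ?thesis .
  qed
  have c0: "c x \<noteq> 0" if x: "x \<in> ?K" for x
  proof -
    obtain i where i: "x = (i, p)" "i < p" using x by (auto simp: col_idx_def)
    then show ?thesis using L(3)[of i] by (simp add: c_def)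
  qed
  have map: "(\<lambda>x\<in>?K. if x \<in> ?K then c x * z x + g x z else z x) = (\<lambda>(i, j)\<in>?K. \<Sum>k<p. L $$ (i, k) * z (k, p))" for z
  proof
    fix x
    show "(\<lambda>x\<in>?K. if x \<in> ?K then c x * z x + g x z else z x) x = (\<lambda>(i, j)\<in>?K. \<Sum>k<p. L $$ (i, k) * z (k, p)) x"
    proof (cases "x \<in> ?K")
      case True
      then obtain i where i: "x = (i, p)" "i < p" by (auto simp: col_idx_def)
      have "(\<Sum>k<p. L $$ (i, k) * z (k, p)) = (\<Sum>k<Suc i. L $$ (i, k) * z (k, p))"
        using i L(2) by (intro sum.mono_neutral_right) auto
      then show ?thesis using True i by (simp add: g_def c_def)
    qed simp
  qed
  have "(\<integral>\<^sup>+x. f x \<partial>col_lborel p) = ennreal (\<Prod>x\<in>?K. \<bar>c x\<bar>) *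
    (\<integral>\<^sup>+z. f (\<lambda>x\<in>?K. if x \<in> ?K then c x * z x + g x z else z x) \<partial>col_lborel p)"
  proof (rule nn_integral_PiM_lborel_triangular[where r = fst, OF finite_col_idx subset_refl _ _ _ f])
    show "c x \<noteq> 0" if "x \<in> ?K" for x by (rule c0[OF that])
    show "g x \<in> borel_measurable (col_lborel p)" if "x \<in> ?K" for x by (rule gm[OF that])
    show "g x w = g x w'" if "x \<in> ?K" "\<And>y. y \<in> ?K \<Longrightarrow> fst y < fst x \<Longrightarrow> w y = w' y" for x w w'
      by (rule dep[OF that])
  qed
  then show ?thesis unfolding map c .
qed

lemma nn_integral_col_gauss:
  "(\<integral>\<^sup>+z. ennreal (exp (- (\<Sum>k<p. (z (k, p))\<^sup>2) / 2)) \<partial>col_lborel p) = ennreal ((2 * pi) powr (real p / 2))"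
proof -
  interpret product_sigma_finite "\<lambda>_ :: nat \<times> nat. lborel :: real measure" by standard
  have "ennreal (exp (- (\<Sum>k<p. (z (k, p))\<^sup>2) / 2)) = (\<Prod>x\<in>col_idx p. ennreal (exp (- (z x)\<^sup>2 / 2)))" for z
  proof -
    have "(\<Prod>x\<in>col_idx p. ennreal (exp (- (z x)\<^sup>2 / 2))) = (\<Prod>k<p. ennreal (exp (- (z (k, p))\<^sup>2 / 2)))"
      unfolding col_idx_def by (subst prod.reindex) (auto simp: inj_on_def)
    also have "\<dots> = ennreal (\<Prod>k<p. exp (- (z (k, p))\<^sup>2 / 2))" by (rule prod_ennreal) simp
    also have "(\<Prod>k<p. exp (- (z (k, p))\<^sup>2 / 2)) = exp (\<Sum>k<p. - (z (k, p))\<^sup>2 / 2)"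
      by (simp add: exp_sum)
    also have "(\<Sum>k<p. - (z (k, p))\<^sup>2 / 2) = - (\<Sum>k<p. (z (k, p))\<^sup>2) / 2"
      by (simp add: sum_negf sum_divide_distrib)
    finally show ?thesis by simp
  qed
  then have "(\<integral>\<^sup>+z. ennreal (exp (- (\<Sum>k<p. (z (k, p))\<^sup>2) / 2)) \<partial>col_lborel p) =
    (\<Prod>x\<in>col_idx p. (\<integral>\<^sup>+z. ennreal (exp (- z\<^sup>2 / 2)) \<partial>lborel))"
    by (simp only:) (rule product_nn_integral_prod, simp_all)
  also have "\<dots> = ennreal (sqrt (2 * pi)) ^ p"
    unfolding nn_integral_exp_square_half prod_constant by (simp add: col_idx_def card_image inj_on_def)
  also have "\<dots> = ennreal (sqrt (2 * pi) ^ p)" by (rule ennreal_power) simp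
  also have "sqrt (2 * pi) ^ p = (2 * pi) powr (real p / 2)"
    by (simp add: powr_half_sqrt[symmetric] powr_powr flip: powr_realpow)
  finally show ?thesis .
qed

text \<open>In these coordinates the determinant is \<open>det V * s\<close>, the trace is that of
  \<open>V\<close> plus \<open>|z|^2 + s\<close>, and semidefiniteness means
  \<open>0 \<le> s\<close>. \<open>A\<close> collects what depends on \<open>V\<close> alone, and
  \<open>b\<close> is chosen so that the exponent \<open>(n - (p + 1) - 1) / 2\<close> is
  \<open>b - 1\<close>.\<close>

lemma wishart_density_bordered_cholesky:
  fixes n p :: nat
  assumes L: "L \<in> carrier_mat p p" "det L > 0"
  defines "V \<equiv> L * L\<^sup>T" and "b \<equiv> (real n - real p) / 2"
  defines "A \<equiv> 1 / (2 powr (real n * real (Suc p) / 2) * mv_Gamma (Suc p) (real n / 2)) *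
    det V powr (b - 1) * exp (- mat_trace V / 2)"
  assumes A: "A \<ge> 0"
  shows "wishart_density (Suc p) n (1\<^sub>m (Suc p)) (bordered p V (col_image p L z)
      ((\<Sum>k<p. (z (k, p))\<^sup>2) + s)) =
    ennreal A * ennreal (exp (- (\<Sum>k<p. (z (k, p))\<^sup>2) / 2)) * (indicator {0..} s * ennreal (s powr (b - 1) * exp (- s / 2)))"
proof -
  define r where "r = mat 1 p (\<lambda>(_, j). z (j, p) :: real)"
  define M where "M = border_mat p L r 1"
  define q where "q = (\<Sum>k<p. (z (k, p))\<^sup>2)"
  define x where "x = col_image p L z"
  have r: "r \<in> carrier_mat 1 p" by (simp add: r_def)
  have M: "M \<in> carrier_mat (Suc p) (Suc p)" using L by (simp add: M_def)
  have detM: "det M = det L" using L r by (simp add: M_def det_border_mat)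
  have W: "bordered p V x (q + s) = M * diag_last p s * M\<^sup>T"
    unfolding x_def q_def M_def r_def V_def by (rule bordered_cholesky[OF L(1)])
  have sym: "bordered p V x (q + s) \<in> sym_mats (Suc p)"
    unfolding W by (rule sym_mats_congr[OF diag_last_sym M])
  have psd: "bordered p V x (q + s) \<in> psd_mats (Suc p) \<longleftrightarrow> 0 \<le> s"
    unfolding W using psd_mats_congr_iff[OF M _ diag_last_carrier] L detM by (simp add: diag_last_psd_iff)
  have Vc: "V \<in> carrier_mat p p" using L by (simp add: V_def)
  have detV: "det V = (det L)\<^sup>2"
    using L det_mult[of L p "L\<^sup>T"] det_transpose[of L p] by (simp add: V_def power2_eq_square)
  have det: "det (bordered p V x (q + s)) = det V * s"
    unfolding W det_congr[OF M diag_last_carrier] detM det_diag_last detV ..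
  have tr: "mat_trace (bordered p V x (q + s)) = mat_trace V + (q + s)"
    by (rule mat_trace_bordered[OF Vc])
  have b: "(real n - real (Suc p) - 1) / 2 = b - 1" by (simp add: b_def field_simps)
  have ex: "exp (- (mat_trace V + (q + s)) / 2) = exp (- mat_trace V / 2) * (exp (- q / 2) * exp (- s / 2))"
    by (simp add: field_simps flip: exp_add)
  show ?thesis
  proof (cases "s \<ge> 0")
    case True
    have pw: "(det V * s) powr (b - 1) = det V powr (b - 1) * s powr (b - 1)"
      using True detV by (simp add: powr_mult)
    have "wishart_density (Suc p) n (1\<^sub>m (Suc p)) (bordered p V x (q + s)) =
      ennreal (A * exp (- q / 2) * (s powr (b - 1) * exp (- s / 2)))"
      unfolding wishart_density_one[OF sym] psd det tr b ex pw using True by (simp add: A_def mult_ac)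
    also have "\<dots> = ennreal A * ennreal (exp (- q / 2)) * ennreal (s powr (b - 1) * exp (- s / 2))"
      using A by (simp add: ennreal_mult)
    finally show ?thesis using True by (simp add: x_def q_def)
  next
    case False
    then show ?thesis unfolding x_def[symmetric] q_def[symmetric] wishart_density_one[OF sym] psd by simp
  qed
qed

lemma mv_Gamma_pos:
  assumes "p \<le> n"
  shows "0 < mv_Gamma p (real n / 2)"
  using assms by (auto simp: mv_Gamma_def intro!: mult_pos_pos prod_pos Gamma_real_pos)

lemma wishart_one_marginal_density:
  assumes n: "Suc p \<le> n" and V: "V \<in> sym_mats p"
  shows "(\<integral>\<^sup>+x. (\<integral>\<^sup>+y. wishart_density (Suc p) n (1\<^sub>m (Suc p)) (bordered p V x y) \<partial>lborel) \<partial>col_lborel p) =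
    wishart_density p n (1\<^sub>m p) V"
proof (cases "V \<in> pd_mats p")
  case False
  \<comment> \<open>A leading block of a positive definite matrix is positive definite; here that
    fails for \<open>V\<close>, so both densities vanish.\<close>
  have "bordered p V x y \<notin> pd_mats (Suc p)" for x y
    using False pd_mats_congr[OF _ drop_mat_carrier drop_mat_transpose_inj, of "bordered p V x y"]
      drop_last_bordered[OF sym_mats_carrier[OF V], of x y] by metis
  then show ?thesis
    using wishart_density_not_pd[OF bordered_sym[OF V]] wishart_density_not_pd[OF V False] by simp
next
  case True
  let ?D = "wishart_density (Suc p) n (1\<^sub>m (Suc p))"
  obtain L where L: "L \<in> carrier_mat p p" "\<And>i j. i < j \<Longrightarrow> j < p \<Longrightarrow> L $$ (i, j) = 0"
    "\<And>i. i < p \<Longrightarrow> 0 < L $$ (i, i)" "L * L\<^sup>T = V" and detL: "0 < det L" and detV: "det V = (det L)\<^sup>2"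
    using cholesky[OF True] by metis
  define b where "b = (real n - real p) / 2"
  have b: "b > 0" using n by (simp add: b_def)
  define A where "A = 1 / (2 powr (real n * real (Suc p) / 2) * mv_Gamma (Suc p) (real n / 2)) *
    det V powr (b - 1) * exp (- mat_trace V / 2)"
  have A: "A \<ge> 0" using mv_Gamma_pos[OF n] by (simp add: A_def)
  let ?\<phi> = "col_image p L"
  let ?q = "\<lambda>z. \<Sum>k<p. (z (k, p))\<^sup>2 :: real"
  let ?\<Gamma> = "2 powr b * Gamma b" and ?c = "2 powr (real n * real (Suc p) / 2) * mv_Gamma (Suc p) (real n / 2)"
  have D: "?D \<in> borel_measurable (sym_lborel (Suc p))" by (rule measurable_wishart_density[OF one_mat_pd])
  have DB: "(\<lambda>(x, y). ?D (bordered p V x y)) \<in> borel_measurable (col_lborel p \<Otimes>\<^sub>M lborel)"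
    using measurable_compose[OF measurable_bordered[OF V] D] by (simp add: case_prod_unfold)
  have inner_meas: "(\<lambda>x. \<integral>\<^sup>+y. ?D (bordered p V x y) \<partial>lborel) \<in> borel_measurable (col_lborel p)"
    by (rule lborel.borel_measurable_nn_integral[OF DB])
  \<comment> \<open>At the fixed column \<open>L z\<close>, shifting the corner by
    \<open>|z|^2\<close> leaves only the Gamma integral in \<open>s\<close>.\<close>
  have inner: "(\<integral>\<^sup>+y. ?D (bordered p V (?\<phi> z) y) \<partial>lborel) =
    ennreal A * ennreal ?\<Gamma> * ennreal (exp (- ?q z / 2))" for z
  proof -
    have \<phi>: "?\<phi> z \<in> space (col_lborel p)" by (simp add: space_PiM)
    have ym: "(\<lambda>y. ?D (bordered p V (?\<phi> z) y)) \<in> borel_measurable borel"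
      using measurable_compose[OF measurable_Pair1'[OF \<phi>] DB] by simp
    have "(\<integral>\<^sup>+y. ?D (bordered p V (?\<phi> z) y) \<partial>lborel) = (\<integral>\<^sup>+s. ?D (bordered p V (?\<phi> z) (?q z + s)) \<partial>lborel)"
      using nn_integral_real_affine[OF ym, of 1 "?q z"] by simp
    also have "\<dots> = (\<integral>\<^sup>+s. ennreal A * ennreal (exp (- ?q z / 2)) *
      (indicator {0..} s * ennreal (s powr (b - 1) * exp (- s / 2))) \<partial>lborel)"
      using wishart_density_bordered_cholesky[OF L(1) detL, where n = n and z = z] A
      unfolding L(4) b_def[symmetric] A_def[symmetric] by simp
    also have "\<dots> = ennreal A * ennreal (exp (- ?q z / 2)) * ennreal ?\<Gamma>"
      by (subst nn_integral_cmult) (simp_all only: nn_integral_powr_exp_half[OF b], measurable)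
    finally show ?thesis by (simp only: mult_ac)
  qed
  have "(\<integral>\<^sup>+x. (\<integral>\<^sup>+y. ?D (bordered p V x y) \<partial>lborel) \<partial>col_lborel p) =
    ennreal (det L) * (\<integral>\<^sup>+z. ennreal A * ennreal ?\<Gamma> * ennreal (exp (- ?q z / 2)) \<partial>col_lborel p)"
    using nn_integral_col_cholesky[OF L(1,2,3) inner_meas] unfolding inner .
  also have "(\<integral>\<^sup>+z. ennreal A * ennreal ?\<Gamma> * ennreal (exp (- ?q z / 2)) \<partial>col_lborel p) =
    ennreal A * ennreal ?\<Gamma> * ennreal ((2 * pi) powr (real p / 2))"
  proof (subst nn_integral_cmult)
    have "?q \<in> borel_measurable (col_lborel p)"
      by (intro borel_measurable_sum borel_measurable_power measurable_PiM_component)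
        (simp add: col_idx_def)
    then show "(\<lambda>z. ennreal (exp (- ?q z / 2))) \<in> borel_measurable (col_lborel p)"
      by (rule measurable_compose[of _ _ borel]) simp
  qed (simp only: nn_integral_col_gauss)
  also have "ennreal (det L) * (ennreal A * ennreal ?\<Gamma> * ennreal ((2 * pi) powr (real p / 2))) =
    ennreal (det L * (A * ?\<Gamma> * (2 * pi) powr (real p / 2)))"
    using detL A b by (simp add: ennreal_mult Gamma_real_nonneg)
  \<comment> \<open>\<open>det L\<close> is the square root of \<open>det V\<close>, which lifts the
    exponent \<open>b - 1 = (n - p - 2) / 2\<close> to \<open>(n - p - 1) / 2\<close>. Since
    \<open>b + p / 2 = n / 2\<close>, the powers of 2 leave \<open>2 powr (n p / 2)\<close>, and
    \<open>mv_Gamma_Suc\<close> cancels the power of \<open>pi\<close> and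
    \<open>Gamma b\<close>.\<close>
  also have "det L * (A * ?\<Gamma> * (2 * pi) powr (real p / 2)) =
    1 / (2 powr (real n * real p / 2) * mv_Gamma p (real n / 2)) *
      det V powr ((real n - real p - 1) / 2) * exp (- mat_trace V / 2)"
  proof -
    have dV: "det V > 0" using detL detV by simp
    have "det L = det V powr (1 / 2)"
      using detL detV by (simp add: powr_half_sqrt)
    then have d: "det L * det V powr (b - 1) = det V powr ((real n - real p - 1) / 2)"
      using dV by (simp add: b_def field_simps flip: powr_add)
    have two: "2 powr (real n * real (Suc p) / 2) = 2 powr b * 2 powr (real p / 2) * 2 powr (real n * real p / 2)"
      by (simp add: b_def field_simps flip: powr_add)
    have G: "mv_Gamma (Suc p) (real n / 2) = pi powr (real p / 2) * mv_Gamma p (real n / 2) * Gamma b"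
      by (simp add: mv_Gamma_Suc b_def diff_divide_distrib)
    have pos: "mv_Gamma p (real n / 2) > 0" "Gamma b > 0" using n b by (auto intro: mv_Gamma_pos)
    have "det L * (A * ?\<Gamma> * (2 * pi) powr (real p / 2)) =
      (det L * det V powr (b - 1)) * exp (- mat_trace V / 2) *
      (?\<Gamma> * (2 powr (real p / 2) * pi powr (real p / 2)) /
      ?c)"
      by (simp add: A_def powr_mult)
    also have "?\<Gamma> * (2 powr (real p / 2) * pi powr (real p / 2)) /
      ?c =
      1 / (2 powr (real n * real p / 2) * mv_Gamma p (real n / 2))"
      unfolding two G using pos by simp
    finally show ?thesis unfolding d by simp
  qed
  finally show ?thesis
    using True pd_mats_subset_psd_mats by (auto simp: wishart_density_one[OF V])
qed

text \<open>The test function sees only the leading block, so it leaves both inner integrals, and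
  these then give the marginal density.\<close>

lemma distr_wishart_one_drop_last:
  assumes n: "Suc p \<le> n"
  shows "distr (wishart (Suc p) n (1\<^sub>m (Suc p))) (sym_lborel p) (congr (drop_mat p)) =
    wishart p n (1\<^sub>m p)"
proof (rule distr_wishart_eqI[OF one_mat_pd one_mat_pd measurable_congr_mat[OF drop_mat_carrier]])
  fix G :: "real mat \<Rightarrow> ennreal" assume G: "G \<in> borel_measurable (sym_lborel p)"
  let ?D = "wishart_density (Suc p) n (1\<^sub>m (Suc p))"
  let ?T = "\<lambda>W. congr (drop_mat p) W"
  have D: "?D \<in> borel_measurable (sym_lborel (Suc p))" by (rule measurable_wishart_density[OF one_mat_pd])
  have F: "(\<lambda>W. ?D W * G (?T W)) \<in> borel_measurable (sym_lborel (Suc p))"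
    by (rule borel_measurable_times_ennreal[OF D measurable_compose[OF measurable_congr_mat[OF drop_mat_carrier] G]])
  have inner: "(\<integral>\<^sup>+x. (\<integral>\<^sup>+y. ?D (bordered p V x y) * G (?T (bordered p V x y)) \<partial>lborel) \<partial>col_lborel p) =
    wishart_density p n (1\<^sub>m p) V * G V" if V: "V \<in> sym_mats p" for V
  proof -
    have DB: "(\<lambda>(x, y). ?D (bordered p V x y)) \<in> borel_measurable (col_lborel p \<Otimes>\<^sub>M lborel)"
      using measurable_compose[OF measurable_bordered[OF V] D] by (simp add: case_prod_unfold)
    have "(\<integral>\<^sup>+x. (\<integral>\<^sup>+y. ?D (bordered p V x y) * G V \<partial>lborel) \<partial>col_lborel p) =
      (\<integral>\<^sup>+x. (\<integral>\<^sup>+y. ?D (bordered p V x y) \<partial>lborel) * G V \<partial>col_lborel p)"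
    proof (rule nn_integral_cong, rule nn_integral_multc)
      fix x assume x: "x \<in> space (col_lborel p)"
      show "(\<lambda>y. ?D (bordered p V x y)) \<in> borel_measurable lborel"
        using measurable_compose[OF measurable_Pair1'[OF x] DB] by simp
    qed
    also have "\<dots> = (\<integral>\<^sup>+x. (\<integral>\<^sup>+y. ?D (bordered p V x y) \<partial>lborel) \<partial>col_lborel p) * G V"
      by (rule nn_integral_multc[OF lborel.borel_measurable_nn_integral[OF DB]])
    finally show ?thesis
      unfolding drop_last_bordered[OF sym_mats_carrier[OF V]] wishart_one_marginal_density[OF n V] .
  qed
  have DG: "(\<lambda>V. wishart_density p n (1\<^sub>m p) V * G V) \<in> borel_measurable (sym_lborel p)"
    by (rule borel_measurable_times_ennreal[OF measurable_wishart_density[OF one_mat_pd] G])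
  show "(\<integral>\<^sup>+W. ?D W * G (?T W) \<partial>sym_lborel (Suc p)) = (\<integral>\<^sup>+V. wishart_density p n (1\<^sub>m p) V * G V \<partial>sym_lborel p)"
    unfolding nn_integral_sym_lborel_Suc[OF F] nn_integral_sym_lborel[OF DG] inner[OF sym_of_upper_sym] ..
qed

section \<open>Linear transformations of Wishart distributions\<close>

text \<open>A measure has the same total mass as its image, so mass 1 passes from dimension
  \<open>p\<close> back up to \<open>p + 1\<close> along row deletion, with \<open>n\<close> fixed.
  In dimension 0 the density is 1 at the only matrix.\<close>

lemma prob_space_wishart_one: "p \<le> n \<Longrightarrow> prob_space (wishart p n (1\<^sub>m p))"
proof (induction p)
  case 0
  interpret product_sigma_finite "\<lambda>_ :: nat \<times> nat. lborel :: real measure" by standard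
  have idx: "upper_idx 0 = {}" by (auto simp: upper_idx_def)
  let ?D = "wishart_density 0 n (1\<^sub>m 0)"
  have W: "sym_of_upper 0 w = 1\<^sub>m 0" for w by (rule eq_matI) auto
  have "1\<^sub>m 0 \<in> psd_mats 0" using one_mat_pd pd_mats_subset_psd_mats by blast
  then have D: "?D (1\<^sub>m 0) = 1"
    using wishart_density_one[OF pd_mats_sym[OF one_mat_pd], of 0 n]
    by (simp add: mv_Gamma_def mat_trace_def)
  have "emeasure (wishart 0 n (1\<^sub>m 0)) (sym_mats 0) = (\<integral>\<^sup>+W. ?D W * indicator (sym_mats 0) W \<partial>sym_lborel 0)"
    unfolding wishart_def using sets.top[of "sym_lborel 0"]
    by (intro emeasure_density measurable_wishart_density one_mat_pd) simp
  also have "\<dots> = (\<integral>\<^sup>+W. ?D W \<partial>sym_lborel 0)"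
    by (rule nn_integral_cong) simp
  also have "\<dots> = (\<integral>\<^sup>+w. ?D (sym_of_upper 0 w) \<partial>PiM_lborel {})"
    unfolding nn_integral_sym_lborel[OF measurable_wishart_density[OF one_mat_pd]] idx ..
  also have "\<dots> = 1" unfolding W D PiM_empty by simp
  finally show ?case by (intro prob_spaceI) simp
next
  case (Suc p)
  have "(congr (drop_mat p)) \<in> measurable (wishart (Suc p) n (1\<^sub>m (Suc p))) (sym_lborel p)"
    using measurable_congr_mat[OF drop_mat_carrier] by (simp add: measurable_cong_sets[OF sets_wishart refl])
  moreover have "prob_space (wishart p n (1\<^sub>m p))" using Suc by simp
  ultimately show ?case
    using distr_wishart_one_drop_last[OF Suc.prems] by (metis prob_space_distrD)
qed

lemma measurable_wishart_congr_mat: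
  "A \<in> carrier_mat q p \<Longrightarrow> (congr A) \<in> measurable (wishart p n \<Sigma>) (sym_lborel q)"
  using measurable_congr_mat[of A q p] by (simp add: measurable_cong_sets[OF sets_wishart refl])

lemma distr_wishart_congr_mult:
  assumes A: "A \<in> carrier_mat q p" and B: "B \<in> carrier_mat r q"
  shows "distr (wishart p n \<Sigma>) (sym_lborel r) (\<lambda>W. B * A * W * (B * A)\<^sup>T) =
    distr (distr (wishart p n \<Sigma>) (sym_lborel q) (congr A)) (sym_lborel r) (congr B)" (is "_ = ?R")
proof -
  have "?R =
    distr (wishart p n \<Sigma>) (sym_lborel r) ((congr B) \<circ> (congr A))"
    by (rule distr_distr[OF measurable_congr_mat[OF B] measurable_wishart_congr_mat[OF A]])
  also have "\<dots> = distr (wishart p n \<Sigma>) (sym_lborel r) (\<lambda>W. B * A * W * (B * A)\<^sup>T)"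
    by (rule distr_cong) (simp_all only: space_wishart o_def congr_congr[OF A B sym_mats_carrier])
  finally show ?thesis by simp
qed

lemma distr_wishart_cholesky:
  assumes "L \<in> carrier_mat p p" "det L \<noteq> 0"
  shows "distr (wishart p n (1\<^sub>m p)) (sym_lborel p) (congr L) = wishart p n (L * L\<^sup>T)"
  using distr_wishart_congr_square[OF one_mat_pd assms] assms by simp

lemma prob_space_wishart:
  assumes "\<Sigma> \<in> pd_mats p" "p \<le> n"
  shows "prob_space (wishart p n \<Sigma>)"
proof -
  obtain L where L: "L \<in> carrier_mat p p" "det L \<noteq> 0" "L * L\<^sup>T = \<Sigma>"
    using cholesky[OF assms(1)] by (metis less_irrefl)
  show ?thesis
    unfolding L(3)[symmetric] distr_wishart_cholesky[OF L(1,2), symmetric]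
    by (rule prob_space.prob_space_distr[OF prob_space_wishart_one[OF assms(2)] measurable_wishart_congr_mat[OF L(1)]])
qed

text \<open>Row deletion commutes with a lower triangular factor,
  \<open>drop_mat p * L = L' * drop_mat p\<close> with \<open>L'\<close> the leading block, because
  the last column of \<open>L\<close> vanishes above the diagonal. A non-triangular square root of
  \<Sigma> would not commute in this way.\<close>

lemma distr_wishart_drop_last:
  assumes \<Sigma>: "\<Sigma> \<in> pd_mats (Suc p)" and n: "Suc p \<le> n"
  shows "distr (wishart (Suc p) n \<Sigma>) (sym_lborel p) (congr (drop_mat p)) =
    wishart p n (congr (drop_mat p) \<Sigma>)"
proof -
  let ?I = "wishart (Suc p) n (1\<^sub>m (Suc p))"
  obtain L where L: "L \<in> carrier_mat (Suc p) (Suc p)" "\<And>i j. i < j \<Longrightarrow> j < Suc p \<Longrightarrow> L $$ (i, j) = 0"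
    "det L \<noteq> 0" "L * L\<^sup>T = \<Sigma>" using cholesky[OF \<Sigma>] by (metis less_irrefl)
  let ?d = "drop_mat p"
  define L' where "L' = mat p p (\<lambda>(i, j). L $$ (i, j))"
  have L': "L' \<in> carrier_mat p p" by (simp add: L'_def)
  have d: "?d \<in> carrier_mat p (Suc p)" by simp
  have comm: "?d * L = L' * ?d"
  proof (rule eq_matI)
    fix i j assume "i < dim_row (L' * ?d)" "j < dim_col (L' * ?d)"
    then have ij: "i < p" "j < Suc p" using L' carrier_matD[OF d] by auto
    have "(L' * ?d) $$ (i, j) = (\<Sum>k<p. L $$ (i, k) * (if k = j then 1 else 0))"
      using ij by (auto simp: L'_def drop_mat_def scalar_prod_def atLeast0LessThan intro!: sum.cong)
    also have "\<dots> = (\<Sum>k<p. if k = j then L $$ (i, k) else 0)"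
      by (intro sum.cong) auto
    also have "\<dots> = L $$ (i, j)" using ij L(2)[of i j] by (auto simp: less_Suc_eq)
    finally show "(?d * L) $$ (i, j) = (L' * ?d) $$ (i, j)"
      using drop_mat_mult[OF L(1) ij] by simp
  qed (use L L' carrier_matD[OF d] in auto)
  have dd: "congr ?d (1\<^sub>m (Suc p)) = 1\<^sub>m p"
    unfolding drop_last_congr[OF one_carrier_mat] by (rule eq_matI) auto
  have d\<Sigma>: "congr ?d \<Sigma> = L' * L'\<^sup>T"
  proof -
    have "congr ?d \<Sigma> = congr ?d (congr L (1\<^sub>m (Suc p)))" using L by simp
    also have "\<dots> = ?d * L * 1\<^sub>m (Suc p) * (?d * L)\<^sup>T"
      by (rule congr_congr[symmetric, OF L(1) d one_carrier_mat])
    also have "\<dots> = congr L' (congr ?d (1\<^sub>m (Suc p)))"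
      unfolding comm by (rule congr_congr[OF d L' one_carrier_mat])
    also have "\<dots> = L' * L'\<^sup>T" unfolding dd using L' by simp
    finally show ?thesis .
  qed
  have "L' * L'\<^sup>T \<in> pd_mats p"
    using pd_mats_congr[OF \<Sigma> d drop_mat_transpose_inj] unfolding d\<Sigma> by blast
  then have "0 < det (L' * L'\<^sup>T)" by (rule det_pd_mats_pos)
  then have detL': "det L' \<noteq> 0" using det_mult[of L' p "L'\<^sup>T"] L' by auto
  have "distr (wishart (Suc p) n \<Sigma>) (sym_lborel p) (congr ?d) =
    distr (distr ?I (sym_lborel (Suc p)) (congr L)) (sym_lborel p) (congr ?d)"
    unfolding distr_wishart_cholesky[OF L(1,3)] L(4) ..
  also have "\<dots> = distr (distr ?I (sym_lborel p) (congr ?d)) (sym_lborel p) (congr L')"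
    unfolding distr_wishart_congr_mult[symmetric, OF L(1) d] distr_wishart_congr_mult[symmetric, OF d L'] comm ..
  also have "\<dots> = wishart p n (L' * L'\<^sup>T)"
    unfolding distr_wishart_one_drop_last[OF n] by (rule distr_wishart_cholesky[OF L' detL'])
  finally show ?thesis unfolding d\<Sigma> .
qed

section \<open>Matrices of full row rank\<close>

lemma wide_mat_kernel:
  assumes M: "(M :: real mat) \<in> carrier_mat m n" and mn: "m < n"
  obtains v where "v \<in> carrier_vec n" "v \<noteq> 0\<^sub>v n" "M *\<^sub>v v = 0\<^sub>v m"
proof -
  \<comment> \<open>Padding with zero rows makes the matrix square with a zero last row; so
    \<open>N\<^sup>T\<close> kills the last unit vector and the determinant vanishes.\<close>
  define N where "N = mat n n (\<lambda>(i, j). if i < m then M $$ (i, j) else 0)"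
  have N: "N \<in> carrier_mat n n" by (simp add: N_def)
  define e where "e = (unit_vec n (n - 1) :: real vec)"
  have "N\<^sup>T *\<^sub>v e = 0\<^sub>v n"
    using mn by (intro eq_vecI) (auto simp: N_def e_def)
  moreover have "e \<in> carrier_vec n" "e \<noteq> 0\<^sub>v n" using mn by (auto simp: e_def)
  ultimately have "det (N\<^sup>T) = 0" using det_0_iff_vec_prod_zero[of "N\<^sup>T" n] N by auto
  then have "det N = 0" using det_transpose[OF N] by simp
  then obtain v where v: "v \<in> carrier_vec n" "v \<noteq> 0\<^sub>v n" "N *\<^sub>v v = 0\<^sub>v n"
    using det_0_iff_vec_prod_zero[OF N] by auto
  have "M *\<^sub>v v = 0\<^sub>v m"
  proof (rule eq_vecI)
    fix i assume "i < dim_vec (0\<^sub>v m)"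
    then have i: "i < m" by simp
    have "row N i = row M i" using i mn M by (intro eq_vecI) (auto simp: N_def)
    then have "(M *\<^sub>v v) $ i = (N *\<^sub>v v) $ i" using i mn M N by simp
    then show "(M *\<^sub>v v) $ i = 0\<^sub>v m $ i" using v i mn by simp
  qed (use M in simp)
  with v that show ?thesis by blast
qed

lemma mult_transpose_vec_index:
  fixes A :: "real mat"
  assumes "A \<in> carrier_mat q p" "v \<in> carrier_vec q" "j < p"
  shows "(A\<^sup>T *\<^sub>v v) $ j = (\<Sum>i<q. A $$ (i, j) * v $ i)"
  using assms by (auto simp: scalar_prod_def atLeast0LessThan)

text \<open>The new row \<open>w\<close> is taken from the kernel of \<open>A\<close>. It is then
  orthogonal to the existing rows, which keeps the extended rows independent.\<close>

lemma ex_full_rank_extension: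
  fixes A :: "real mat"
  assumes A: "A \<in> carrier_mat q p" and qp: "q < p"
    and inj: "\<And>v. v \<in> carrier_vec q \<Longrightarrow> A\<^sup>T *\<^sub>v v = 0\<^sub>v p \<Longrightarrow> v = 0\<^sub>v q"
  obtains A' where "A' \<in> carrier_mat (Suc q) p" "drop_mat q * A' = A"
    "\<And>v. v \<in> carrier_vec (Suc q) \<Longrightarrow> A'\<^sup>T *\<^sub>v v = 0\<^sub>v p \<Longrightarrow> v = 0\<^sub>v (Suc q)"
proof -
  obtain w where w: "w \<in> carrier_vec p" "w \<noteq> 0\<^sub>v p" "A *\<^sub>v w = 0\<^sub>v q"
    using wide_mat_kernel[OF A qp] by metis
  define A' where "A' = mat (Suc q) p (\<lambda>(i, j). if i < q then A $$ (i, j) else w $ j)"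
  have A': "A' \<in> carrier_mat (Suc q) p" by (simp add: A'_def)
  have "drop_mat q * A' = A"
  proof (rule eq_matI)
    fix i j assume "i < dim_row A" "j < dim_col A"
    then have "i < q" "j < p" using A by auto
    then show "(drop_mat q * A') $$ (i, j) = A $$ (i, j)"
      using drop_mat_mult[OF A', of i j] by (simp add: A'_def)
  qed (use A A' carrier_matD[OF drop_mat_carrier] in auto)
  moreover have "v = 0\<^sub>v (Suc q)" if v: "v \<in> carrier_vec (Suc q)" and 0: "A'\<^sup>T *\<^sub>v v = 0\<^sub>v p" for v
  proof -
    let ?w = "\<Sum>j<p. w $ j * w $ j" and ?S = "\<lambda>j. \<Sum>i<q. A $$ (i, j) * v $ i"
      and ?R = "\<lambda>i. \<Sum>j<p. A $$ (i, j) * w $ j"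
    have eq: "?S j + w $ j * v $ q = 0" if j: "j < p" for j
    proof -
      have "(A'\<^sup>T *\<^sub>v v) $ j = 0" unfolding 0 using j by simp
      then show ?thesis unfolding mult_transpose_vec_index[OF A' v j] using j by (simp add: A'_def)
    qed
    have Aw: "?R i = 0" if i: "i < q" for i
    proof -
      have "(A *\<^sub>v w) $ i = ?R i"
        using i A w(1) by (auto simp: scalar_prod_def atLeast0LessThan)
      then show ?thesis using w(3) i by simp
    qed
    \<comment> \<open>Pairing the relation with \<open>w\<close> kills the rows of \<open>A\<close>
      and leaves \<open>|w|^2\<close> times the last coefficient, which must therefore
      vanish.\<close>
    have "0 = (\<Sum>j<p. w $ j * (?S j + w $ j * v $ q))"
      using eq by simp
    also have "\<dots> = (\<Sum>j<p. \<Sum>i<q. w $ j * (A $$ (i, j) * v $ i)) + ?w * v $ q"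
      by (simp add: distrib_left sum.distrib sum_distrib_left sum_distrib_right mult.assoc)
    also have "(\<Sum>j<p. \<Sum>i<q. w $ j * (A $$ (i, j) * v $ i)) = (\<Sum>i<q. v $ i * ?R i)"
      by (subst sum.swap) (simp add: sum_distrib_left mult_ac)
    also have "\<dots> = 0" using Aw by simp
    finally have "?w * v $ q = 0" by simp
    moreover have "?w \<noteq> 0"
    proof
      assume "?w = 0"
      then have "w = 0\<^sub>v p" using w(1) by (intro eq_vecI) (auto simp: sum_nonneg_eq_0_iff)
      then show False using w(2) by simp
    qed
    ultimately have vq: "v $ q = 0" by simp
    define u where "u = vec q (\<lambda>i. v $ i)"
    have u: "u \<in> carrier_vec q" by (simp add: u_def)
    have "A\<^sup>T *\<^sub>v u = 0\<^sub>v p"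
    proof (rule eq_vecI)
      fix j assume "j < dim_vec (0\<^sub>v p)"
      then have j: "j < p" by simp
      show "(A\<^sup>T *\<^sub>v u) $ j = 0\<^sub>v p $ j"
        using mult_transpose_vec_index[OF A u j] eq[OF j] vq j by (simp add: u_def)
    qed (use A in simp)
    then have "u = 0\<^sub>v q" by (rule inj[OF u])
    then have "v $ i = 0" if "i < q" for i using that by (metis index_vec index_zero_vec(1) u_def)
    then show ?thesis using v vq by (intro eq_vecI) (auto simp: less_Suc_eq)
  qed
  ultimately show ?thesis using that A' by blast
qed

text \<open>Rows are added to \<open>A\<close> one at a time until it is square, by induction on the
  number \<open>p - q\<close> of missing rows; \<open>drop_mat\<close> takes each added row away
  again.\<close>

lemma distr_wishart_congr:
  assumes \<Sigma>: "\<Sigma> \<in> pd_mats p" and n: "p \<le> n" and A: "A \<in> carrier_mat q p"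
    and pd: "congr A \<Sigma> \<in> pd_mats q"
  shows "distr (wishart p n \<Sigma>) (sym_lborel q) (congr A) = wishart q n (congr A \<Sigma>)"
proof -
  note \<Sigma>c = pd_mats_carrier[OF \<Sigma>]
  have main: "distr (wishart p n \<Sigma>) (sym_lborel q) (congr A) = wishart q n (congr A \<Sigma>)"
    if "q \<le> p" "A \<in> carrier_mat q p" "\<And>v. v \<in> carrier_vec q \<Longrightarrow> A\<^sup>T *\<^sub>v v = 0\<^sub>v p \<Longrightarrow> v = 0\<^sub>v q" for q A
    using that
  proof (induction "p - q" arbitrary: q A)
    case 0
    then have A: "A \<in> carrier_mat p p" and q: "q = p" by auto
    have "det A \<noteq> 0"
      using det_0_iff_vec_prod_zero[of "A\<^sup>T" p] A 0(4) det_transpose[OF A] unfolding q by auto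
    then show ?case unfolding q by (rule distr_wishart_congr_square[OF \<Sigma> A])
  next
    case (Suc m)
    have qp: "q < p" using Suc.hyps(2) by simp
    obtain A' where A': "A' \<in> carrier_mat (Suc q) p" "drop_mat q * A' = A"
      "\<And>v. v \<in> carrier_vec (Suc q) \<Longrightarrow> A'\<^sup>T *\<^sub>v v = 0\<^sub>v p \<Longrightarrow> v = 0\<^sub>v (Suc q)"
      using ex_full_rank_extension[OF Suc.prems(2) qp Suc.prems(3)] by metis
    have IH: "distr (wishart p n \<Sigma>) (sym_lborel (Suc q)) (congr A') = wishart (Suc q) n (congr A' \<Sigma>)"
      using Suc.hyps qp A' by (intro Suc.hyps(1)) auto
    have pd: "congr A' \<Sigma> \<in> pd_mats (Suc q)" by (rule pd_mats_congr[OF \<Sigma> A'(1,3)])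
    have qn: "Suc q \<le> n" using qp n by simp
    have "distr (wishart p n \<Sigma>) (sym_lborel q) (congr A) =
      distr (wishart (Suc q) n (congr A' \<Sigma>)) (sym_lborel q) (congr (drop_mat q))"
      unfolding IH[symmetric] distr_wishart_congr_mult[OF A'(1) drop_mat_carrier, symmetric] A'(2) ..
    also have "\<dots> = wishart q n (congr (drop_mat q) (congr A' \<Sigma>))"
      by (rule distr_wishart_drop_last[OF pd qn])
    also have "congr (drop_mat q) (congr A' \<Sigma>) = congr A \<Sigma>"
      unfolding congr_congr[OF A'(1) drop_mat_carrier \<Sigma>c, symmetric] A'(2) ..
    finally show ?case .
  qed
  have inj: "v = 0\<^sub>v q" if "v \<in> carrier_vec q" "A\<^sup>T *\<^sub>v v = 0\<^sub>v p" for v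
    by (rule pd_mats_congr_inj[OF pd A \<Sigma>c that])
  \<comment> \<open>Otherwise \<open>A\<^sup>T\<close> has more columns than rows and hence a
    kernel, against the injectivity forced by \<open>pd\<close>.\<close>
  have "q \<le> p"
  proof (rule ccontr)
    assume "\<not> q \<le> p"
    then obtain v where "v \<in> carrier_vec q" "v \<noteq> 0\<^sub>v q" "A\<^sup>T *\<^sub>v v = 0\<^sub>v p"
      using wide_mat_kernel[of "A\<^sup>T" p q] A by auto
    then show False using inj by blast
  qed
  then show ?thesis using main A inj by blast
qed

section \<open>Identifiability of the parameters\<close>

text \<open>The expectation of \<open>det W\<close>, written as the quotient of the normalizing
  constants for \<open>n + 2\<close> and \<open>n\<close> degrees of freedom.\<close>

definition det_moment :: "nat \<Rightarrow> nat \<Rightarrow> real mat \<Rightarrow> real" where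
  "det_moment p n \<Sigma> = 2 ^ p * det \<Sigma> * mv_Gamma p (real (n + 2) / 2) / mv_Gamma p (real n / 2)"

lemma det_moment_nonneg:
  assumes "\<Sigma> \<in> pd_mats p" "p \<le> n"
  shows "0 \<le> det_moment p n \<Sigma>"
  using det_pd_mats_pos[OF assms(1)] mv_Gamma_pos[OF assms(2)] mv_Gamma_pos[of p "n + 2"] assms(2)
  by (auto simp: det_moment_def intro!: divide_nonneg_pos mult_nonneg_nonneg less_imp_le)

lemma det_times_wishart_density:
  assumes \<Sigma>: "\<Sigma> \<in> pd_mats p" and n: "p \<le> n"
  shows "wishart_density p n \<Sigma> W * ennreal (det W) =
    ennreal (det_moment p n \<Sigma>) * wishart_density p (n + 2) \<Sigma> W"
proof (cases "W \<in> psd_mats p")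
  case True
  define s where "s = det \<Sigma>"
  have s: "s > 0" using det_pd_mats_pos[OF \<Sigma>] by (simp add: s_def)
  define w where "w = det W"
  have w: "w \<ge> 0" using det_psd_mats_nonneg[OF True] by (simp add: w_def)
  define G where "G = mv_Gamma p (real n / 2)"
  define G2 where "G2 = mv_Gamma p (real (n + 2) / 2)"
  have G: "G > 0" "G2 > 0" using mv_Gamma_pos[OF n] mv_Gamma_pos[of p "n + 2"] n by (auto simp: G_def G2_def)
  define e where "e = exp (- (1 / 2) * mat_trace (the (mat_inverse \<Sigma>) * W))"
  define a where "a = (real n - real p - 1) / 2"
  have a2: "(real (n + 2) - real p - 1) / 2 = a + 1" by (simp add: a_def field_simps)
  \<comment> \<open>This holds at \<open>w = 0\<close> as well, where both sides are 0 by the value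
    of \<open>0 powr\<close>.\<close>
  have pw: "w powr (a + 1) = w powr a * w" using w by (cases "w = 0") (auto simp: powr_add)
  have s2: "s powr (real (n + 2) / 2) = s powr (real n / 2) * s"
    using s by (simp add: add_divide_distrib powr_add)
  have "real (n + 2) * real p / 2 = real n * real p / 2 + real p" by (simp add: field_simps)
  then have t2: "2 powr (real (n + 2) * real p / 2) = 2 powr (real n * real p / 2) * 2 ^ p"
    by (simp only: powr_add) (simp add: powr_realpow)
  have K: "det_moment p n \<Sigma> = 2 ^ p * s * G2 / G" by (simp add: det_moment_def s_def G_def G2_def)
  let ?A = "1 / (2 powr (real n * real p / 2) * s powr (real n / 2) * G) * w powr a * e"
    and ?B = "1 / (2 powr (real (n + 2) * real p / 2) * s powr (real (n + 2) / 2) * G2) * w powr (a + 1) * e"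
  have "wishart_density p n \<Sigma> W = ennreal ?A"
    using True unfolding wishart_density_def s_def w_def e_def G_def a_def by simp
  then have "wishart_density p n \<Sigma> W * ennreal w =
    ennreal (?A * w)"
    by (simp only: ennreal_mult''[OF w])
  also have "?A * w =
    det_moment p n \<Sigma> * ?B"
    unfolding K t2 s2 pw using s G by (simp add: field_simps)
  also have "ennreal \<dots> = ennreal (det_moment p n \<Sigma>) *
    ennreal ?B"
    by (rule ennreal_mult'[OF det_moment_nonneg[OF \<Sigma> n]])
  also have "ennreal ?B =
    wishart_density p (n + 2) \<Sigma> W"
    using True unfolding wishart_density_def a2 s_def w_def e_def G2_def by simp
  finally show ?thesis unfolding w_def .
qed (simp add: wishart_density_def)

lemma nn_integral_wishart_det:
  assumes \<Sigma>: "\<Sigma> \<in> pd_mats p" and n: "p \<le> n" and F: "F \<in> borel_measurable (sym_lborel p)"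
  shows "(\<integral>\<^sup>+W. ennreal (det W) * F W \<partial>wishart p n \<Sigma>) =
    ennreal (det_moment p n \<Sigma>) * (\<integral>\<^sup>+W. F W \<partial>wishart p (n + 2) \<Sigma>)"
proof -
  note D = measurable_wishart_density[OF \<Sigma>]
  have det: "(\<lambda>W. ennreal (det W)) \<in> borel_measurable (sym_lborel p)"
    using borel_measurable_det by (rule measurable_compose[OF _ measurable_ennreal])
  have "(\<integral>\<^sup>+W. ennreal (det W) * F W \<partial>wishart p n \<Sigma>) =
    (\<integral>\<^sup>+W. wishart_density p n \<Sigma> W * (ennreal (det W) * F W) \<partial>sym_lborel p)"
    unfolding wishart_def by (rule nn_integral_density[OF D borel_measurable_times_ennreal[OF det F]])
  also have "\<dots> = (\<integral>\<^sup>+W. ennreal (det_moment p n \<Sigma>) * (wishart_density p (n + 2) \<Sigma> W * F W) \<partial>sym_lborel p)"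
    by (simp only: mult.assoc[symmetric] det_times_wishart_density[OF \<Sigma> n])
  also have "\<dots> = ennreal (det_moment p n \<Sigma>) * (\<integral>\<^sup>+W. wishart_density p (n + 2) \<Sigma> W * F W \<partial>sym_lborel p)"
    by (rule nn_integral_cmult[OF borel_measurable_times_ennreal[OF D F]])
  also have "(\<integral>\<^sup>+W. wishart_density p (n + 2) \<Sigma> W * F W \<partial>sym_lborel p) = (\<integral>\<^sup>+W. F W \<partial>wishart p (n + 2) \<Sigma>)"
    unfolding wishart_def by (rule nn_integral_density[symmetric, OF D F])
  finally show ?thesis .
qed

text \<open>The first moment is the mass of the distribution with \<open>n + 2\<close> degrees of
  freedom times a constant; for the second the shift is made twice and ends at
  \<open>n + 4\<close>.\<close>

lemma wishart_det_moments:
  assumes \<Sigma>: "\<Sigma> \<in> pd_mats p" and n: "p \<le> n"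
  shows "(\<integral>\<^sup>+W. ennreal (det W) \<partial>wishart p n \<Sigma>) = ennreal (det_moment p n \<Sigma>)"
    and "(\<integral>\<^sup>+W. ennreal (det W) * ennreal (det W) \<partial>wishart p n \<Sigma>) =
      ennreal (det_moment p n \<Sigma> * det_moment p (n + 2) \<Sigma>)"
proof -
  let ?d = "\<lambda>W. ennreal (det W)"
  have first: "(\<integral>\<^sup>+W. ?d W \<partial>wishart p n \<Sigma>) = ennreal (det_moment p n \<Sigma>)" if n: "p \<le> n" for n
  proof -
    have "p \<le> n + 2" using n by simp
    from prob_space.emeasure_space_1[OF prob_space_wishart[OF \<Sigma> this]]
    have "(\<integral>\<^sup>+W. 1 \<partial>wishart p (n + 2) \<Sigma>) = 1" by simp
    then show ?thesis using nn_integral_wishart_det[OF \<Sigma> n, of "\<lambda>_. 1"] by simp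
  qed
  show "(\<integral>\<^sup>+W. ?d W \<partial>wishart p n \<Sigma>) = ennreal (det_moment p n \<Sigma>)"
    by (rule first[OF n])
  have n2: "p \<le> n + 2" using n by simp
  have det: "?d \<in> borel_measurable (sym_lborel p)"
    using borel_measurable_det by (rule measurable_compose[OF _ measurable_ennreal])
  show "(\<integral>\<^sup>+W. ?d W * ?d W \<partial>wishart p n \<Sigma>) =
      ennreal (det_moment p n \<Sigma> * det_moment p (n + 2) \<Sigma>)"
    unfolding nn_integral_wishart_det[OF \<Sigma> n det] first[OF n2]
    by (rule ennreal_mult[symmetric, OF det_moment_nonneg[OF \<Sigma> n] det_moment_nonneg[OF \<Sigma> n2]])
qed

text \<open>\<open>Gamma (x + 1) = x * Gamma x\<close> at \<open>x = n / 2\<close>, and the factor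
  \<open>2 ^ p\<close> with \<open>p = 1\<close> cancels the 2 in the denominator.\<close>

lemma det_moment_one:
  assumes "0 < n" "\<Sigma> \<in> carrier_mat 1 1"
  shows "det_moment 1 n \<Sigma> = real n * \<Sigma> $$ (0, 0)"
proof -
  have one: "mv_Gamma 1 a = Gamma a" for a by (simp add: mv_Gamma_def)
  have "real n / 2 \<notin> \<int>\<^sub>\<le>\<^sub>0" using assms(1) nonpos_Ints_nonpos[of "real n / 2"] by auto
  then have "Gamma (real n / 2 + 1) = real n / 2 * Gamma (real n / 2)" by (rule Gamma_plus1)
  moreover have "real (n + 2) / 2 = real n / 2 + 1" by simp
  ultimately have plus: "Gamma (real (n + 2) / 2) = real n / 2 * Gamma (real n / 2)" by (simp only:)
  have pos: "Gamma (real n / 2) > 0" using assms(1) by (intro Gamma_real_pos) simp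
  show ?thesis
    unfolding det_moment_def one plus det_single[OF assms(2)] using pos by simp
qed

lemma wishart_one_dim_inject:
  assumes "\<Sigma> \<in> pd_mats 1" "\<Sigma>' \<in> pd_mats 1" "0 < n" "0 < n'" and eq: "wishart 1 n \<Sigma> = wishart 1 n' \<Sigma>'"
  shows "n = n' \<and> \<Sigma> $$ (0, 0) = \<Sigma>' $$ (0, 0)"
proof -
  note c = pd_mats_carrier[OF assms(1)] pd_mats_carrier[OF assms(2)]
  define s where "s = \<Sigma> $$ (0, 0)"
  define s' where "s' = \<Sigma>' $$ (0, 0)"
  have s: "s > 0" "s' > 0" using det_pd_mats_pos[OF assms(1)] det_pd_mats_pos[OF assms(2)] c
    by (auto simp: s_def s'_def det_single)
  have m: "det_moment 1 n \<Sigma> = real n * s" "det_moment 1 n' \<Sigma>' = real n' * s'"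
    "det_moment 1 (n + 2) \<Sigma> = real (n + 2) * s" "det_moment 1 (n' + 2) \<Sigma>' = real (n' + 2) * s'"
    using det_moment_one[OF assms(3) c(1)] det_moment_one[OF assms(4) c(2)]
      det_moment_one[OF _ c(1), of "n + 2"] det_moment_one[OF _ c(2), of "n' + 2"] by (auto simp: s_def s'_def)
  have n: "1 \<le> n" "1 \<le> n'" using assms by auto
  have "ennreal (real n * s) = ennreal (real n' * s')"
    using wishart_det_moments(1)[OF assms(1) n(1)] wishart_det_moments(1)[OF assms(2) n(2)] unfolding eq m by simp
  then have e1: "real n * s = real n' * s'" using s by (simp add: ennreal_inj)
  have "ennreal (real n * s * (real (n + 2) * s)) = ennreal (real n' * s' * (real (n' + 2) * s'))"
    using wishart_det_moments(2)[OF assms(1) n(1)] wishart_det_moments(2)[OF assms(2) n(2)] unfolding eq m by simp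
  then have "real n * s * (real (n + 2) * s) = real n' * s' * (real (n' + 2) * s')"
    using s by (subst (asm) ennreal_inj) auto
  \<comment> \<open>Dividing the second moment by the first leaves \<open>(n + 2) s\<close>;
    subtracting the first moment \<open>n s\<close> then gives \<open>2 s\<close>.\<close>
  then have "real (n + 2) * s = real (n' + 2) * s'"
    unfolding e1 using s assms(4) by simp
  then have "s = s'" using e1 by (simp add: algebra_simps)
  with e1 s show ?thesis by (simp add: s_def s'_def)
qed

lemma wishart_inject:
  assumes \<Sigma>: "\<Sigma> \<in> pd_mats p" "p \<le> n" and \<Sigma>': "\<Sigma>' \<in> pd_mats p'" "p' \<le> n'" and p: "0 < p"
    and eq: "wishart p n \<Sigma> = wishart p' n' \<Sigma>'"
  shows "p = p' \<and> n = n' \<and> \<Sigma> = \<Sigma>'"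
proof -
  \<comment> \<open>The dimension is already visible in the underlying space of the measure.\<close>
  have "sym_mats p = sym_mats p'" using eq by (metis space_wishart)
  then have "1\<^sub>m p \<in> sym_mats p'" using pd_mats_sym[OF one_mat_pd] by blast
  then have pp: "p' = p" using sym_mats_carrier by fastforce
  note \<Sigma>' = \<Sigma>'[unfolded pp]
  note c = pd_mats_carrier[OF \<Sigma>(1)] pd_mats_carrier[OF \<Sigma>'(1)]
  have row: "n = n' \<and> v \<bullet> (\<Sigma> *\<^sub>v v) = v \<bullet> (\<Sigma>' *\<^sub>v v)" if v: "v \<in> carrier_vec p" "v \<noteq> 0\<^sub>v p" for v
  proof -
    define A where "A = mat 1 p (\<lambda>(_, j). v $ j)"
    have A: "A \<in> carrier_mat 1 p" by (simp add: A_def)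
    have inj: "u = 0\<^sub>v 1" if u: "u \<in> carrier_vec 1" "A\<^sup>T *\<^sub>v u = 0\<^sub>v p" for u
    proof -
      obtain j where j: "j < p" "v $ j \<noteq> 0" using v by (metis carrier_vecD eq_vecI index_zero_vec)
      have "(A\<^sup>T *\<^sub>v u) $ j = 0" unfolding u(2) using j by simp
      then have "v $ j * u $ 0 = 0"
        unfolding mult_transpose_vec_index[OF A u(1) j(1)] using j by (simp add: A_def)
      then show ?thesis using j u by (intro eq_vecI) auto
    qed
    have pd: "congr A \<Sigma> \<in> pd_mats 1" "congr A \<Sigma>' \<in> pd_mats 1"
      using pd_mats_congr[OF \<Sigma>(1) A inj] pd_mats_congr[OF \<Sigma>'(1) A inj] by auto
    have "wishart 1 n (congr A \<Sigma>) = wishart 1 n' (congr A \<Sigma>')"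
      using distr_wishart_congr[OF \<Sigma> A pd(1)] distr_wishart_congr[OF \<Sigma>' A pd(2)] eq pp by simp
    moreover have "0 < n" "0 < n'" using p \<Sigma>(2) \<Sigma>'(2) pp by auto
    ultimately have "n = n'" "congr A \<Sigma> $$ (0, 0) = congr A \<Sigma>' $$ (0, 0)"
      using wishart_one_dim_inject[OF pd] by auto
    then show ?thesis
      unfolding quad_form_sum[OF c(1) v(1)] quad_form_sum[OF c(2) v(1)]
      using congr_mat_index[OF A c(1), of 0 0] congr_mat_index[OF A c(2), of 0 0]
      by (simp add: A_def mult.assoc)
  qed
  have unit: "unit_vec p i \<bullet> (S *\<^sub>v unit_vec p j) = S $$ (i, j)" if "S \<in> carrier_mat p p" "i < p" "j < p" for S :: "real mat" and i j
    using that by auto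
  have unit_nz: "(unit_vec p i :: real vec) \<noteq> 0\<^sub>v p" if "i < p" for i using that by simp
  have diag: "\<Sigma> $$ (i, i) = \<Sigma>' $$ (i, i)" if "i < p" for i
    using row[OF unit_vec_carrier unit_nz[OF that]] unit[OF c(1) that that] unit[OF c(2) that that] by simp
  have "\<Sigma> = \<Sigma>'"
  proof (rule sym_mats_eqI[OF pd_mats_sym[OF \<Sigma>(1)] pd_mats_sym[OF \<Sigma>'(1)]])
    fix i j :: nat assume ij: "i \<le> j" "j < p"
    then have i: "i < p" by simp
    show "\<Sigma> $$ (i, j) = \<Sigma>' $$ (i, j)"
    proof (cases "i = j")
      case False
      \<comment> \<open>Polarization: the quadratic form at two unit vectors and at their sum
        determines the entry off the diagonal.\<close>
      let ?e = "unit_vec p i + unit_vec p j :: real vec"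
      have e: "?e \<in> carrier_vec p" by simp
      have "?e $ i = 1" using False i ij by simp
      then have ne: "?e \<noteq> 0\<^sub>v p" using i by (metis index_zero_vec(1) zero_neq_one)
      have expand: "?e \<bullet> (S *\<^sub>v ?e) = S $$ (i, i) + S $$ (j, j) + 2 * S $$ (i, j)" if S: "S \<in> sym_mats p" for S
      proof -
        note Sc = sym_mats_carrier[OF S]
        have "?e \<bullet> (S *\<^sub>v ?e) = unit_vec p i \<bullet> (S *\<^sub>v unit_vec p i) + unit_vec p i \<bullet> (S *\<^sub>v unit_vec p j)
          + (unit_vec p j \<bullet> (S *\<^sub>v unit_vec p i) + unit_vec p j \<bullet> (S *\<^sub>v unit_vec p j))"
          using Sc by (subst mult_add_distrib_mat_vec[of S p p])
            (simp_all add: add_scalar_prod_distrib[of _ p] scalar_prod_add_distrib[of _ p])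
        then show ?thesis using unit[OF Sc] i ij sym_mats_index[OF S i ij(2)] by simp
      qed
      show ?thesis
        using row[OF e ne] diag[OF i] diag[OF ij(2)]
        unfolding expand[OF pd_mats_sym[OF \<Sigma>(1)]] expand[OF pd_mats_sym[OF \<Sigma>'(1)]] by simp
    qed (use diag ij in simp)
  qed
  moreover have "n = n'" using row[OF unit_vec_carrier unit_nz[OF p]] by blast
  ultimately show ?thesis using pp by simp
qed

section \<open>Block sums and block swaps\<close>

lemma dsum_mat_carrier:
  "A \<in> carrier_mat a b \<Longrightarrow> B \<in> carrier_mat c d \<Longrightarrow> A \<oplus>\<^sub>m B \<in> carrier_mat (a + c) (b + d)"
  unfolding dsum_mat_def by (rule four_block_carrier_mat)

lemma dsum_mat_mult:
  assumes "A \<in> carrier_mat a b" "B \<in> carrier_mat c d" "A' \<in> carrier_mat b e" "B' \<in> carrier_mat d f"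
  shows "(A \<oplus>\<^sub>m B) * (A' \<oplus>\<^sub>m B') = A * A' \<oplus>\<^sub>m B * B'"
  unfolding dsum_mat_def using assms
  by (subst mult_four_block_mat[of _ a b _ d _ c _ _ e _ f]) (auto intro!: cong_four_block_mat)

lemma dsum_mat_transpose: "(A \<oplus>\<^sub>m B)\<^sup>T = A\<^sup>T \<oplus>\<^sub>m B\<^sup>T"
  unfolding dsum_mat_def
  by (subst transpose_four_block_mat[of _ "dim_row A" "dim_col A" _ "dim_col B" _ "dim_row B"]) auto

lemma dsum_mat_one: "1\<^sub>m p \<oplus>\<^sub>m 1\<^sub>m q = 1\<^sub>m (p + q)"
  by (simp add: dsum_mat_def)

lemma dsum_mat_assoc: "(A \<oplus>\<^sub>m B) \<oplus>\<^sub>m C = A \<oplus>\<^sub>m (B \<oplus>\<^sub>m C)"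
  using assoc_four_block_mat[of A B C] by (simp add: dsum_mat_def)

lemma dsum_mat_empty:
  assumes "A \<in> carrier_mat 0 0"
  shows "A \<oplus>\<^sub>m B = B" "B \<oplus>\<^sub>m A = B"
  using assms by (auto simp: dsum_mat_def intro!: eq_matI)

lemma dsum_mat_congr:
  assumes "A1 \<in> carrier_mat q1 p1" "A2 \<in> carrier_mat q2 p2" "\<Sigma>1 \<in> carrier_mat p1 p1" "\<Sigma>2 \<in> carrier_mat p2 p2"
  shows "congr (A1 \<oplus>\<^sub>m A2) (\<Sigma>1 \<oplus>\<^sub>m \<Sigma>2) = congr A1 \<Sigma>1 \<oplus>\<^sub>m congr A2 \<Sigma>2"
  unfolding dsum_mat_transpose dsum_mat_mult[OF assms(1,2,3,4)]
  by (rule dsum_mat_mult) (use assms in auto)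

lemma det_dsum_mat:
  assumes "A \<in> carrier_mat p p" "B \<in> carrier_mat q q"
  shows "det (A \<oplus>\<^sub>m B) = det A * det B"
  unfolding dsum_mat_def using assms
  by (subst det_four_block_mat_upper_right_zero[of _ p _ q]) auto

text \<open>The direct sum of Cholesky factors is invertible and exhibits the block sum as congruent
  to the identity, so no vector has to be split into blocks.\<close>

lemma dsum_mat_pd:
  assumes "A \<in> pd_mats p" "B \<in> pd_mats q"
  shows "A \<oplus>\<^sub>m B \<in> pd_mats (p + q)"
proof -
  obtain L where L: "L \<in> carrier_mat p p" "det L \<noteq> 0" "L * L\<^sup>T = A"
    using cholesky[OF assms(1)] by (metis less_irrefl)
  obtain M where M: "M \<in> carrier_mat q q" "det M \<noteq> 0" "M * M\<^sup>T = B"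
    using cholesky[OF assms(2)] by (metis less_irrefl)
  have LM: "L \<oplus>\<^sub>m M \<in> carrier_mat (p + q) (p + q)" by (rule dsum_mat_carrier[OF L(1) M(1)])
  have "congr (L \<oplus>\<^sub>m M) (1\<^sub>m (p + q)) = A \<oplus>\<^sub>m B"
    unfolding dsum_mat_one[symmetric] dsum_mat_congr[OF L(1) M(1) one_carrier_mat one_carrier_mat]
    using L M by simp
  moreover have "congr (L \<oplus>\<^sub>m M) (1\<^sub>m (p + q)) \<in> pd_mats (p + q)"
    by (subst pd_mats_congr_iff[OF LM _ one_carrier_mat])
      (use L M in \<open>simp_all add: det_dsum_mat one_mat_pd\<close>)
  ultimately show ?thesis by simp
qed

text \<open>The linear map that reads coordinate \<open>f i\<close> into position \<open>i\<close>.
  Products become compositions in reversed order, which reduces identities between swap matrices to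
  index arithmetic.\<close>

definition fun_mat :: "nat \<Rightarrow> (nat \<Rightarrow> nat) \<Rightarrow> real mat" where
  "fun_mat n f = mat n n (\<lambda>(i, j). if f i = j then 1 else 0)"

lemma fun_mat_mult:
  assumes "\<And>i. i < n \<Longrightarrow> f i < n"
  shows "fun_mat n f * fun_mat n g = fun_mat n (\<lambda>i. g (f i))" (is "_ = ?M")
proof (rule eq_matI)
  fix i j assume "i < dim_row ?M" "j < dim_col ?M"
  then have ij: "i < n" "j < n" by (auto simp: fun_mat_def)
  have "(fun_mat n f * fun_mat n g) $$ (i, j) = (\<Sum>k<n. (if f i = k then 1 else 0) * (if g k = j then 1 else 0))"
    using ij by (auto simp: fun_mat_def scalar_prod_def atLeast0LessThan intro!: sum.cong)
  also have "\<dots> = (\<Sum>k<n. if f i = k then if g k = j then 1 else 0 else 0)"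
    by (intro sum.cong) auto
  also have "\<dots> = (if g (f i) = j then 1 else 0)" using assms[OF ij(1)] by (subst sum.delta') auto
  finally show "(fun_mat n f * fun_mat n g) $$ (i, j) = ?M $$ (i, j)"
    using ij by (simp add: fun_mat_def)
qed (auto simp: fun_mat_def)

lemma one_mat_eq_fun_mat: "1\<^sub>m n = fun_mat n (\<lambda>i. i)"
  by (rule eq_matI) (auto simp: fun_mat_def)

lemma fun_mat_cong: "(\<And>i. i < n \<Longrightarrow> f i = g i) \<Longrightarrow> fun_mat n f = fun_mat n g"
  by (rule eq_matI) (auto simp: fun_mat_def)

lemma dsum_fun_mat:
  assumes "\<And>i. i < p \<Longrightarrow> f i < p" "\<And>i. i < q \<Longrightarrow> g i < q"
  shows "fun_mat p f \<oplus>\<^sub>m fun_mat q g = fun_mat (p + q) (\<lambda>i. if i < p then f i else p + g (i - p))" (is "_ = ?M")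
proof (rule eq_matI)
  fix i j assume "i < dim_row ?M"
    "j < dim_col ?M"
  then have ij: "i < p + q" "j < p + q" by (auto simp: fun_mat_def)
  then show "(fun_mat p f \<oplus>\<^sub>m fun_mat q g) $$ (i, j) =
    ?M $$ (i, j)"
    using assms(1)[of i] assms(2)[of "i - p"] by (auto simp: fun_mat_def dsum_mat_def)
qed (auto simp: fun_mat_def dsum_mat_def)

lemma swap_mat_eq_fun_mat: "swap_mat p q = fun_mat (p + q) (\<lambda>i. if i < q then p + i else i - q)"
  by (rule eq_matI) (auto simp: swap_mat_def fun_mat_def)

lemma swap_mat_carrier: "swap_mat p q \<in> carrier_mat (q + p) (p + q)"
  by (rule carrier_matI) (auto simp: swap_mat_def)

lemma swap_mat_transpose: "(swap_mat p q)\<^sup>T = swap_mat q p"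
  by (rule eq_matI) (auto simp: swap_mat_def)

lemma swap_mat_swap: "swap_mat q p * swap_mat p q = 1\<^sub>m (p + q)"
proof -
  have "swap_mat q p * swap_mat p q = fun_mat (p + q) (\<lambda>i. if i < p then q + i else i - p) *
    fun_mat (p + q) (\<lambda>i. if i < q then p + i else i - q)"
    by (simp add: swap_mat_eq_fun_mat add.commute)
  also have "\<dots> = 1\<^sub>m (p + q)"
    unfolding one_mat_eq_fun_mat by (subst fun_mat_mult) (auto intro!: fun_mat_cong)
  finally show ?thesis .
qed

lemma swap_mat_zero: "swap_mat p 0 = 1\<^sub>m p"
  by (rule eq_matI) (auto simp: swap_mat_def)

text \<open>Moving a block of length \<open>x\<close> past one of length \<open>y + z\<close> is
  moving it past \<open>y\<close> and then past \<open>z\<close>; with trivial associators this is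
  the hexagon.\<close>

lemma swap_mat_hexagon:
  "swap_mat x (y + z) = (1\<^sub>m y \<oplus>\<^sub>m swap_mat x z) * (swap_mat x y \<oplus>\<^sub>m 1\<^sub>m z)"
proof -
  have 1: "1\<^sub>m y \<oplus>\<^sub>m swap_mat x z =
      fun_mat (y + (x + z)) (\<lambda>i. if i < y then i else y + (if i - y < z then x + (i - y) else i - y - z))"
    unfolding one_mat_eq_fun_mat swap_mat_eq_fun_mat by (rule dsum_fun_mat) (auto split: if_splits)
  have 2: "swap_mat x y \<oplus>\<^sub>m 1\<^sub>m z =
      fun_mat (x + y + z) (\<lambda>i. if i < x + y then if i < y then x + i else i - y else x + y + (i - (x + y)))"
    unfolding one_mat_eq_fun_mat swap_mat_eq_fun_mat by (rule dsum_fun_mat) (auto split: if_splits)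
  have n: "y + (x + z) = x + y + z" "x + (y + z) = x + y + z" by simp_all
  let ?f = "\<lambda>i. if i < y then i else y + (if i - y < z then x + (i - y) else i - y - z)"
  have f: "?f i < x + y + z" if "i < x + y + z" for i
    using that by (simp split: if_split) arith
  have prod: "fun_mat (x + y + z) ?f * fun_mat (x + y + z) g = fun_mat (x + y + z) (\<lambda>i. g (?f i))" for g
    by (rule fun_mat_mult) (rule f)
  show ?thesis
    unfolding 1 2 swap_mat_eq_fun_mat[of x "y + z"] n prod
  proof (rule fun_mat_cong)
    fix i assume i: "i < x + y + z"
    \<comment> \<open>The output positions in turn: the blocks of length \<open>y\<close>,
      \<open>z\<close> and \<open>x\<close>.\<close>
    consider "i < y" | "y \<le> i" "i < y + z" | "y + z \<le> i" by linarith
    then show "(if i < y + z then x + i else i - (y + z)) =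
      (if ?f i < x + y then if ?f i < y then x + ?f i else ?f i - y else x + y + (?f i - (x + y)))"
    proof cases
      case 1
      then have "?f i = i" by simp
      then show ?thesis using 1 by simp
    next
      case 2
      then have "i - y < z" by arith
      then have "?f i = x + i" using 2 by simp
      then show ?thesis using 2 by simp
    next
      case 3
      then have "\<not> i - y < z" by arith
      then have "?f i = i - z" using 3 by simp
      moreover have "i - z < x + y" "\<not> i - z < y" "\<not> i < y + z" "i - z - y = i - (y + z)"
        using 3 i by arith+
      ultimately show ?thesis by simp
    qed
  qed
qed

text \<open>Naturality of the braiding at the level of matrices: both sides have \<open>B\<close> in
  the upper right block, \<open>A\<close> in the lower left one, and zeros elsewhere.\<close>

lemma swap_mat_dsum:
  assumes A: "A \<in> carrier_mat p p'" and B: "B \<in> carrier_mat q q'"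
  shows "swap_mat p q * (A \<oplus>\<^sub>m B) = (B \<oplus>\<^sub>m A) * swap_mat p' q'"
proof -
  have "swap_mat p q * (A \<oplus>\<^sub>m B) = four_block_mat (0\<^sub>m q p') B A (0\<^sub>m p q')"
    unfolding swap_mat_def dsum_mat_def using A B
    by (subst mult_four_block_mat[of _ q p _ q _ p _ _ p' _ q']) (auto intro!: cong_four_block_mat)
  also have "\<dots> = (B \<oplus>\<^sub>m A) * swap_mat p' q'"
    unfolding swap_mat_def dsum_mat_def using A B
    by (subst mult_four_block_mat[of _ q q' _ p' _ p _ _ p' _ q']) (auto intro!: cong_four_block_mat)
  finally show ?thesis .
qed

lemma swap_mat_congr:
  assumes A: "A \<in> carrier_mat p p" and B: "B \<in> carrier_mat q q"
  shows "swap_mat p q * (A \<oplus>\<^sub>m B) * (swap_mat p q)\<^sup>T = B \<oplus>\<^sub>m A"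
proof -
  have BA: "B \<oplus>\<^sub>m A \<in> carrier_mat (q + p) (q + p)" by (rule dsum_mat_carrier[OF B A])
  have "swap_mat p q * (A \<oplus>\<^sub>m B) * (swap_mat p q)\<^sup>T = (B \<oplus>\<^sub>m A) * swap_mat p q * swap_mat q p"
    unfolding swap_mat_transpose swap_mat_dsum[OF A B] ..
  also have "\<dots> = (B \<oplus>\<^sub>m A) * (swap_mat p q * swap_mat q p)"
    by (rule assoc_mult_mat[OF BA swap_mat_carrier swap_mat_carrier])
  also have "\<dots> = B \<oplus>\<^sub>m A" unfolding swap_mat_swap by (rule right_mult_one_mat[OF BA])
  finally show ?thesis .
qed

section \<open>Admissible parameters and objects\<close>

lemma wishart_param_iff: "wishart_param p n \<Sigma> \<longleftrightarrow> \<Sigma> \<in> pd_mats p \<and> p \<le> n \<and> (p = 0 \<longrightarrow> n = 0)"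
proof (cases "p = 0")
  case True
  \<comment> \<open>The empty matrix is vacuously positive definite, so the unit satisfies the same
    description as the family proper.\<close>
  have "0\<^sub>m 0 0 = (1\<^sub>m 0 :: real mat)" by (rule eq_matI) auto
  then have "\<Sigma> = 0\<^sub>m 0 0" if "\<Sigma> \<in> pd_mats 0" using pd_mats_carrier[OF that] by auto
  moreover have "0\<^sub>m 0 0 \<in> pd_mats 0" using one_mat_pd[of 0] \<open>0\<^sub>m 0 0 = 1\<^sub>m 0\<close> by simp
  ultimately show ?thesis using True by (auto simp: wishart_param_def)
qed (auto simp: wishart_param_def)

lemma wishart_param_inject:
  assumes "wishart_param p n \<Sigma>" "wishart_param p' n' \<Sigma>'" "wishart p n \<Sigma> = wishart p' n' \<Sigma>'"
  shows "p = p' \<and> n = n' \<and> \<Sigma> = \<Sigma>'"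
proof -
  consider "0 < p" | "0 < p'" | "p = 0" "p' = 0" by auto
  then show ?thesis
  proof cases
    case 1
    then show ?thesis using wishart_inject[of \<Sigma> p n \<Sigma>' p' n'] assms by (simp add: wishart_param_iff)
  next
    case 2
    then show ?thesis using wishart_inject[of \<Sigma>' p' n' \<Sigma> p n] assms by (simp add: wishart_param_iff)
  next
    \<comment> \<open>In dimension 0 the measure does not see \<open>n\<close>; here
      \<open>wishart_param\<close> itself fixes \<open>n = 0\<close>.\<close>
    case 3
    then show ?thesis using assms(1,2) by (simp add: wishart_param_def)
  qed
qed

lemma param_of_wishart:
  assumes "wishart_param p n \<Sigma>"
  shows "param_of (wishart p n \<Sigma>) = (p, n, \<Sigma>)"
  unfolding param_of_def
proof (rule the_equality)
  show "case (p, n, \<Sigma>) of (q, m, \<Sigma>') \<Rightarrow> wishart_param q m \<Sigma>' \<and> wishart p n \<Sigma> = wishart q m \<Sigma>'"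
    using assms by simp
  fix x assume "case x of (q, m, \<Sigma>') \<Rightarrow> wishart_param q m \<Sigma>' \<and> wishart p n \<Sigma> = wishart q m \<Sigma>'"
  then show "x = (p, n, \<Sigma>)" using wishart_param_inject[OF assms] by auto
qed

lemma wishart_sel:
  assumes "wishart_param p n \<Sigma>"
  shows "wdim (wishart p n \<Sigma>) = p" "wdof (wishart p n \<Sigma>) = n" "wscale (wishart p n \<Sigma>) = \<Sigma>"
  using param_of_wishart[OF assms] by (simp_all add: wdim_def wdof_def wscale_def)

lemma wishart_objects_iff:
  "X \<in> wishart_objects \<longleftrightarrow> wishart_param (wdim X) (wdof X) (wscale X) \<and> X = wishart (wdim X) (wdof X) (wscale X)"
  (is "_ \<longleftrightarrow> ?R")
proof
  assume "X \<in> wishart_objects"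
  then obtain p n \<Sigma> where "wishart_param p n \<Sigma>" "X = wishart p n \<Sigma>"
    by (auto simp: wishart_objects_def wishart_param_def)
  then show ?R
    by (simp add: wishart_sel)
next
  assume ?R
  then have "wishart_param (wdim X) (wdof X) (wscale X)" and X: "X = wishart (wdim X) (wdof X) (wscale X)" by auto
  then have "wishart (wdim X) (wdof X) (wscale X) \<in> wishart_objects"
    unfolding wishart_objects_def wishart_param_def by auto
  then show "X \<in> wishart_objects" by (rule ssubst[OF X])
qed

lemma wishart_in_objects: "wishart_param p n \<Sigma> \<Longrightarrow> wishart p n \<Sigma> \<in> wishart_objects"
  by (simp add: wishart_objects_iff wishart_sel)

lemma wishart_objects_eqI:
  assumes "X \<in> wishart_objects" "Y \<in> wishart_objects" "wdim X = wdim Y" "wdof X = wdof Y" "wscale X = wscale Y"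
  shows "X = Y"
  using assms by (metis wishart_objects_iff)

lemma wscale_carrier: "X \<in> wishart_objects \<Longrightarrow> wscale X \<in> carrier_mat (wdim X) (wdim X)"
  by (simp add: wishart_objects_iff wishart_param_iff pd_mats_carrier)

lemma wishart_param_dsum:
  "wishart_param p n \<Sigma> \<Longrightarrow> wishart_param p' n' \<Sigma>' \<Longrightarrow> wishart_param (p + p') (n + n') (\<Sigma> \<oplus>\<^sub>m \<Sigma>')"
  by (auto simp: wishart_param_iff dsum_mat_pd)

lemma wtensor_obj_sel:
  assumes "X \<in> wishart_objects" "Y \<in> wishart_objects"
  shows "wtensor_obj (X, Y) \<in> wishart_objects" (is ?A) and "wdim (wtensor_obj (X, Y)) = wdim X + wdim Y" (is ?B) and
    "wdof (wtensor_obj (X, Y)) = wdof X + wdof Y" (is ?C) and "wscale (wtensor_obj (X, Y)) = wscale X \<oplus>\<^sub>m wscale Y" (is ?D)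
proof -
  have "wishart_param (wdim X + wdim Y) (wdof X + wdof Y) (wscale X \<oplus>\<^sub>m wscale Y)"
    using assms by (intro wishart_param_dsum) (simp_all add: wishart_objects_iff)
  then show ?A ?B ?C ?D
    by (simp_all add: wtensor_obj_def wishart_sel wishart_in_objects)
qed

lemma wunit_sel: "wunit \<in> wishart_objects" "wdim wunit = 0" "wdof wunit = 0" "wscale wunit = 0\<^sub>m 0 0"
proof -
  have "wishart_param 0 0 (0\<^sub>m 0 0)" by (simp add: wishart_param_def)
  then show "wunit \<in> wishart_objects" "wdim wunit = 0" "wdof wunit = 0" "wscale wunit = 0\<^sub>m 0 0"
    by (simp_all add: wunit_def wishart_sel wishart_in_objects)
qed

section \<open>The category and its arrows\<close>

lemma wishart_cat_sel [simp]:
  "Obj wishart_cat = wishart_objects" "Ide wishart_cat X = WArrow X (1\<^sub>m (wdim X)) X"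
  "g \<cdot>\<^bsub>wishart_cat\<^esub> f = WArrow (wsource f) (wmatrix g * wmatrix f) (wtarget g)"
  "Dom wishart_cat = wsource" "Cod wishart_cat = wtarget" "Arr wishart_cat = wishart_arrows"
  by (simp_all add: wishart_cat_def)

text \<open>Since a distribution determines its parameters, an arrow between given objects amounts
  to a matrix that carries one scale matrix to the other at equal degrees of freedom. The
  categorical laws are checked in this form.\<close>

lemma Hom_wishart_iff:
  "f \<in> Hom wishart_cat X Y \<longleftrightarrow> X \<in> wishart_objects \<and> Y \<in> wishart_objects \<and> wdof Y = wdof X \<and>
    (\<exists>A \<in> carrier_mat (wdim Y) (wdim X). wscale Y = A * wscale X * A\<^sup>T \<and> f = WArrow X A Y)" (is "_ \<longleftrightarrow> ?R")
proof
  assume "f \<in> Hom wishart_cat X Y"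
  then obtain p n \<Sigma> q A where f: "f = WArrow (wishart p n \<Sigma>) A (wishart q n (congr A \<Sigma>))"
    and p: "wishart_param p n \<Sigma>" "A \<in> carrier_mat q p" "wishart_param q n (congr A \<Sigma>)"
    and XY: "X = wishart p n \<Sigma>" "Y = wishart q n (congr A \<Sigma>)"
    by (auto simp: Hom_def wishart_arrows_def)
  show ?R
    unfolding XY f wishart_sel[OF p(1)] wishart_sel[OF p(3)]
    using p wishart_in_objects by blast
next
  assume ?R
  then obtain A where X: "X \<in> wishart_objects" and Y: "Y \<in> wishart_objects" and dof: "wdof Y = wdof X"
    and A: "A \<in> carrier_mat (wdim Y) (wdim X)" "wscale Y = A * wscale X * A\<^sup>T" and f: "f = WArrow X A Y"
    by blast
  have X': "wishart_param (wdim X) (wdof X) (wscale X)" "X = wishart (wdim X) (wdof X) (wscale X)"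
    using X wishart_objects_iff by blast+
  have Y': "wishart_param (wdim Y) (wdof X) (A * wscale X * A\<^sup>T)" "Y = wishart (wdim Y) (wdof X) (A * wscale X * A\<^sup>T)"
    using Y dof A(2) wishart_objects_iff by metis+
  have "f = WArrow (wishart (wdim X) (wdof X) (wscale X)) A (wishart (wdim Y) (wdof X) (A * wscale X * A\<^sup>T))"
    unfolding f X'(2)[symmetric] Y'(2)[symmetric] ..
  then have "f \<in> wishart_arrows" unfolding wishart_arrows_def using X'(1) Y'(1) A(1) by blast
  then show "f \<in> Hom wishart_cat X Y" by (simp add: Hom_def f)
qed

lemma Hom_wishartI:
  assumes "X \<in> wishart_objects" "Y \<in> wishart_objects" "wdof Y = wdof X"
    "A \<in> carrier_mat (wdim Y) (wdim X)" "wscale Y = A * wscale X * A\<^sup>T"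
  shows "WArrow X A Y \<in> Hom wishart_cat X Y"
  using assms by (auto simp: Hom_wishart_iff)

lemma Hom_wishartE:
  assumes "f \<in> Hom wishart_cat X Y"
  obtains A where "f = WArrow X A Y" "A \<in> carrier_mat (wdim Y) (wdim X)" "wscale Y = A * wscale X * A\<^sup>T"
    "wdof Y = wdof X" "X \<in> wishart_objects" "Y \<in> wishart_objects"
  using assms by (auto simp: Hom_wishart_iff)

lemma Hom_wishart_one:
  assumes "X \<in> wishart_objects" "Y \<in> wishart_objects" "wdim X = wdim Y" "wdof X = wdof Y" "wscale X = wscale Y"
    "n = wdim X"
  shows "WArrow X (1\<^sub>m n) Y \<in> Hom wishart_cat X Y"
  using assms wscale_carrier[OF assms(2)] by (intro Hom_wishartI) auto

lemma category_wishart: "category wishart_cat"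
proof
  let ?W = wishart_cat
  show "Dom ?W f \<in> Obj ?W" "Cod ?W f \<in> Obj ?W" if "f \<in> Arr ?W" for f
    using that by (auto simp: wishart_arrows_def wishart_in_objects)
  show "Ide ?W X \<in> Hom ?W X X" if "X \<in> Obj ?W" for X
    using that by (simp add: Hom_wishart_one)
  show "g \<cdot>\<^bsub>?W\<^esub> f \<in> Hom ?W X Z" if f: "f \<in> Hom ?W X Y" and g: "g \<in> Hom ?W Y Z" for f g X Y Z
  proof -
    obtain A where A: "f = WArrow X A Y" "A \<in> carrier_mat (wdim Y) (wdim X)" "wscale Y = A * wscale X * A\<^sup>T"
      "wdof Y = wdof X" "X \<in> wishart_objects" "Y \<in> wishart_objects" by (rule Hom_wishartE[OF f])
    obtain B where B: "g = WArrow Y B Z" "B \<in> carrier_mat (wdim Z) (wdim Y)" "wscale Z = B * wscale Y * B\<^sup>T"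
      "wdof Z = wdof Y" "Y \<in> wishart_objects" "Z \<in> wishart_objects" by (rule Hom_wishartE[OF g])
    have "WArrow X (B * A) Z \<in> Hom ?W X Z"
    proof (rule Hom_wishartI)
      show "wscale Z = B * A * wscale X * (B * A)\<^sup>T"
        unfolding congr_congr[OF A(2) B(2) wscale_carrier[OF A(5)]] B(3) A(3) ..
    qed (use A B in auto)
    then show ?thesis by (simp add: A B)
  qed
  show "Ide ?W Y \<cdot>\<^bsub>?W\<^esub> f = f" "f \<cdot>\<^bsub>?W\<^esub> Ide ?W X = f"
    if "f \<in> Hom ?W X Y" for f X Y
    using that by (auto elim!: Hom_wishartE)
  show "h \<cdot>\<^bsub>?W\<^esub> g \<cdot>\<^bsub>?W\<^esub> f = h \<cdot>\<^bsub>?W\<^esub> (g \<cdot>\<^bsub>?W\<^esub> f)"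
    if "f \<in> Hom ?W X Y" "g \<in> Hom ?W Y Z" "h \<in> Hom ?W Z U" for f g h X Y Z U
    using that by (auto elim!: Hom_wishartE simp: assoc_mult_mat)
qed

lemma inverse_arrows_wishartI:
  assumes X: "X \<in> wishart_objects" and Y: "Y \<in> wishart_objects" "wdof Y = wdof X"
    and A: "A \<in> carrier_mat (wdim X) (wdim X)" "wscale Y = A * wscale X * A\<^sup>T" and d: "wdim Y = wdim X"
    and B: "B \<in> carrier_mat (wdim X) (wdim X)" "B * A = 1\<^sub>m (wdim X)"
  shows "inverse_arrows wishart_cat (WArrow X A Y) (WArrow Y B X)"
proof -
  have "WArrow X A Y \<in> Hom wishart_cat X Y"
    using X Y A d by (intro Hom_wishartI) auto
  moreover have "WArrow Y B X \<in> Hom wishart_cat Y X"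
  proof (rule Hom_wishartI)
    show "wscale X = B * wscale Y * B\<^sup>T"
      unfolding A(2) by (rule congr_inverse[symmetric, OF A(1) B wscale_carrier[OF X]])
  qed (use X Y B d in auto)
  moreover have "A * B = 1\<^sub>m (wdim X)" by (rule mat_mult_left_right_inverse[OF B(1) A(1) B(2)])
  ultimately show ?thesis using B(2) d by (simp add: inverse_arrows_def Hom_def)
qed

section \<open>The symmetric monoidal structure\<close>

lemma Hom_prod_cat_iff:
  "h \<in> Hom (prod_cat C D) P Q \<longleftrightarrow> fst h \<in> Hom C (fst P) (fst Q) \<and> snd h \<in> Hom D (snd P) (snd Q)"
  by (cases h; cases P; cases Q) (auto simp: Hom_def prod_cat_def)

lemma prod_cat_sel [simp]:
  "Obj (prod_cat C D) = Obj C \<times> Obj D" "Ide (prod_cat C D) P = (Ide C (fst P), Ide D (snd P))"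
  "g \<cdot>\<^bsub>prod_cat C D\<^esub> f = (fst g \<cdot>\<^bsub>C\<^esub> fst f, snd g \<cdot>\<^bsub>D\<^esub> snd f)"
  by (simp_all add: prod_cat_def case_prod_unfold map_prod_def)

lemma category_prod_cat:
  assumes "category C" "category D"
  shows "category (prod_cat C D)"
proof -
  let ?P = "prod_cat C D"
  interpret C: category C by fact
  interpret D: category D by fact
  show ?thesis
  proof
    show "Dom (?P) f \<in> Obj (?P)" "Cod (?P) f \<in> Obj (?P)"
      if "f \<in> Arr (?P)" for f
      using that C.Dom_Obj C.Cod_Obj D.Dom_Obj D.Cod_Obj by (auto simp: prod_cat_def)
    show "Ide (?P) X \<in> Hom (?P) X X" if "X \<in> Obj (?P)" for X
      using that C.Ide_Hom D.Ide_Hom by (auto simp: Hom_prod_cat_iff)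
    show "g \<cdot>\<^bsub>?P\<^esub> f \<in> Hom (?P) X Z"
      if "f \<in> Hom (?P) X Y" "g \<in> Hom (?P) Y Z" for f g X Y Z
      using that C.Cmp_Hom D.Cmp_Hom by (auto simp: Hom_prod_cat_iff)
    show "Ide (?P) Y \<cdot>\<^bsub>?P\<^esub> f = f" "f \<cdot>\<^bsub>?P\<^esub> Ide (?P) X = f"
      if "f \<in> Hom (?P) X Y" for f X Y
      using that C.Cmp_Ide_left D.Cmp_Ide_left C.Cmp_Ide_right D.Cmp_Ide_right
      by (auto simp: Hom_prod_cat_iff intro!: prod_eqI)
    show "h \<cdot>\<^bsub>?P\<^esub> g \<cdot>\<^bsub>?P\<^esub> f = h \<cdot>\<^bsub>?P\<^esub> (g \<cdot>\<^bsub>?P\<^esub> f)"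
      if "f \<in> Hom (?P) X Y" "g \<in> Hom (?P) Y Z" "h \<in> Hom (?P) Z U" for f g h X Y Z U
      using that C.Cmp_assoc D.Cmp_assoc by (auto simp: Hom_prod_cat_iff)
  qed
qed

lemma is_functorI:
  assumes "category C" "category D" "\<And>X. X \<in> Obj C \<Longrightarrow> Fo X \<in> Obj D"
    "\<And>f X Y. f \<in> Hom C X Y \<Longrightarrow> Fa f \<in> Hom D (Fo X) (Fo Y)"
    "\<And>X. X \<in> Obj C \<Longrightarrow> Fa (Ide C X) = Ide D (Fo X)"
    "\<And>f g X Y Z. f \<in> Hom C X Y \<Longrightarrow> g \<in> Hom C Y Z \<Longrightarrow> Fa (g \<cdot>\<^bsub>C\<^esub> f) = Fa g \<cdot>\<^bsub>D\<^esub> Fa f"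
  shows "is_functor C D Fo Fa"
  using assms by (simp add: is_functor_def is_functor_axioms_def)

lemma natural_isoI:
  assumes "is_functor C D Fo Fa" "is_functor C D Go Ga"
    "\<And>X. X \<in> Obj C \<Longrightarrow> \<eta> X \<in> Hom D (Fo X) (Go X)" "\<And>X. X \<in> Obj C \<Longrightarrow> iso_arrow D (\<eta> X)"
    "\<And>f X Y. f \<in> Hom C X Y \<Longrightarrow> Ga f \<cdot>\<^bsub>D\<^esub> \<eta> X = \<eta> Y \<cdot>\<^bsub>D\<^esub> Fa f"
  shows "natural_iso C D Fo Fa Go Ga \<eta>"
  using assms by (simp add: natural_iso_def natural_iso_axioms_def)

lemma (in category) inverse_arrows_Ide:
  assumes X: "X \<in> Obj C"
  shows "inverse_arrows C (Ide C X) (Ide C X)"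
  using Ide_Hom[OF X] Cmp_Ide_left[OF Ide_Hom[OF X]] by (auto simp: inverse_arrows_def Hom_def)

text \<open>Made for the associator and the unitors: their source and target functors agree on
  objects and arrows of the category but may differ as functions elsewhere. Hence functoriality of
  \<open>Fo\<close> and \<open>Fa\<close> is transferred pointwise.\<close>

lemma natural_iso_IdeI:
  assumes G: "is_functor C D Go Ga"
    and Fo: "\<And>X. X \<in> Obj C \<Longrightarrow> Fo X = Go X" and Fa: "\<And>f X Y. f \<in> Hom C X Y \<Longrightarrow> Fa f = Ga f"
    and \<eta>: "\<And>X. X \<in> Obj C \<Longrightarrow> \<eta> X = Ide D (Go X)"
  shows "natural_iso C D Fo Fa Go Ga \<eta>"
proof -
  interpret G: is_functor C D Go Ga by fact
  have obj: "X \<in> Obj C" "Y \<in> Obj C" if "f \<in> Hom C X Y" for f X Y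
    using that G.C.Dom_Obj G.C.Cod_Obj by (auto simp: Hom_def)
  show ?thesis
  proof (rule natural_isoI[OF _ G])
    show "is_functor C D Fo Fa"
    proof (rule is_functorI)
      fix f g X Y Z assume fg: "f \<in> Hom C X Y" "g \<in> Hom C Y Z"
      show "Fa (g \<cdot>\<^bsub>C\<^esub> f) = Fa g \<cdot>\<^bsub>D\<^esub> Fa f"
        using G.map_Cmp[OF fg] Fa[OF fg(1)] Fa[OF fg(2)] Fa[OF G.C.Cmp_Hom[OF fg]] by simp
    qed (use obj G.map_Obj G.map_Hom G.map_Ide Fo Fa G.C.Ide_Hom in
      \<open>metis G.C.category_axioms G.D.category_axioms\<close>)+
    show "Ga f \<cdot>\<^bsub>D\<^esub> \<eta> X = \<eta> Y \<cdot>\<^bsub>D\<^esub> Fa f" if f: "f \<in> Hom C X Y" for f X Y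
      unfolding Fa[OF f] \<eta>[OF obj(1)[OF f]] \<eta>[OF obj(2)[OF f]]
        G.D.Cmp_Ide_left[OF G.map_Hom[OF f]] G.D.Cmp_Ide_right[OF G.map_Hom[OF f]] ..
    fix X assume X: "X \<in> Obj C"
    show "\<eta> X \<in> Hom D (Fo X) (Go X)" unfolding \<eta>[OF X] Fo[OF X] by (rule G.D.Ide_Hom[OF G.map_Obj[OF X]])
    show "iso_arrow D (\<eta> X)"
      unfolding \<eta>[OF X] iso_arrow_def using G.D.inverse_arrows_Ide[OF G.map_Obj[OF X]] by blast
  qed
qed

text \<open>Justifies the description operator in \<open>inv_arrow\<close>.\<close>

lemma (in category) inverse_arrows_unique:
  assumes "inverse_arrows C f g" "inverse_arrows C f h"
  shows "g = h"
proof -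
  have f: "f \<in> Hom C (Dom C f) (Cod C f)" and g: "g \<in> Hom C (Cod C f) (Dom C f)" and h: "h \<in> Hom C (Cod C f) (Dom C f)"
    using assms by (auto simp: inverse_arrows_def Hom_def)
  have "g = g \<cdot> Ide C (Cod C f)" using Cmp_Ide_right[OF g] by simp
  also have "\<dots> = g \<cdot> (f \<cdot> h)" using assms(2) by (simp add: inverse_arrows_def)
  also have "\<dots> = g \<cdot> f \<cdot> h" by (rule Cmp_assoc[symmetric, OF h f g])
  also have "\<dots> = Ide C (Dom C f) \<cdot> h" using assms(1) by (simp add: inverse_arrows_def)
  also have "\<dots> = h" by (rule Cmp_Ide_left[OF h])
  finally show ?thesis .
qed

lemma (in category) inv_arrow_eq:
  "inverse_arrows C f g \<Longrightarrow> inv_arrow C f = g"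
  unfolding inv_arrow_def by (rule the_equality) (auto intro: inverse_arrows_unique)

section \<open>Tensor product, unit and braiding\<close>

lemma is_functor_wtensor: "is_functor (prod_cat wishart_cat wishart_cat) wishart_cat wtensor_obj wtensor_arr"
proof (rule is_functorI)
  let ?W = wishart_cat and ?P = "prod_cat wishart_cat wishart_cat" and ?T = wtensor_obj and ?t = wtensor_arr
  show "category ?P"
    by (rule category_prod_cat[OF category_wishart category_wishart])
  show "category ?W" by (rule category_wishart)
  show "?T X \<in> Obj ?W" if "X \<in> Obj ?P" for X
    using that wtensor_obj_sel(1) by auto
  show "?t f \<in> Hom ?W (?T X) (?T Y)"
    if "f \<in> Hom ?P X Y" for f X Y
  proof -
    obtain f1 f2 X1 X2 Y1 Y2 where p: "f = (f1, f2)" "X = (X1, X2)" "Y = (Y1, Y2)" by (metis surj_pair)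
    with that have f1: "f1 \<in> Hom ?W X1 Y1" and f2: "f2 \<in> Hom ?W X2 Y2"
      by (auto simp: Hom_prod_cat_iff)
    obtain A where A: "f1 = WArrow X1 A Y1" "A \<in> carrier_mat (wdim Y1) (wdim X1)" "wscale Y1 = A * wscale X1 * A\<^sup>T"
      "wdof Y1 = wdof X1" "X1 \<in> wishart_objects" "Y1 \<in> wishart_objects" by (rule Hom_wishartE[OF f1])
    obtain B where B: "f2 = WArrow X2 B Y2" "B \<in> carrier_mat (wdim Y2) (wdim X2)" "wscale Y2 = B * wscale X2 * B\<^sup>T"
      "wdof Y2 = wdof X2" "X2 \<in> wishart_objects" "Y2 \<in> wishart_objects" by (rule Hom_wishartE[OF f2])
    have "WArrow (?T (X1, X2)) (A \<oplus>\<^sub>m B) (?T (Y1, Y2)) \<in>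
      Hom ?W (?T (X1, X2)) (?T (Y1, Y2))"
    proof (rule Hom_wishartI, unfold wtensor_obj_sel[OF A(5) B(5)] wtensor_obj_sel[OF A(6) B(6)])
      show "A \<oplus>\<^sub>m B \<in> carrier_mat (wdim Y1 + wdim Y2) (wdim X1 + wdim X2)"
        by (rule dsum_mat_carrier[OF A(2) B(2)])
      show "wscale Y1 \<oplus>\<^sub>m wscale Y2 = congr (A \<oplus>\<^sub>m B) (wscale X1 \<oplus>\<^sub>m wscale X2)"
        unfolding dsum_mat_congr[OF A(2) B(2) wscale_carrier[OF A(5)] wscale_carrier[OF B(5)]] A(3) B(3) ..
    qed (use A B in \<open>simp_all add: wtensor_obj_sel(1)\<close>)
    then show ?thesis by (simp add: p A(1) B(1) wtensor_arr_def)
  qed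
  show "?t (Ide ?P X) = Ide ?W (?T X)"
    if "X \<in> Obj ?P" for X
    using that by (cases X) (simp add: wtensor_arr_def dsum_mat_one wtensor_obj_sel)
  show "?t (g \<cdot>\<^bsub>?P\<^esub> f) = ?t g \<cdot>\<^bsub>?W\<^esub> ?t f"
    if "f \<in> Hom ?P X Y" "g \<in> Hom ?P Y Z" for f g X Y Z
    using that unfolding Hom_prod_cat_iff
    by (cases f; cases g) (auto elim!: Hom_wishartE simp: wtensor_arr_def dsum_mat_mult)
qed

lemma wtensor_arr_Hom:
  "f \<in> Hom wishart_cat X Y \<Longrightarrow> g \<in> Hom wishart_cat X' Y' \<Longrightarrow>
    wtensor_arr (f, g) \<in> Hom wishart_cat (wtensor_obj (X, X')) (wtensor_obj (Y, Y'))"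
  using is_functor.map_Hom[OF is_functor_wtensor, of "(f, g)" "(X, X')" "(Y, Y')"]
  by (simp add: Hom_prod_cat_iff)

lemma wtensor_arr_Cmp:
  assumes "f \<in> Hom wishart_cat X Y" "g \<in> Hom wishart_cat Y Z" "f' \<in> Hom wishart_cat X' Y'" "g' \<in> Hom wishart_cat Y' Z'"
  shows "wtensor_arr (g \<cdot>\<^bsub>wishart_cat\<^esub> f, g' \<cdot>\<^bsub>wishart_cat\<^esub> f') = wtensor_arr (g, g') \<cdot>\<^bsub>wishart_cat\<^esub> wtensor_arr (f, f')"
  using is_functor.map_Cmp[OF is_functor_wtensor, of "(f, f')" "(X, X')" "(Y, Y')" "(g, g')" "(Z, Z')"] assms
  by (simp add: Hom_prod_cat_iff)

lemma wtensor_obj_unit: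
  assumes X: "X \<in> wishart_objects"
  shows "wtensor_obj (wunit, X) = X" "wtensor_obj (X, wunit) = X"
  using X by (auto intro!: wishart_objects_eqI simp: wtensor_obj_sel wunit_sel dsum_mat_empty)

lemma wtensor_obj_assoc:
  assumes "X \<in> wishart_objects" "Y \<in> wishart_objects" "Z \<in> wishart_objects"
  shows "wtensor_obj (wtensor_obj (X, Y), Z) = wtensor_obj (X, wtensor_obj (Y, Z))"
  using assms by (intro wishart_objects_eqI) (simp_all add: wtensor_obj_sel dsum_mat_assoc)

lemma wassoc_eq:
  assumes "X \<in> wishart_objects" "Y \<in> wishart_objects" "Z \<in> wishart_objects"
  shows "wassoc X Y Z = Ide wishart_cat (wtensor_obj (X, wtensor_obj (Y, Z)))"
  using assms by (simp add: wassoc_def wtensor_obj_assoc wtensor_obj_sel add.assoc)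

lemma wlunit_eq: "X \<in> wishart_objects \<Longrightarrow> wlunit X = Ide wishart_cat X"
  and wrunit_eq: "X \<in> wishart_objects \<Longrightarrow> wrunit X = Ide wishart_cat X"
  by (simp_all add: wlunit_def wrunit_def wtensor_obj_unit)

lemma wbraid_inverse_arrows:
  assumes X: "X \<in> wishart_objects" and Y: "Y \<in> wishart_objects"
  shows "inverse_arrows wishart_cat (wbraid X Y) (wbraid Y X)"
  unfolding wbraid_def
proof (rule inverse_arrows_wishartI)
  let ?n = "wdim (wtensor_obj (X, Y))" and ?s = "swap_mat (wdim X) (wdim Y)" and ?s' = "swap_mat (wdim Y) (wdim X)"
  show "?s \<in> carrier_mat ?n ?n"
    using swap_mat_carrier[of "wdim X" "wdim Y"] by (simp add: wtensor_obj_sel X Y add.commute)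
  show "?s' \<in> carrier_mat ?n ?n"
    using swap_mat_carrier[of "wdim Y" "wdim X"] by (simp add: wtensor_obj_sel X Y add.commute)
  show "?s' * ?s = 1\<^sub>m ?n"
    by (simp add: wtensor_obj_sel X Y swap_mat_swap)
  show "wscale (wtensor_obj (Y, X)) = ?s * wscale (wtensor_obj (X, Y)) * ?s\<^sup>T"
    by (simp add: wtensor_obj_sel X Y swap_mat_congr wscale_carrier)
qed (simp_all add: wtensor_obj_sel X Y)

lemma wbraid_Hom:
  assumes "X \<in> wishart_objects" "Y \<in> wishart_objects"
  shows "wbraid X Y \<in> Hom wishart_cat (wtensor_obj (X, Y)) (wtensor_obj (Y, X))"
  using wbraid_inverse_arrows[OF assms] by (simp add: inverse_arrows_def Hom_def wbraid_def)

lemma symmetric_monoidal_wishart: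
  "symmetric_monoidal_category wishart_cat wtensor_obj wtensor_arr wunit wassoc wlunit wrunit wbraid"
proof -
  let ?W = wishart_cat and ?W2 = "prod_cat wishart_cat wishart_cat" and
    ?W3 = "prod_cat (prod_cat wishart_cat wishart_cat) wishart_cat" and ?O = wishart_objects and ?T = wtensor_obj and ?t = wtensor_arr
  interpret W: category ?W by (rule category_wishart)
  \<comment> \<open>Identities and compositions stay folded, so that the laws of the category and of
    the tensor functor can be matched.\<close>
  note [simp del] = wishart_cat_sel(2,3)
  have T_obj: "?T (X, Y) \<in> ?O" if "X \<in> ?O" "Y \<in> ?O" for X Y
    using that by (rule wtensor_obj_sel)
  have T_ide: "?t (Ide ?W X, Ide ?W Y) = Ide ?W (?T (X, Y))"
    if "X \<in> ?O" "Y \<in> ?O" for X Y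
    using is_functor.map_Ide[OF is_functor_wtensor, of "(X, Y)"] that by simp
  have Ide_Hom: "Ide ?W X \<in> Hom ?W X X" if "X \<in> ?O" for X
    using that W.Ide_Hom by simp
  have Ide_Ide: "Ide ?W X \<cdot>\<^bsub>?W\<^esub> Ide ?W X = Ide ?W X" if "X \<in> ?O" for X
    by (rule W.Cmp_Ide_left[OF Ide_Hom[OF that]])
  have assoc_arr: "?t (?t (f, g), h) = ?t (f, ?t (g, h))"
    if "f \<in> Hom ?W X X'" "g \<in> Hom ?W Y Y'" "h \<in> Hom ?W Z Z'" for f g h X X' Y Y' Z Z'
    using that by (auto elim!: Hom_wishartE simp: wtensor_arr_def wtensor_obj_assoc dsum_mat_assoc)
  have unit_arr: "?t (Ide ?W wunit, f) = f" "?t (f, Ide ?W wunit) = f" if "f \<in> Hom ?W X Y" for f X Y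
    using that by (auto elim!: Hom_wishartE simp: wtensor_arr_def wtensor_obj_unit wunit_sel dsum_mat_empty wishart_cat_sel(2))
  have id_functor: "is_functor ?W ?W (\<lambda>X. X) (\<lambda>f. f)"
    by (rule is_functorI) (simp_all add: category_wishart)
  show ?thesis
  proof (unfold symmetric_monoidal_category_def symmetric_monoidal_category_axioms_def, intro conjI allI impI, goal_cases)
    case 1
    show ?case by (rule category_wishart)
  next
    case 2
    show ?case by (rule is_functor_wtensor)
  next
    case 3
    show ?case by (simp add: wunit_sel)
  next
    case 4
    show ?case
    proof (rule natural_iso_IdeI)
      show "is_functor ?W3 ?W
        (\<lambda>((X, Y), Z). ?T (X, ?T (Y, Z))) (\<lambda>((f, g), h). ?t (f, ?t (g, h)))"
      proof (rule is_functorI[OF category_prod_cat[OF category_prod_cat[OF category_wishart category_wishart] category_wishart] category_wishart])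
        fix u v P Q R assume "u \<in> Hom ?W3 P Q" "v \<in> Hom ?W3 Q R"
        then have f: "fst (fst u) \<in> Hom ?W (fst (fst P)) (fst (fst Q))" "fst (fst v) \<in> Hom ?W (fst (fst Q)) (fst (fst R))"
          and g: "snd (fst u) \<in> Hom ?W (snd (fst P)) (snd (fst Q))" "snd (fst v) \<in> Hom ?W (snd (fst Q)) (snd (fst R))"
          and h: "snd u \<in> Hom ?W (snd P) (snd Q)" "snd v \<in> Hom ?W (snd Q) (snd R)"
          unfolding Hom_prod_cat_iff by auto
        show "(\<lambda>((f, g), h). ?t (f, ?t (g, h))) (v \<cdot>\<^bsub>?W3\<^esub> u) =
          (\<lambda>((f, g), h). ?t (f, ?t (g, h))) v \<cdot>\<^bsub>?W\<^esub> (\<lambda>((f, g), h). ?t (f, ?t (g, h))) u"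
          using wtensor_arr_Cmp[OF f wtensor_arr_Hom[OF g(1) h(1)] wtensor_arr_Hom[OF g(2) h(2)]] wtensor_arr_Cmp[OF g h]
          by (simp add: case_prod_unfold)
      qed (auto simp: Hom_prod_cat_iff T_obj T_ide intro!: wtensor_arr_Hom)
    next
      fix u P Q assume u: "u \<in> Hom ?W3 P Q"
      show "(\<lambda>((f, g), h). ?t (?t (f, g), h)) u = (\<lambda>((f, g), h). ?t (f, ?t (g, h))) u"
        using u assoc_arr[of "fst (fst u)" "fst (fst P)" "fst (fst Q)" "snd (fst u)" "snd (fst P)" "snd (fst Q)" "snd u" "snd P" "snd Q"]
        unfolding Hom_prod_cat_iff by (simp add: case_prod_unfold)
    qed (auto simp: wassoc_eq wtensor_obj_assoc)
  next
    case 5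
    show ?case
      by (rule natural_iso_IdeI[OF id_functor]) (simp_all add: wtensor_obj_unit unit_arr wlunit_eq)
  next
    case 6
    show ?case
      by (rule natural_iso_IdeI[OF id_functor]) (simp_all add: wtensor_obj_unit unit_arr wrunit_eq)
  next
    case 7
    show ?case
    proof (rule natural_isoI[OF is_functor_wtensor])
      show "is_functor ?W2 ?W (\<lambda>(X, Y). ?T (Y, X)) (\<lambda>(f, g). ?t (g, f))"
      proof (rule is_functorI[OF category_prod_cat[OF category_wishart category_wishart] category_wishart])
        fix u v P Q R assume "u \<in> Hom ?W2 P Q" "v \<in> Hom ?W2 Q R"
        then have "fst u \<in> Hom ?W (fst P) (fst Q)" "fst v \<in> Hom ?W (fst Q) (fst R)"
          "snd u \<in> Hom ?W (snd P) (snd Q)" "snd v \<in> Hom ?W (snd Q) (snd R)"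
          unfolding Hom_prod_cat_iff by auto
        then show "(\<lambda>(f, g). ?t (g, f)) (v \<cdot>\<^bsub>?W2\<^esub> u) =
          (\<lambda>(f, g). ?t (g, f)) v \<cdot>\<^bsub>?W\<^esub> (\<lambda>(f, g). ?t (g, f)) u"
          using wtensor_arr_Cmp[of "snd u" "snd P" "snd Q" "snd v" "snd R" "fst u" "fst P" "fst Q" "fst v" "fst R"]
          by (simp add: case_prod_unfold)
      qed (auto simp: Hom_prod_cat_iff T_obj T_ide intro: wtensor_arr_Hom)
    next
      fix P assume "P \<in> Obj ?W2"
      then obtain X Y where P: "P = (X, Y)" "X \<in> ?O" "Y \<in> ?O" by auto
      then show "(\<lambda>(X, Y). wbraid X Y) P \<in> Hom ?W (?T P) ((\<lambda>(X, Y). ?T (Y, X)) P)"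
        by (simp add: wbraid_Hom)
      show "iso_arrow ?W ((\<lambda>(X, Y). wbraid X Y) P)"
        using P wbraid_inverse_arrows[OF P(2,3)] by (auto simp: iso_arrow_def)
    next
      fix u P Q assume u: "u \<in> Hom ?W2 P Q"
      obtain f g X Y X' Y' where p: "u = (f, g)" "P = (X, Y)" "Q = (X', Y')" by (metis surj_pair)
      have f: "f \<in> Hom ?W X X'" and g: "g \<in> Hom ?W Y Y'"
        using u unfolding p Hom_prod_cat_iff by auto
      obtain A where A: "f = WArrow X A X'" "A \<in> carrier_mat (wdim X') (wdim X)" using Hom_wishartE[OF f] by metis
      obtain B where B: "g = WArrow Y B Y'" "B \<in> carrier_mat (wdim Y') (wdim Y)" using Hom_wishartE[OF g] by metis
      show "(\<lambda>(f, g). ?t (g, f)) u \<cdot>\<^bsub>?W\<^esub> (\<lambda>(X, Y). wbraid X Y) P = (\<lambda>(X, Y). wbraid X Y) Q \<cdot>\<^bsub>?W\<^esub> ?t u"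
        by (simp add: p A(1) B(1) wtensor_arr_def wbraid_def wishart_cat_sel(3) swap_mat_dsum[OF A(2) B(2)])
    qed
  next
    case (8 X Y Z U)
    then show ?case by (simp add: wassoc_eq T_obj T_ide wtensor_obj_assoc Ide_Ide)
  next
    case (9 X Y)
    then show ?case
      by (simp add: wassoc_eq wlunit_eq wrunit_eq wunit_sel T_obj T_ide wtensor_obj_unit Ide_Ide)
  next
    case (10 X Y Z)
    then have o: "X \<in> ?O" "Y \<in> ?O" "Z \<in> ?O" by simp_all
    have XYZ: "wbraid X (?T (Y, Z)) \<in> Hom ?W (?T (?T (X, Y), Z)) (?T (Y, ?T (Z, X)))"
      using wbraid_Hom[of X "?T (Y, Z)"] o by (simp add: T_obj wtensor_obj_assoc)
    have s1: "?t (Ide ?W Y, wbraid X Z) \<in> Hom ?W (?T (Y, ?T (X, Z))) (?T (Y, ?T (Z, X)))"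
      by (rule wtensor_arr_Hom[OF Ide_Hom[OF o(2)] wbraid_Hom[OF o(1,3)]])
    \<comment> \<open>The associators are identities and disappear, which leaves the matrix identity
      \<open>swap_mat_hexagon\<close>.\<close>
    have "wassoc Y Z X \<cdot>\<^bsub>?W\<^esub> wbraid X (?T (Y, Z)) \<cdot>\<^bsub>?W\<^esub> wassoc X Y Z = wbraid X (?T (Y, Z))"
      using W.Cmp_Ide_left[OF XYZ] W.Cmp_Ide_right[OF XYZ] o by (simp add: wassoc_eq wtensor_obj_assoc)
    also have "\<dots> = ?t (Ide ?W Y, wbraid X Z) \<cdot>\<^bsub>?W\<^esub> ?t (wbraid X Y, Ide ?W Z)"
      using o by (simp add: wbraid_def wtensor_arr_def wishart_cat_sel(2,3) wtensor_obj_sel T_obj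
          wtensor_obj_assoc swap_mat_hexagon)
    also have "\<dots> = ?t (Ide ?W Y, wbraid X Z) \<cdot>\<^bsub>?W\<^esub> wassoc Y X Z \<cdot>\<^bsub>?W\<^esub> ?t (wbraid X Y, Ide ?W Z)"
      using W.Cmp_Ide_right[OF s1] o by (simp add: wassoc_eq)
    finally show ?case .
  next
    case (11 X Y)
    then show ?case using wbraid_inverse_arrows[of X Y] by (simp add: inverse_arrows_def wbraid_def)
  next
    case (12 X)
    then have X: "X \<in> ?O" by simp
    have "wbraid X wunit = Ide ?W X"
      using X by (simp add: wbraid_def wunit_sel wtensor_obj_unit swap_mat_zero wishart_cat_sel(2))
    moreover have "inv_arrow ?W (wlunit X) = Ide ?W X"
      using W.inv_arrow_eq W.inverse_arrows_Ide X by (simp add: wlunit_eq)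
    ultimately show ?case using X by (simp add: wrunit_eq Ide_Ide)
  qed
qed

text \<open>\<open>distributed\<close> includes that the law of \<open>W\<close> is the density
  measure \<open>wishart p n \<Sigma>\<close>, so the claim on random variables follows from the one
  on image measures.\<close>

lemma has_wishart_congr:
  assumes \<Sigma>: "\<Sigma> \<in> pd_mats p" and n: "p \<le> n" and A: "A \<in> carrier_mat q p"
    and pd: "congr A \<Sigma> \<in> pd_mats q" and W: "has_wishart M W p n \<Sigma>"
  shows "has_wishart M (\<lambda>\<omega>. A * W \<omega> * A\<^sup>T) q n (congr A \<Sigma>)"
proof -
  have M: "prob_space M" and Wm: "W \<in> measurable M (sym_lborel p)" and W_distr: "distr M (sym_lborel p) W = wishart p n \<Sigma>"
    using W by (auto simp: has_wishart_def distributed_def wishart_def)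
  have "distr M (sym_lborel q) (\<lambda>\<omega>. A * W \<omega> * A\<^sup>T) = distr (distr M (sym_lborel p) W) (sym_lborel q) (congr A)"
    by (simp add: distr_distr[OF measurable_congr_mat[OF A] Wm] o_def)
  also have "\<dots> = wishart q n (congr A \<Sigma>)"
    unfolding W_distr by (rule distr_wishart_congr[OF \<Sigma> n A pd])
  finally show ?thesis
    using M measurable_compose[OF Wm measurable_congr_mat[OF A]] measurable_wishart_density[OF pd]
    by (simp add: has_wishart_def distributed_def wishart_def)
qed

lemma congr_congr_assoc:
  assumes A: "(A :: real mat) \<in> carrier_mat q p" and B: "B \<in> carrier_mat r q" and W: "W \<in> carrier_mat p p"
  shows "B * A * W * (B * A)\<^sup>T = B * A * W * A\<^sup>T * B\<^sup>T"
proof -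
  have AT: "A\<^sup>T \<in> carrier_mat p q" and BT: "B\<^sup>T \<in> carrier_mat q r" using A B by auto
  show ?thesis
    unfolding transpose_mult[OF B A]
    by (rule assoc_mult_mat[symmetric, OF mult_carrier_mat[OF mult_carrier_mat[OF B A] W] AT BT])
qed

theorem theorem1:
  shows
    "symmetric_monoidal_category wishart_cat wtensor_obj wtensor_arr wunit
       wassoc wlunit wrunit wbraid
   \<and> (\<forall>X \<in> Obj wishart_cat. prob_space X)
   \<and> (\<forall>p n \<Sigma> q A (M :: 'w measure) W.
        wishart_param p n \<Sigma> \<and> A \<in> carrier_mat q p \<and> wishart_param q n (A * \<Sigma> * A\<^sup>T) \<longrightarrow>
          WArrow (wishart p n \<Sigma>) A (wishart q n (A * \<Sigma> * A\<^sup>T))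
            \<in> Hom wishart_cat (wishart p n \<Sigma>) (wishart q n (A * \<Sigma> * A\<^sup>T)) \<and>
          (has_wishart M W p n \<Sigma> \<longrightarrow>
             has_wishart M (\<lambda>\<omega>. A * W \<omega> * A\<^sup>T) q n (A * \<Sigma> * A\<^sup>T)))
   \<and> (\<forall>p n \<Sigma>. wishart_param p n \<Sigma> \<longrightarrow>
        Ide wishart_cat (wishart p n \<Sigma>) = WArrow (wishart p n \<Sigma>) (1\<^sub>m p) (wishart p n \<Sigma>))
   \<and> (\<forall>p n \<Sigma> q A r B.
        wishart_param p n \<Sigma> \<and>
        A \<in> carrier_mat q p \<and> wishart_param q n (A * \<Sigma> * A\<^sup>T) \<and>
        B \<in> carrier_mat r q \<and> wishart_param r n (B * A * \<Sigma> * A\<^sup>T * B\<^sup>T) \<longrightarrow>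
          WArrow (wishart q n (A * \<Sigma> * A\<^sup>T)) B (wishart r n (B * A * \<Sigma> * A\<^sup>T * B\<^sup>T))
            \<cdot>\<^bsub>wishart_cat\<^esub> WArrow (wishart p n \<Sigma>) A (wishart q n (A * \<Sigma> * A\<^sup>T))
          = WArrow (wishart p n \<Sigma>) (B * A) (wishart r n (B * A * \<Sigma> * A\<^sup>T * B\<^sup>T)) \<and>
          WArrow (wishart p n \<Sigma>) (B * A) (wishart r n (B * A * \<Sigma> * A\<^sup>T * B\<^sup>T))
            \<in> Hom wishart_cat (wishart p n \<Sigma>) (wishart r n (B * A * \<Sigma> * A\<^sup>T * B\<^sup>T)) \<and>
          (\<forall>V \<in> sym_mats p. (B * A) * V * (B * A)\<^sup>T = B * (A * V * A\<^sup>T) * B\<^sup>T \<and>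
             (B * A) * V * (B * A)\<^sup>T = B * A * V * A\<^sup>T * B\<^sup>T))
   \<and> (\<forall>p1 n1 \<Sigma>1 p2 n2 \<Sigma>2.
        wishart_param p1 n1 \<Sigma>1 \<and> wishart_param p2 n2 \<Sigma>2 \<longrightarrow>
          wtensor_obj (wishart p1 n1 \<Sigma>1, wishart p2 n2 \<Sigma>2)
            = wishart (p1 + p2) (n1 + n2) (\<Sigma>1 \<oplus>\<^sub>m \<Sigma>2))
   \<and> (\<forall>p1 n1 \<Sigma>1 q1 A1 p2 n2 \<Sigma>2 q2 A2.
        wishart_param p1 n1 \<Sigma>1 \<and> A1 \<in> carrier_mat q1 p1 \<and>
        wishart_param q1 n1 (A1 * \<Sigma>1 * A1\<^sup>T) \<and>
        wishart_param p2 n2 \<Sigma>2 \<and> A2 \<in> carrier_mat q2 p2 \<and>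
        wishart_param q2 n2 (A2 * \<Sigma>2 * A2\<^sup>T) \<longrightarrow>
          wtensor_arr
            (WArrow (wishart p1 n1 \<Sigma>1) A1 (wishart q1 n1 (A1 * \<Sigma>1 * A1\<^sup>T)),
             WArrow (wishart p2 n2 \<Sigma>2) A2 (wishart q2 n2 (A2 * \<Sigma>2 * A2\<^sup>T)))
          = WArrow (wishart (p1 + p2) (n1 + n2) (\<Sigma>1 \<oplus>\<^sub>m \<Sigma>2)) (A1 \<oplus>\<^sub>m A2)
              (wishart (q1 + q2) (n1 + n2)
                 ((A1 \<oplus>\<^sub>m A2) * (\<Sigma>1 \<oplus>\<^sub>m \<Sigma>2) * (A1 \<oplus>\<^sub>m A2)\<^sup>T)))
   \<and> (\<forall>X \<in> Obj wishart_cat. isomorphic wishart_cat (wtensor_obj (X, wunit)) X)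
   \<and> (\<forall>p1 n1 \<Sigma>1 p2 n2 \<Sigma>2.
        wishart_param p1 n1 \<Sigma>1 \<and> wishart_param p2 n2 \<Sigma>2 \<longrightarrow>
          wbraid (wishart p1 n1 \<Sigma>1) (wishart p2 n2 \<Sigma>2)
            = WArrow (wishart (p1 + p2) (n1 + n2) (\<Sigma>1 \<oplus>\<^sub>m \<Sigma>2)) (swap_mat p1 p2)
                (wishart (p2 + p1) (n2 + n1) (\<Sigma>2 \<oplus>\<^sub>m \<Sigma>1)) \<and>
          swap_mat p1 p2 * (\<Sigma>1 \<oplus>\<^sub>m \<Sigma>2) * (swap_mat p1 p2)\<^sup>T = \<Sigma>2 \<oplus>\<^sub>m \<Sigma>1)"
proof (intro conjI allI impI ballI, goal_cases)
  case 1
  show ?case by (rule symmetric_monoidal_wishart)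
next
  case (2 X)
  then have "wishart_param (wdim X) (wdof X) (wscale X)" and X: "X = wishart (wdim X) (wdof X) (wscale X)"
    by (simp_all add: wishart_objects_iff)
  then have "prob_space (wishart (wdim X) (wdof X) (wscale X))"
    by (intro prob_space_wishart) (simp_all add: wishart_param_iff)
  then show ?case by (rule ssubst[OF X])
next
  case (3 p n \<Sigma> q A M W)
  then show ?case by (intro Hom_wishartI) (simp_all add: wishart_sel wishart_in_objects)
next
  case (4 p n \<Sigma> q A M W)
  then show ?case by (intro has_wishart_congr) (simp_all add: wishart_param_iff)
next
  case (5 p n \<Sigma>)
  then show ?case by (simp add: wishart_sel)
next
  case (6 p n \<Sigma> q A r B)
  show ?case by simp
next
  case (7 p n \<Sigma> q A r B)
  then have h: "wishart_param p n \<Sigma>" "wishart_param r n (B * A * \<Sigma> * A\<^sup>T * B\<^sup>T)"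
    "A \<in> carrier_mat q p" "B \<in> carrier_mat r q" by auto
  then have \<Sigma>: "\<Sigma> \<in> carrier_mat p p" by (simp add: wishart_param_iff pd_mats_carrier)
  show ?case
  proof (rule Hom_wishartI)
    show "wscale (wishart r n (B * A * \<Sigma> * A\<^sup>T * B\<^sup>T)) = congr (B * A) (wscale (wishart p n \<Sigma>))"
      unfolding wishart_sel[OF h(1)] wishart_sel[OF h(2)] congr_congr_assoc[OF h(3,4) \<Sigma>] ..
  qed (use h in \<open>simp_all add: wishart_sel wishart_in_objects\<close>)
next
  case (8 p n \<Sigma> q A r B V)
  then show ?case by (intro congr_congr[of A q p B r]) (simp_all add: sym_mats_carrier)
next
  case (9 p n \<Sigma> q A r B V)
  then show ?case by (intro congr_congr_assoc[of A q p B r]) (simp_all add: sym_mats_carrier)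
next
  case (10 p1 n1 \<Sigma>1 p2 n2 \<Sigma>2)
  then show ?case by (simp add: wtensor_obj_def wishart_sel)
next
  case (11 p1 n1 \<Sigma>1 q1 A1 p2 n2 \<Sigma>2 q2 A2)
  \<comment> \<open>\<open>wtensor_arr\<close> tensors the two targets separately; this equation
    identifies the result with the congruence by the block sum.\<close>
  then have "congr (A1 \<oplus>\<^sub>m A2) (\<Sigma>1 \<oplus>\<^sub>m \<Sigma>2) = congr A1 \<Sigma>1 \<oplus>\<^sub>m congr A2 \<Sigma>2"
    by (intro dsum_mat_congr[of _ _ p1 _ _ p2]) (auto simp: wishart_param_iff pd_mats_carrier)
  with 11 show ?case
    by (simp only:) (simp add: wtensor_arr_def wtensor_obj_def wishart_sel)
next
  case (12 X)
  \<comment> \<open>Tensoring with the unit returns \<open>X\<close> itself, so the identity serves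
    as the isomorphism.\<close>
  then have X: "X \<in> Obj wishart_cat" "wtensor_obj (X, wunit) = X" by (simp_all add: wtensor_obj_unit)
  interpret category wishart_cat by (rule category_wishart)
  show ?case
    unfolding X(2) isomorphic_def iso_arrow_def using Ide_Hom[OF X(1)] inverse_arrows_Ide[OF X(1)] by blast
next
  case (13 p1 n1 \<Sigma>1 p2 n2 \<Sigma>2)
  then show ?case by (simp add: wbraid_def wtensor_obj_def wishart_sel)
next
  case (14 p1 n1 \<Sigma>1 p2 n2 \<Sigma>2)
  then show ?case by (intro swap_mat_congr) (simp_all add: wishart_param_iff pd_mats_carrier)
qed

end
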